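(* Let $M$ be a $3$-connected matroid with no $4$-element fans and no $\Theta$-separators. If $M$ has exactly four elastic elements, then $M$ has path-width three.
   Context: An element $e$ of a $3$-connected matroid $M$ is elastic if ${\rm si}(M/e)$ (the simplification of $M/e$) and ${\rm co}(M\backslash e)$ (the cosimplification of $M\backslash e$) are both $3$-connected. A set $X$ is $3$-separating if $r(X)+r(E(M)-X)-r(M)\le 2$. $M$ has path-width three if there is an ordering $(e_1,\dots,e_n)$ of $E(M)$ such that $\{e_1,\dots,e_i\}$ is $3$-separating for all $i$. A fan is a set of at least three elements with an ordering $(f_1,\dots,f_k)$ such that each $\{f_i,f_{i+1},f_{i+2}\}$ is a triangle or triad, alternately. For $n\ge 2$, $\Theta_n$ is the matroid on $W=\{w_1,\dots,w_n\}\sqcup Z=\{z_1,\dots,z_n\}$ with circuits: all $3$-subsets of $W$; all $(Z-\{z_i\})\cup\{w_i\}$; all $(Z-\{z_i\})\cup\{w_j,w_k\}$ for distinct $i,j,k$; $\Theta_n^-=\Theta_n\backslash w_i$. For $3$-connected $M$ with $r(M),r^*(M)\ge 4$, if $W$ is a rank-$2$ set and $Z$ a corank-$2$ set with $n=\max\{|W|,|Z|\}\ge3$, then $W\cup Z$ is a $\Theta$-separator if $M|(W\cup Z)$ or $M^*|(W\cup Z)$ is isomorphic to $\Theta_n$ or $\Theta_n^-$ (matroids of rank or corank less than four have no $\Theta$-separators). *)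

theory Defs
  imports Main
begin

section \<open>Finite matroids\<close>

record 'a matroid =
  ground :: "'a set"
  indep_sets :: "'a set set"

locale matroid =
  fixes M :: "'a matroid"
  assumes finite_ground: "finite (ground M)"
    and indep_subset_ground: "I \<in> indep_sets M \<Longrightarrow> I \<subseteq> ground M"
    and indep_empty: "{} \<in> indep_sets M"
    and indep_hereditary: "J \<in> indep_sets M \<Longrightarrow> I \<subseteq> J \<Longrightarrow> I \<in> indep_sets M"
    and indep_augment: "I \<in> indep_sets M \<Longrightarrow> J \<in> indep_sets M \<Longrightarrow> card I < card J
      \<Longrightarrow> \<exists>x \<in> J - I. insert x I \<in> indep_sets M"

definition basis :: "'a matroid \<Rightarrow> 'a set \<Rightarrow> bool" where
  "basis M B \<longleftrightarrow> B \<in> indep_sets M \<and> (\<forall>I \<in> indep_sets M. B \<subseteq> I \<longrightarrow> I = B)"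

definition circuit :: "'a matroid \<Rightarrow> 'a set \<Rightarrow> bool" where
  "circuit M C \<longleftrightarrow> C \<subseteq> ground M \<and> C \<notin> indep_sets M \<and> (\<forall>D. D \<subset> C \<longrightarrow> D \<in> indep_sets M)"

definition rk :: "'a matroid \<Rightarrow> 'a set \<Rightarrow> nat" where
  "rk M X = Max (card ` {I \<in> indep_sets M. I \<subseteq> X})"

definition dual_matroid :: "'a matroid \<Rightarrow> 'a matroid" where
  "dual_matroid M =
    \<lparr>ground = ground M,
     indep_sets = {I. I \<subseteq> ground M \<and> (\<exists>B. basis M B \<and> I \<inter> B = {})}\<rparr>"

abbreviation cork :: "'a matroid \<Rightarrow> 'a set \<Rightarrow> nat" where
  "cork M \<equiv> rk (dual_matroid M)"

abbreviation cocircuit :: "'a matroid \<Rightarrow> 'a set \<Rightarrow> bool" where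
  "cocircuit M \<equiv> circuit (dual_matroid M)"

definition restrict_matroid :: "'a matroid \<Rightarrow> 'a set \<Rightarrow> 'a matroid" where
  "restrict_matroid M X =
    \<lparr>ground = ground M \<inter> X, indep_sets = {I \<in> indep_sets M. I \<subseteq> X}\<rparr>"

definition delete_matroid :: "'a matroid \<Rightarrow> 'a set \<Rightarrow> 'a matroid" where
  "delete_matroid M X = restrict_matroid M (ground M - X)"

definition contract_matroid :: "'a matroid \<Rightarrow> 'a set \<Rightarrow> 'a matroid" where
  "contract_matroid M X = dual_matroid (delete_matroid (dual_matroid M) X)"

definition matroid_iso :: "'a matroid \<Rightarrow> 'b matroid \<Rightarrow> bool" where
  "matroid_iso M N \<longleftrightarrow> (\<exists>f. bij_betw f (ground M) (ground N) \<and>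
     (\<forall>X \<subseteq> ground M. X \<in> indep_sets M \<longleftrightarrow> f ` X \<in> indep_sets N))"

definition matroid_of_circuits :: "'a set \<Rightarrow> 'a set set \<Rightarrow> 'a matroid" where
  "matroid_of_circuits E \<C> =
    \<lparr>ground = E, indep_sets = {I. I \<subseteq> E \<and> \<not> (\<exists>C \<in> \<C>. C \<subseteq> I)}\<rparr>"

section \<open>Simplification and cosimplification\<close>

definition loop :: "'a matroid \<Rightarrow> 'a \<Rightarrow> bool" where
  "loop M x \<longleftrightarrow> circuit M {x}"

definition parallel_rel :: "'a matroid \<Rightarrow> ('a \<times> 'a) set" where
  "parallel_rel M = {(x, y). x \<in> ground M \<and> y \<in> ground M \<and> \<not> loop M x \<and> \<not> loop M y \<and>
     (x = y \<or> circuit M {x, y})}"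

definition parallel_classes :: "'a matroid \<Rightarrow> 'a set set" where
  "parallel_classes M = {x \<in> ground M. \<not> loop M x} // parallel_rel M"

text \<open>
  The simplification is only determined up to isomorphism: all loops are deleted, and one
  (arbitrarily chosen) element of each parallel class is kept.
\<close>

definition simplification :: "'a matroid \<Rightarrow> 'a matroid" where
  "simplification M = restrict_matroid M ((\<lambda>P. SOME x. x \<in> P) ` parallel_classes M)"

definition cosimplification :: "'a matroid \<Rightarrow> 'a matroid" where
  "cosimplification M = dual_matroid (simplification (dual_matroid M))"

section \<open>Connectivity\<close>

definition connectivity :: "'a matroid \<Rightarrow> 'a set \<Rightarrow> int" where
  "connectivity M X =
    int (rk M X) + int (rk M (ground M - X)) - int (rk M (ground M))"

definition separating :: "nat \<Rightarrow> 'a matroid \<Rightarrow> 'a set \<Rightarrow> bool" where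
  "separating k M X \<longleftrightarrow> X \<subseteq> ground M \<and> connectivity M X \<le> int k - 1"

definition separation :: "nat \<Rightarrow> 'a matroid \<Rightarrow> 'a set \<Rightarrow> 'a set \<Rightarrow> bool" where
  "separation k M X Y \<longleftrightarrow> X \<union> Y = ground M \<and> X \<inter> Y = {} \<and>
     k \<le> card X \<and> k \<le> card Y \<and> separating k M X"

definition n_connected :: "nat \<Rightarrow> 'a matroid \<Rightarrow> bool" where
  "n_connected n M \<longleftrightarrow> (\<forall>k X Y. 1 \<le> k \<and> k < n \<longrightarrow> \<not> separation k M X Y)"

abbreviation three_connected :: "'a matroid \<Rightarrow> bool" where
  "three_connected \<equiv> n_connected 3"

definition elastic :: "'a matroid \<Rightarrow> 'a \<Rightarrow> bool" where
  "elastic M e \<longleftrightarrow> e \<in> ground M \<and>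
     three_connected (simplification (contract_matroid M {e})) \<and>
     three_connected (cosimplification (delete_matroid M {e}))"

definition path_width_three :: "'a matroid \<Rightarrow> bool" where
  "path_width_three M \<longleftrightarrow> (\<exists>es. distinct es \<and> set es = ground M \<and>
     (\<forall>i \<in> {1..length es}. separating 3 M (set (take i es))))"

section \<open>Fans\<close>

definition triangle :: "'a matroid \<Rightarrow> 'a set \<Rightarrow> bool" where
  "triangle M T \<longleftrightarrow> circuit M T \<and> card T = 3"

definition triad :: "'a matroid \<Rightarrow> 'a set \<Rightarrow> bool" where
  "triad M T \<longleftrightarrow> cocircuit M T \<and> card T = 3"

definition fan_ordering :: "'a matroid \<Rightarrow> 'a list \<Rightarrow> bool" where
  "fan_ordering M fs \<longleftrightarrow> distinct fs \<and> 3 \<le> length fs \<and>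
     ((\<forall>i. i + 2 < length fs \<longrightarrow>
         (if even i then triangle M {fs ! i, fs ! (i + 1), fs ! (i + 2)}
          else triad M {fs ! i, fs ! (i + 1), fs ! (i + 2)})) \<or>
      (\<forall>i. i + 2 < length fs \<longrightarrow>
         (if even i then triad M {fs ! i, fs ! (i + 1), fs ! (i + 2)}
          else triangle M {fs ! i, fs ! (i + 1), fs ! (i + 2)})))"

definition fan :: "'a matroid \<Rightarrow> 'a set \<Rightarrow> bool" where
  "fan M F \<longleftrightarrow> (\<exists>fs. set fs = F \<and> fan_ordering M fs)"

section \<open>Theta separators\<close>

datatype theta_elem = Theta_w nat | Theta_z nat

definition theta_W :: "nat \<Rightarrow> theta_elem set" where
  "theta_W n = Theta_w ` {1..n}"

definition theta_Z :: "nat \<Rightarrow> theta_elem set" where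
  "theta_Z n = Theta_z ` {1..n}"

definition theta_circuits :: "nat \<Rightarrow> theta_elem set set" where
  "theta_circuits n =
     {C. C \<subseteq> theta_W n \<and> card C = 3} \<union>
     {(theta_Z n - {Theta_z i}) \<union> {Theta_w i} | i. i \<in> {1..n}} \<union>
     {(theta_Z n - {Theta_z i}) \<union> {Theta_w j, Theta_w k} | i j k.
        i \<in> {1..n} \<and> j \<in> {1..n} \<and> k \<in> {1..n} \<and> i \<noteq> j \<and> i \<noteq> k \<and> j \<noteq> k}"

definition theta :: "nat \<Rightarrow> theta_elem matroid" where
  "theta n = matroid_of_circuits (theta_W n \<union> theta_Z n) (theta_circuits n)"

definition theta_minus :: "nat \<Rightarrow> nat \<Rightarrow> theta_elem matroid" where
  "theta_minus n i = delete_matroid (theta n) {Theta_w i}"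

definition theta_or_theta_minus :: "nat \<Rightarrow> 'a matroid \<Rightarrow> bool" where
  "theta_or_theta_minus n N \<longleftrightarrow>
     matroid_iso N (theta n) \<or> (\<exists>i \<in> {1..n}. matroid_iso N (theta_minus n i))"

definition theta_separator :: "'a matroid \<Rightarrow> 'a set \<Rightarrow> bool" where
  "theta_separator M S \<longleftrightarrow>
     three_connected M \<and> 4 \<le> rk M (ground M) \<and> 4 \<le> cork M (ground M) \<and>
     (\<exists>W Z n. W \<subseteq> ground M \<and> Z \<subseteq> ground M \<and> S = W \<union> Z \<and>
        rk M W = 2 \<and> cork M Z = 2 \<and> n = max (card W) (card Z) \<and> 3 \<le> n \<and>
        (theta_or_theta_minus n (restrict_matroid M S) \<or>
         theta_or_theta_minus n (restrict_matroid (dual_matroid M) S)))"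

end

theory Submission
  imports Defs
begin

text \<open>
  A non-elastic element is the middle of a vertical 3-separation \<open>(X, {e}, Y)\<close> of the matroid or of
  its dual. Uncross such a triple, with \<open>X\<close> minimal among the triples of both kinds, with the triple
  of a non-elastic element of \<open>X\<close>: up to duality, \<open>X\<close> consists of two lines, or meets a long
  line \<open>L\<close> such that \<open>L\<close>, or \<open>L\<close> minus a point, is completed by a single further point to a
  cocircuit. On such a line all but at most one point would carry a cocircuit \<open>(L - w) \<union> z\<^sub>w\<close>, which is a
  \<open>\<Theta>\<close>-separator, unless the line has two elastic elements. Hence every side of every triple has
  at least two elastic elements.

  If there are only four elastic elements, every side has exactly two, and moving an elastic element
  across a triple always yields a contradiction; so all triples split the elastic elements in the same
  way \<open>{a, b} | {c, d}\<close>. The 3-separating sets containing \<open>a, b\<close> and avoiding \<open>c, d\<close> are then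
  closed under union and intersection, and each further element \<open>g\<close> is separated from them by a pair
  \<open>P, P \<union> {g}\<close> of such sets, so a maximal chain adds one element at a time.
\<close>

text \<open>The obstacle is that a non-elastic element may be the middle of a triple of the matroid
  or of the dual, and the two kinds cross each other. Working with an integer rank function
  \<open>r\<close> and with \<open>drk E r\<close> makes duality an involution on one parameter:
  each locale is interpreted again at the dual, and \<open>lam\<close> is the same for both, so
  triples of different kinds can be uncrossed.

  The number four makes counting rigid. Both sides of a triple hold at least two elements of
  \<open>elast\<close>, so with at most four in all each side holds exactly two, and shifting one
  across would leave a side with one. The count passes from the matroid to rank functions through
  the inclusion of \<open>elast\<close> in the set of elastic elements.

  Fans enter through one pattern, a triangle and a triad sharing two elements; it removes the
  configurations that are too small to contain a long line.

  Sets that contain \<open>a\<close>, \<open>b\<close> and avoid \<open>c\<close>, \<open>d\<close>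
  have \<open>lam\<close> at least 2 by 3-connectedness, which is why submodularity makes those with
  \<open>lam\<close> at most 2 closed under union and intersection.\<close>

section \<open>Rank functions and duality\<close>

text \<open>Intersecting with \<open>E\<close> makes \<open>drk E (drk E r) = r\<close> hold on all sets, not only on subsets of \<open>E\<close>.\<close>
definition drk :: "'a set \<Rightarrow> ('a set \<Rightarrow> int) \<Rightarrow> 'a set \<Rightarrow> int" where
  "drk E r X = int (card (X \<inter> E)) + r (E - X) - r E"

text \<open>A vertical 3-separation \<open>(X, {e}, Y)\<close>; instantiating \<open>r\<close> with the dual rank gives the cyclic ones.\<close>
definition vtriple :: "'a set \<Rightarrow> ('a set \<Rightarrow> int) \<Rightarrow> 'a set \<Rightarrow> 'a \<Rightarrow> 'a set \<Rightarrow> bool" where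
  "vtriple E r X e Y \<longleftrightarrow> insert e (X \<union> Y) = E \<and> e \<notin> X \<and> e \<notin> Y \<and> X \<inter> Y = {} \<and>
     3 \<le> r X \<and> 3 \<le> r Y \<and> r (insert e X) = r X \<and> r (insert e Y) = r Y \<and> r X + r Y = r E + 2"

text \<open>Elasticity in terms of triples, symmetric in \<open>r\<close> and its dual. That these
  elements are elastic follows by lifting separations of the simplification and, dually, of the
  cosimplification.\<close>

definition elast :: "'a set \<Rightarrow> ('a set \<Rightarrow> int) \<Rightarrow> 'a set" where
  "elast E r = {e \<in> E. \<forall>X Y. \<not> vtriple E r X e Y \<and> \<not> vtriple E (drk E r) X e Y}"

text \<open>The complement of a hyperplane: \<open>E - C\<close> has corank one in the lattice of
  flats and is closed.\<close>

definition cocirc :: "'a set \<Rightarrow> ('a set \<Rightarrow> int) \<Rightarrow> 'a set \<Rightarrow> bool" where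
  "cocirc E r C \<longleftrightarrow> C \<subseteq> E \<and> r (E - C) = r E - 1 \<and> (\<forall>c \<in> C. r (insert c (E - C)) = r E)"

text \<open>
  In this situation the restriction of the dual to \<open>L \<union> z ` A\<close> is \<open>\<Theta>\<^sub>n\<close> or \<open>\<Theta>\<^sub>n\<^sup>-\<close>, where \<open>L\<close> plays
  the role of \<open>Z\<close> and \<open>z ` A\<close> that of \<open>W\<close>.
\<close>
definition theta_config :: "'a set \<Rightarrow> ('a set \<Rightarrow> int) \<Rightarrow> bool" where
  "theta_config E r \<longleftrightarrow> 4 \<le> r E \<and> (\<exists>L A z. L \<subseteq> E \<and> r L = 2 \<and> 4 \<le> card L \<and> A \<subseteq> L \<and>
     card L \<le> card A + 1 \<and> (\<forall>w \<in> A. z w \<in> E - L \<and> cocirc E r (insert (z w) (L - {w}))))"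

text \<open>By \<open>r_Int\<close> the rank is total and ignores elements outside \<open>E\<close>,
  so closure arguments run on arbitrary sets. The equation \<open>r (insert x X) = r X\<close> is
  the encoding of \<open>x\<close> lying in the closure of \<open>X\<close>.\<close>

locale rank_function =
  fixes E :: "'a set" and r :: "'a set \<Rightarrow> int"
  assumes fin: "finite E"
    and r_Int: "r (X \<inter> E) = r X"
    and r_empty: "r {} = 0"
    and r_mono: "X \<subseteq> Y \<Longrightarrow> r X \<le> r Y"
    and r_sub: "r (X \<union> Y) + r (X \<inter> Y) \<le> r X + r Y"
    and r_insert: "r (insert x X) \<le> r X + 1"
begin

abbreviation "rd \<equiv> drk E r"

text \<open>The connectivity function; being 3-separating means
  \<open>lam X \<le> 2\<close>.\<close>

definition lam :: "'a set \<Rightarrow> int" where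
  "lam X = r X + r (E - X) - r E"

lemma r_nonneg: "0 \<le> r X"
  using r_mono[of "{}" X] r_empty by simp

lemma r_le_card: "finite X \<Longrightarrow> r X \<le> int (card X)"
proof (induction X rule: finite_induct)
  case empty
  then show ?case by (simp add: r_empty)
next
  case (insert x F)
  then show ?case using r_insert[of x F] by simp
qed

lemma r_le_insert: "r X \<le> r (insert x X)"
  by (rule r_mono) auto

lemma span_mono: "r (insert x X) = r X \<Longrightarrow> X \<subseteq> Y \<Longrightarrow> r (insert x Y) = r Y"
proof (cases "x \<in> Y")
  case True
  then show ?thesis by (simp add: insert_absorb)
next
  case False
  assume a: "r (insert x X) = r X" "X \<subseteq> Y"
  have "insert x X \<union> Y = insert x Y" "insert x X \<inter> Y = X" using a False by auto
  then show ?thesis using r_sub[of "insert x X" Y] r_le_insert[of Y x] a by simp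
qed

lemma span_Un:
  assumes "finite S" "\<And>x. x \<in> S \<Longrightarrow> r (insert x X) = r X"
  shows "r (X \<union> S) = r X"
  using assms
proof (induction S rule: finite_induct)
  case empty
  then show ?case by simp
next
  case (insert s S)
  have "r (insert s (X \<union> S)) = r (X \<union> S)" by (rule span_mono[of s X]) (use insert in auto)
  then show ?case using insert by simp
qed

lemma span_trans:
  assumes "r (insert x Y) = r Y" "finite Y" "\<And>y. y \<in> Y \<Longrightarrow> r (insert y X) = r X"
  shows "r (insert x X) = r X"
proof -
  have "r (insert x (X \<union> Y)) = r (X \<union> Y)" by (rule span_mono[OF assms(1)]) auto
  moreover have "r (X \<union> Y) = r X" by (rule span_Un) (use assms in auto)
  ultimately show ?thesis
    using r_mono[of "insert x X" "insert x (X \<union> Y)"] r_le_insert[of X x] by force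
qed

lemma not_span_insert: "r (insert x X) \<noteq> r X \<Longrightarrow> r (insert x X) = r X + 1"
  using r_insert[of x X] r_le_insert[of X x] by linarith

lemma lam_submod: "lam (X \<inter> Y) + lam (X \<union> Y) \<le> lam X + lam Y"
proof -
  have "(E - X) \<union> (E - Y) = E - (X \<inter> Y)" "(E - X) \<inter> (E - Y) = E - (X \<union> Y)" by auto
  then show ?thesis using r_sub[of X Y] r_sub[of "E - X" "E - Y"] by (auto simp: lam_def)
qed

lemma lam_compl: "X \<subseteq> E \<Longrightarrow> lam (E - X) = lam X"
  by (simp add: lam_def double_diff)

lemma lam_le_span: "r (insert x X) = r X \<Longrightarrow> lam (insert x X) \<le> lam X"
  using r_mono[of "E - insert x X" "E - X"] by (auto simp: lam_def)

lemma rd_rd: "drk E rd = r"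
proof
  fix X
  have "E - (E - X) = X \<inter> E" by auto
  moreover have "card ((E - X) \<inter> E) + card (X \<inter> E) = card E"
    using card_Int_Diff[OF fin, of X] by (simp add: Int_commute Int_absorb1 Diff_subset)
  ultimately show "drk E rd X = r X"
    using r_Int[of X] by (simp add: drk_def r_empty) 
qed

text \<open>Trades rank for corank once \<open>lam\<close> is bounded: with \<open>lam\<close> equal
  to 2, rank 2 and corank 2 force two elements, and three elements cannot have both rank and corank
  3.\<close>

lemma rd_lam: "X \<subseteq> E \<Longrightarrow> r X + rd X = lam X + int (card X)"
  by (simp add: drk_def lam_def Int_absorb2)

text \<open>Adding \<open>f\<close> to \<open>A\<close> raises the corank by one minus the rise in
  rank when \<open>f\<close> is added to the remaining elements. So closure on one side of
  \<open>f\<close> is complementary to dual closure on the other.\<close>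

lemma rd_span_iff:
  assumes "A \<subseteq> E" "f \<in> E" "f \<notin> A"
  shows "rd (insert f A) = rd A \<longleftrightarrow> r (insert f (E - insert f A)) \<noteq> r (E - insert f A)"
proof -
  define B where "B = E - insert f A"
  have B: "E - A = insert f B" using assms by (auto simp: B_def)
  have "rd (insert f A) = int (card A) + 1 + r B - r E"
    using assms finite_subset[OF _ fin] by (simp add: drk_def B_def Int_absorb2)
  moreover have "rd A = int (card A) + r (insert f B) - r E"
    using assms by (simp add: drk_def B Int_absorb2)
  ultimately show ?thesis
    using not_span_insert[of f B] unfolding B_def[symmetric] by linarith
qed

lemma dual_rank_function: "rank_function E rd"
proof
  show "finite E" by (rule fin)
  fix X Y :: "'a set" and x
  have f: "finite (X \<inter> E)" for X using fin by simp
  show "rd (X \<inter> E) = rd X" by (simp add: drk_def Diff_Int)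
  show "rd {} = 0" by (simp add: drk_def)
  have ins: "rd X \<le> rd (insert x X) \<and> rd (insert x X) \<le> rd X + 1" for x X
  proof (cases "x \<in> E - X")
    case True
    have "insert x (E - insert x X) = E - X" using True by auto
    moreover have "card (insert x X \<inter> E) = card (X \<inter> E) + 1" using True f[of X] by simp
    ultimately show ?thesis
      using r_insert[of x "E - insert x X"] r_mono[of "E - insert x X" "E - X"] by (auto simp: drk_def)
  next
    case False
    then have "insert x X \<inter> E = X \<inter> E" "E - insert x X = E - X" by auto
    then show ?thesis by (simp add: drk_def)
  qed
  then show "rd (insert x X) \<le> rd X + 1" by blast
  have un: "finite S \<Longrightarrow> rd X \<le> rd (X \<union> S)" for X S
  proof (induction S rule: finite_induct)
    case (insert s S)
    then show ?case using ins[of "X \<union> S" s] by simp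
  qed simp
  have e: "rd X = rd (X \<inter> E)" for X by (simp add: drk_def Diff_Int)
  show "rd X \<le> rd Y" if "X \<subseteq> Y"
  proof -
    have "X \<inter> E \<union> Y \<inter> E = Y \<inter> E" using that by auto
    then show ?thesis using un[of "Y \<inter> E" "X \<inter> E"] f[of Y] e by metis
  qed
  have "(E - X) \<union> (E - Y) = E - (X \<inter> Y)" "(E - X) \<inter> (E - Y) = E - (X \<union> Y)" 
     "(X \<union> Y) \<inter> E = X \<inter> E \<union> Y \<inter> E" "X \<inter> Y \<inter> E = (X \<inter> E) \<inter> (Y \<inter> E)" by auto
  then show "rd (X \<union> Y) + rd (X \<inter> Y) \<le> rd X + rd Y"
    using r_sub[of "E - X" "E - Y"] card_Un_Int[OF f[of X] f[of Y]] by (simp add: drk_def)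
qed

lemma dual_lam: "X \<subseteq> E \<Longrightarrow> rank_function.lam E rd X = lam X"
proof -
  assume a: "X \<subseteq> E"
  interpret D: rank_function E rd by (rule dual_rank_function)
  have "E - (E - X) = X" using a by auto
  moreover have "card E = card X + card (E - X)" using a fin
    by (metis card_Diff_subset card_mono finite_subset le_add_diff_inverse)
  ultimately show ?thesis using a unfolding D.lam_def lam_def
    by (simp add: drk_def r_empty Int_absorb2 Int_absorb1 Diff_subset)
qed

lemma elast_dual: "elast E rd = elast E r"
  by (auto simp: elast_def rd_rd)

end

lemma vtriple_sym: "vtriple E r X e Y \<Longrightarrow> vtriple E r Y e X"
  by (auto simp: vtriple_def)

lemma vtriple_mem: "vtriple E r X e Y \<Longrightarrow> x \<in> E \<longleftrightarrow> x = e \<or> x \<in> X \<or> x \<in> Y"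
  by (auto simp: vtriple_def)

lemma vtriple_disj: "vtriple E r X e Y \<Longrightarrow> x \<in> X \<Longrightarrow> x \<notin> Y"
  by (auto simp: vtriple_def)

section \<open>Three-connectedness in terms of rank\<close>

locale tri_connected = rank_function +
  assumes card4: "4 \<le> card E"
    and conn1: "X \<subseteq> E \<Longrightarrow> X \<noteq> {} \<Longrightarrow> X \<noteq> E \<Longrightarrow> r E + 1 \<le> r X + r (E - X)"
    and conn2: "X \<subseteq> E \<Longrightarrow> 2 \<le> card X \<Longrightarrow> 2 \<le> card (E - X) \<Longrightarrow> r E + 2 \<le> r X + r (E - X)"
begin

lemma lam1: "X \<subseteq> E \<Longrightarrow> X \<noteq> {} \<Longrightarrow> X \<noteq> E \<Longrightarrow> 1 \<le> lam X"
  using conn1[of X] by (simp add: lam_def)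

lemma lam2: "X \<subseteq> E \<Longrightarrow> 2 \<le> card X \<Longrightarrow> 2 \<le> card (E - X) \<Longrightarrow> 2 \<le> lam X"
  using conn2[of X] by (simp add: lam_def)

lemma dual_tri_connected: "tri_connected E rd"
proof -
  interpret D: rank_function E rd by (rule dual_rank_function)
  show ?thesis
  proof
    show "4 \<le> card E" by (rule card4)
    fix X assume X: "X \<subseteq> E"
    then have l: "rd X + rd (E - X) - rd E = lam X" using dual_lam unfolding D.lam_def by blast
    show "X \<noteq> {} \<Longrightarrow> X \<noteq> E \<Longrightarrow> rd E + 1 \<le> rd X + rd (E - X)" using lam1[OF X] l by linarith
    show "2 \<le> card X \<Longrightarrow> 2 \<le> card (E - X) \<Longrightarrow> rd E + 2 \<le> rd X + rd (E - X)"
      using lam2[OF X] l by linarith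
  qed
qed

lemma fin_sub: "X \<subseteq> E \<Longrightarrow> finite X"
  using fin finite_subset by blast

lemma card_compl: "X \<subseteq> E \<Longrightarrow> card (E - X) = card E - card X"
  by (simp add: card_Diff_subset fin_sub)

lemma r_pair:
  assumes "x \<in> E" "y \<in> E" "x \<noteq> y"
  shows "r {x, y} = 2"
proof -
  have "card (E - {x,y}) = card E - 2" using assms by (simp add: card_Diff_subset)
  then have "r E + 2 \<le> r {x,y} + r (E - {x,y})" using conn2[of "{x,y}"] assms card4 by simp
  then show ?thesis using r_mono[of "E - {x,y}" E] r_le_card[of "{x,y}"] assms by auto
qed

lemma r_single:
  assumes "x \<in> E" shows "r {x} = 1"
proof -
  have "E \<noteq> {x}" using card4 by auto
  then have "r E + 1 \<le> r {x} + r (E - {x})" using conn1[of "{x}"] assms by auto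
  then show ?thesis using r_mono[of "E - {x}" E] r_le_card[of "{x}"] assms by auto
qed

lemma r_ge2:
  assumes "X \<subseteq> E" "2 \<le> card X" shows "2 \<le> r X"
proof -
  obtain T where "T \<subseteq> X" "card T = 2" using obtain_subset_with_card_n[OF assms(2)] by blast
  then obtain x y where "x \<in> X" "y \<in> X" "x \<noteq> y" by (auto simp: card_2_iff)
  then have "r {x,y} \<le> r X" "r {x,y} = 2" using r_mono[of "{x,y}" X] r_pair assms(1) by auto
  then show ?thesis by simp
qed

lemma card_ge3: "X \<subseteq> E \<Longrightarrow> 3 \<le> r X \<Longrightarrow> 3 \<le> card X"
  using r_le_card[of X] fin_sub by fastforce

text \<open>Two distinct points have rank 2 by \<open>r_pair\<close>, hence span \<open>L\<close>;
  transitivity of closure does the rest.\<close>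

lemma line_span:
  assumes "r L \<le> 2" "L \<subseteq> E" "x \<in> L" "y \<in> L" "x \<noteq> y" "l \<in> L"
    "r (insert x X) = r X" "r (insert y X) = r X"
  shows "r (insert l X) = r X"
proof (rule span_trans[of l "{x,y}"])
  show "r (insert l {x,y}) = r {x,y}"
  proof -
    have "r {x,y} = 2" by (rule r_pair) (use assms in auto)
    then show ?thesis using r_mono[of "insert l {x,y}" L] r_le_insert[of "{x,y}" l] assms by simp
  qed
qed (use assms in auto)

lemma lam_le_card: "X \<subseteq> E \<Longrightarrow> lam X \<le> int (card X)"
  using r_le_card[of X] r_mono[of "E - X" E] fin_sub[of X] by (auto simp: lam_def)

text \<open>Later proofs select these facts by position: 7 and 8 are the rank bounds, 9 and 10 the
  spanning of \<open>e\<close>, 12 to 15 the complements, 18 to 21 the values of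
  \<open>lam\<close>.\<close>

lemma vtripleD:
  assumes "vtriple E r X e Y"
  shows "X \<subseteq> E" "Y \<subseteq> E" "e \<in> E" "e \<notin> X" "e \<notin> Y" "X \<inter> Y = {}" "3 \<le> r X" "3 \<le> r Y"
    "r (insert e X) = r X" "r (insert e Y) = r Y" "r X + r Y = r E + 2"
    "E - X = insert e Y" "E - insert e X = Y" "E - Y = insert e X" "E - insert e Y = X"
    "3 \<le> card X" "3 \<le> card Y" "lam X = 2" "lam Y = 2" "lam (insert e X) = 2" "lam (insert e Y) = 2"
proof -
  show b: "X \<subseteq> E" "Y \<subseteq> E" "e \<in> E" "e \<notin> X" "e \<notin> Y" "X \<inter> Y = {}" "3 \<le> r X" "3 \<le> r Y"
    "r (insert e X) = r X" "r (insert e Y) = r Y" "r X + r Y = r E + 2"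
    "E - X = insert e Y" "E - insert e X = Y" "E - Y = insert e X" "E - insert e Y = X"
    using assms by (auto simp: vtriple_def)
  then show "3 \<le> card X" "3 \<le> card Y" using card_ge3 by auto
  show "lam X = 2" "lam Y = 2" "lam (insert e X) = 2" "lam (insert e Y) = 2"
    unfolding lam_def using b by simp_all
qed

text \<open>Same positions as in \<open>vtripleD\<close>, with ranks taken in the dual but
  \<open>lam\<close> in the primal, so that triples of different kinds can be uncrossed with one
  function.\<close>

lemma vtriple_dualD:
  assumes "vtriple E rd X e Y"
  shows "X \<subseteq> E" "Y \<subseteq> E" "e \<in> E" "e \<notin> X" "e \<notin> Y" "X \<inter> Y = {}" "3 \<le> rd X" "3 \<le> rd Y"
    "rd (insert e X) = rd X" "rd (insert e Y) = rd Y" "rd X + rd Y = rd E + 2"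
    "E - X = insert e Y" "E - insert e X = Y" "E - Y = insert e X" "E - insert e Y = X"
    "3 \<le> card X" "3 \<le> card Y" "lam X = 2" "lam Y = 2" "lam (insert e X) = 2" "lam (insert e Y) = 2"
proof -
  interpret D: tri_connected E rd by (rule dual_tri_connected)
  note d = D.vtripleD[OF assms]
  show "X \<subseteq> E" "Y \<subseteq> E" "e \<in> E" "e \<notin> X" "e \<notin> Y" "X \<inter> Y = {}" "3 \<le> rd X" "3 \<le> rd Y"
    "rd (insert e X) = rd X" "rd (insert e Y) = rd Y" "rd X + rd Y = rd E + 2"
    "E - X = insert e Y" "E - insert e X = Y" "E - Y = insert e X" "E - insert e Y = X"
    "3 \<le> card X" "3 \<le> card Y" by (rule d)+
  show "lam X = 2" "lam Y = 2" "lam (insert e X) = 2" "lam (insert e Y) = 2"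
    using d(18-21) d(1-3) dual_lam by auto
qed

text \<open>Orthogonality: \<open>X\<close> lies in the closed set \<open>E - C\<close>, which
  misses \<open>c\<close>.\<close>

lemma cocirc_not_span:
  assumes "cocirc E r C" "c \<in> C" "X \<subseteq> E" "X \<inter> C = {}"
  shows "r (insert c X) = r X + 1"
proof (rule not_span_insert, rule notI)
  assume "r (insert c X) = r X"
  then have "r (insert c (E - C)) = r (E - C)" by (rule span_mono) (use assms in auto)
  then show False using assms by (auto simp: cocirc_def)
qed

lemma card_ge2I: "X \<subseteq> E \<Longrightarrow> x \<in> X \<Longrightarrow> y \<in> X \<Longrightarrow> x \<noteq> y \<Longrightarrow> 2 \<le> card X"
  using card_mono[of X "{x,y}"] fin_sub by auto

lemma card_ge2E:
  assumes "2 \<le> card X" obtains x y where "x \<in> X" "y \<in> X" "x \<noteq> y"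
proof -
  obtain T where "T \<subseteq> X" "card T = 2" using obtain_subset_with_card_n[OF assms] by blast
  then show ?thesis using that by (auto simp: card_2_iff)
qed

lemma card_lt2: "X \<subseteq> E \<Longrightarrow> \<not> 2 \<le> card X \<Longrightarrow> x \<in> X \<Longrightarrow> X = {x}"
  using card_ge2I[of X] by blast

lemma card_ge3E:
  assumes "3 \<le> card X" obtains x y z where "x \<in> X" "y \<in> X" "z \<in> X" "x \<noteq> y" "x \<noteq> z" "y \<noteq> z"
proof -
  obtain T where "T \<subseteq> X" "card T = 3" using obtain_subset_with_card_n[OF assms] by blast
  then show ?thesis using that by (auto simp: card_3_iff)
qed

section \<open>Long lines\<close>

text \<open>If \<open>P\<close> avoided \<open>L\<close>, it would avoid \<open>C\<close> and could
  not span \<open>g\<close>. So \<open>P\<close> contains a second point of \<open>L\<close>, spans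
  the line and can absorb it; 3-connectedness keeps the rank of what remains of
  \<open>Q\<close>.\<close>

lemma vtriple_absorb_line:
  assumes vt: "vtriple E r P g Q" and L: "L \<subseteq> E" "r L = 2"
    and C: "cocirc E r C" "y \<in> C" "y \<notin> L" "C \<subseteq> insert y L" "g \<in> C" "g \<in> L" and y: "y \<in> Q"
  shows "vtriple E r (P \<union> (L - {g})) g (Q - L)"
proof -
  note v = vtripleD[OF vt]
  have "P \<inter> L \<noteq> {}"
  proof
    assume "P \<inter> L = {}"
    then have "P \<inter> C = {}" using C(4) y v(6) by blast
    then have "r (insert g P) = r P + 1" using cocirc_not_span[OF C(1,5)] v(1) by blast
    then show False using v(9) by simp
  qed
  then obtain p where p: "p \<in> P" "p \<in> L" by auto
  have sp: "r (insert l P) = r P" if "l \<in> L" for l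
    by (rule line_span[of L g p]) (use L C(6) p v(4,9) that in \<open>auto simp: insert_absorb\<close>)
  have PL: "r (P \<union> (L - {g})) = r P" by (rule span_Un) (use sp L fin_sub in auto)
  have PL2: "r (P \<union> L) = r P" by (rule span_Un) (use sp L fin_sub in auto)
  have c2: "2 \<le> card (Q - L)"
  proof (rule ccontr)
    assume "\<not> 2 \<le> card (Q - L)"
    then have "Q - L = {y}" by (rule card_lt2[rotated]) (use v(2) y C(3) in auto)
    then have "Q \<subseteq> insert y L" by blast
    moreover have "E \<subseteq> insert g (P \<union> Q)" using vt by (simp add: vtriple_def)
    ultimately have e: "E - {y} \<subseteq> P \<union> L" using C(6) by blast
    then have "r (E - {y}) \<le> r P" using PL2 r_mono[OF e] by simp
    moreover have "r E + 1 \<le> r {y} + r (E - {y})"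
      by (rule conn1) (use v(2,3,5) y in auto)
    ultimately show False using r_single[of y] v y by auto
  qed
  have QL: "r (Q - L) = r Q"
  proof -
    have e: "E - (Q - L) = P \<union> L" using L(1) C(6) vtriple_disj[OF vt] v(5) by (auto simp: vtriple_mem[OF vt])
    have "2 \<le> card (P \<union> L)"
      by (rule card_ge2I[of _ p g]) (use p C(6) v(1,4) L in auto)
    then have "2 \<le> lam (Q - L)" using lam2[of "Q - L"] e c2 v by auto
    then have "r Q \<le> r (Q - L)" unfolding lam_def e PL2 using v by simp
    then show ?thesis using r_mono[of "Q - L" Q] by auto
  qed
  have "r (insert g (P \<union> (L - {g}))) = r (P \<union> (L - {g}))"
    by (rule span_mono[of g P]) (use v in auto)
  moreover have "r (insert g (Q - L)) = r (Q - L)"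
    using r_mono[of "insert g (Q - L)" "insert g Q"] r_le_insert[of "Q - L" g] QL v by auto
  moreover have "insert g (P \<union> (L - {g}) \<union> (Q - L)) = E" using vt L unfolding vtriple_def by auto
  ultimately show ?thesis unfolding vtriple_def using PL QL v by auto
qed

text \<open>Normal form for a triple with middle on the line: the side without \<open>y\<close>
  absorbs the line.\<close>

lemma vtriple_line:
  assumes vt: "vtriple E r P g Q" and L: "L \<subseteq> E" "r L = 2"
    and C: "cocirc E r C" "y \<in> C" "y \<notin> L" "C \<subseteq> insert y L" "g \<in> C" "g \<in> L"
  obtains P' Q' where "vtriple E r P' g Q'" "L - {g} \<subseteq> P'" "y \<in> Q'" "Q' \<inter> L = {}"
proof -
  have "y \<in> E" "y \<noteq> g" using C by (auto simp: cocirc_def)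
  then consider "y \<in> P" | "y \<in> Q" using vt by (auto simp: vtriple_def)
  then show ?thesis
  proof cases
    case 1
    show ?thesis
      by (rule that[OF vtriple_absorb_line[OF vtriple_sym[OF vt] L C 1]]) (use 1 C in auto)
  next
    case 2
    show ?thesis
      by (rule that[OF vtriple_absorb_line[OF vt L C 2]]) (use 2 C in auto)
  qed
qed

text \<open>Passing from \<open>P\<close> to \<open>P - L\<close> loses at least one in rank, and
  \<open>L\<close> adds at most one to the rank of \<open>Q\<close>, because \<open>Q\<close> spans
  \<open>g\<close> and one further point completes the line. Since \<open>lam (P - L)\<close> is at
  least 2, both changes are exactly one.\<close>

lemma vtriple_line_rank:
  assumes vt: "vtriple E r P g Q" and L: "L \<subseteq> E" "r L = 2" "3 \<le> card L" "L - {g} \<subseteq> P" "Q \<inter> L = {}"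
    and g: "g \<in> L" "r (insert g (P - L)) \<noteq> r (P - L)" and S: "2 \<le> card (P - L)"
  shows "r P = r (P - L) + 1" "r (Q \<union> L) = r Q + 1"
proof -
  note v = vtripleD[OF vt]
  obtain l where l: "l \<in> L" "l \<noteq> g" using L(3)
    by (metis card_ge3E)
  have le1: "r (P - L) + 1 \<le> r P"
    using not_span_insert[OF g(2)] r_mono[of "insert g (P - L)" "insert g P"] v by auto
  have "r (insert x (insert l Q)) = r (insert l Q)" if "x \<in> L" for x
    by (rule line_span[of L g l])
       (use L l g that span_mono[OF v(10), of "insert l Q"] in \<open>auto simp: insert_absorb\<close>)
  then have "r (insert l Q \<union> L) = r (insert l Q)" by (intro span_Un) (use L fin_sub in auto)
  then have le2: "r (Q \<union> L) \<le> r Q + 1" using r_insert[of l Q] r_mono[of "Q \<union> L" "insert l Q \<union> L"] by fastforce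
  have e: "E - (P - L) = Q \<union> L" using L(1) g(1) v(4) vtriple_disj[OF vt] by (auto simp: vtriple_mem[OF vt])
  have "2 \<le> card (Q \<union> L)" by (rule card_ge2I[of _ g l]) (use l g v L in auto)
  then have "2 \<le> lam (P - L)" using lam2[of "P - L"] e S v by auto
  then show "r P = r (P - L) + 1" "r (Q \<union> L) = r Q + 1"
    unfolding lam_def e using le1 le2 v by linarith+
qed

text \<open>Uncrossing the two \<open>P\<close> sides leaves the line and a common part
  \<open>R\<close>, whose connectivity is too small unless \<open>R\<close> is empty. Then
  \<open>P2 - L\<close> lies in \<open>Q1\<close>, so \<open>Q1\<close> spans \<open>L\<close>,
  against \<open>vtriple_line_rank\<close>.\<close>

lemma two_line_triples:
  assumes L: "L \<subseteq> E" "r L = 2" "3 \<le> card L" and cl: "\<And>x. x \<in> E \<Longrightarrow> r (insert x L) = 2 \<Longrightarrow> x \<in> L"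
    and C: "cocirc E r C" "y \<in> C" "y \<notin> L" "C \<subseteq> insert y L" "g1 \<in> C" "g1 \<in> L" "g2 \<in> C" "g2 \<in> L" "g1 \<noteq> g2"
    and v1: "vtriple E r P1 g1 Q1" "L - {g1} \<subseteq> P1" "y \<in> Q1" "Q1 \<inter> L = {}"
    and v2: "vtriple E r P2 g2 Q2" "L - {g2} \<subseteq> P2" "y \<in> Q2" "Q2 \<inter> L = {}"
  shows "card (P1 - L) \<le> 1 \<or> card (P2 - L) \<le> 1"
proof (rule ccontr)
  assume "\<not> ?thesis"
  then have S: "2 \<le> card (P1 - L)" "2 \<le> card (P2 - L)" by auto
  note a = vtripleD[OF v1(1)] and b = vtripleD[OF v2(1)]
  have ns1: "r (insert g1 X) = r X + 1" if "X \<subseteq> E" "X \<inter> C = {}" for X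
    by (rule cocirc_not_span[OF C(1)]) (use that C in auto)
  have ns2: "r (insert g2 X) = r X + 1" if "X \<subseteq> E" "X \<inter> C = {}" for X
    by (rule cocirc_not_span[OF C(1)]) (use that C in auto)
  \<comment> \<open>Needed for the union of the \<open>P\<close> sides to have \<open>lam\<close> at
    least 2. If the \<open>Q\<close> sides met only in \<open>y\<close>, then \<open>P1\<close>
    would span \<open>y\<close>, and \<open>Q1 - {y}\<close> would have \<open>lam\<close> at most
    1.\<close>
  have Q12: "2 \<le> card (Q1 \<inter> Q2)"
  proof (rule ccontr)
    assume "\<not> ?thesis"
    then have q: "Q1 \<inter> Q2 = {y}" by (rule card_lt2[rotated]) (use a(2) v1(3) v2(3) in auto)
    have sub: "Q2 - {y} \<subseteq> P1"
    proof
      fix x assume x: "x \<in> Q2 - {y}"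
      then have "x \<in> E - Q1" using q b(2) by auto
      moreover have "x \<noteq> g1" using x v2(4) C(6) by auto
      ultimately show "x \<in> P1" using a(14) by auto
    qed
    have "(Q2 - {y}) \<inter> C = {}" using C(4) v2(4) by blast
    then have "r (insert g2 (Q2 - {y})) = r (Q2 - {y}) + 1" by (intro ns2) (use b(2) in blast)+
    moreover have "r Q2 \<le> r (Q2 - {y}) + 1" using r_insert[of y "Q2 - {y}"] v2 by (simp add: insert_absorb)
    moreover have "r (insert y (insert g2 (Q2 - {y}))) \<le> r Q2"
      using b r_mono[of "insert y (insert g2 (Q2 - {y}))" "insert g2 Q2"] v2 by auto
    ultimately have "r (insert y (insert g2 (Q2 - {y}))) = r (insert g2 (Q2 - {y}))"
      using r_le_insert[of "insert g2 (Q2 - {y})" y] by linarith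
    then have "r (insert y P1) = r P1"
      by (rule span_mono) (use sub v1 C in auto)
    then have yP: "r (insert y (insert g1 P1)) = r P1"
      using span_mono[of y P1 "insert g1 P1"] a by auto
    have "r (insert g1 (Q1 - {y})) = r (Q1 - {y}) + 1" by (intro ns1) (use a(2) C(4) v1(4) in blast)+
    moreover have "r (insert g1 (Q1 - {y})) \<le> r Q1" using r_mono[of "insert g1 (Q1 - {y})" "insert g1 Q1"] a by auto
    ultimately have rq: "r (Q1 - {y}) + 1 \<le> r Q1" by simp
    have e: "E - (Q1 - {y}) = insert y (insert g1 P1)" using v1(3) vtriple_disj[OF v1(1)] a(5) by (auto simp: vtriple_mem[OF v1(1)])
    have "2 \<le> card (Q1 - {y})" using a(17) v1 fin_sub[OF a(2)] by auto
    moreover have "2 \<le> card (insert y (insert g1 P1))" unfolding e[symmetric]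
    proof -
      have "P1 \<subseteq> E - (Q1 - {y})" using a(1,6) by auto
      then show "2 \<le> card (E - (Q1 - {y}))" using a(16) card_mono[of "E - (Q1 - {y})" P1] fin by simp
    qed
    ultimately have "2 \<le> lam (Q1 - {y})" using lam2[of "Q1 - {y}"] a(2) unfolding e by auto
    then show False unfolding lam_def e yP using rq a by simp
  qed
  define R where "R = (P1 - L) \<inter> (P2 - L)"
  have un: "(insert g1 P1) \<inter> (insert g2 P2) = L \<union> R" using v1 v2 C unfolding R_def by auto
  have "E - (insert g1 P1 \<union> insert g2 P2) = Q1 \<inter> Q2" using a(13) b(13) by auto
  moreover have "2 \<le> card (insert g1 P1 \<union> insert g2 P2)"
    by (rule card_ge2I[of _ g1 g2]) (use a b C in auto)
  ultimately have "2 \<le> lam (insert g1 P1 \<union> insert g2 P2)" using lam2 Q12 a b by simp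
  then have lamLR: "lam (L \<union> R) \<le> 2" using lam_submod[of "insert g1 P1" "insert g2 P2"] a b un by simp
  have cLR: "E - (L \<union> R) = Q1 \<union> Q2" using un a(13) b(13) by blast
  have sQ: "r (insert l (Q1 \<union> Q2)) = r (Q1 \<union> Q2)" if "l \<in> L" for l
  proof (rule line_span[of L g1 g2])
    show "r (insert g1 (Q1 \<union> Q2)) = r (Q1 \<union> Q2)" by (rule span_mono[OF a(10)]) auto
    show "r (insert g2 (Q1 \<union> Q2)) = r (Q1 \<union> Q2)" by (rule span_mono[OF b(10)]) auto
  qed (use L C that in auto)
  have cR: "E - R = (Q1 \<union> Q2) \<union> L" using cLR L un unfolding R_def by auto
  have rQL: "r (Q1 \<union> Q2 \<union> L) = r (Q1 \<union> Q2)" by (rule span_Un) (use sQ L fin_sub in auto)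
  have RE: "R \<subseteq> E" using a unfolding R_def by auto
  \<comment> \<open>Removing the line from \<open>L \<union> R\<close> lowers the rank, as
    \<open>R\<close> does not span \<open>g1\<close>, while adding it to the complement costs no
    rank; so \<open>lam\<close> drops by one.\<close>
  have "R \<inter> C = {}" using C a v1 unfolding R_def by auto
  then have "r R + 1 \<le> r (L \<union> R)" using ns1[of R] RE r_mono[of "insert g1 R" "L \<union> R"] C by auto
  then have lamR: "lam R \<le> 1" using lamLR unfolding lam_def cLR cR rQL by simp
  have "2 \<le> card (E - R)" unfolding cR by (rule card_ge2I[of _ g1 g2]) (use a b C L in auto)
  then have "\<not> 2 \<le> card R" using lam2[of R] lamR RE by auto
  \<comment> \<open>A single point in \<open>R\<close> would be spanned by the line, which is closed
    and disjoint from \<open>R\<close>.\<close>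
  have R0: "R = {}"
  proof (rule ccontr)
    assume ne: "R \<noteq> {}"
    then obtain x where x: "x \<in> R" by auto
    have Rx: "R = {x}" by (rule card_lt2[OF RE \<open>\<not> 2 \<le> card R\<close> x])
    have "1 \<le> lam R" by (rule lam1) (use RE ne C L cR in auto)
    then have "1 \<le> r R + r (Q1 \<union> Q2) - r E" unfolding lam_def cR rQL .
    moreover have "r R = 1" using r_single[of x] x RE by (auto simp: Rx)
    ultimately have "r E \<le> r (Q1 \<union> Q2)" by simp
    then have "r (L \<union> R) \<le> 2" using lamLR unfolding lam_def cLR by simp
    then have "r (insert x L) \<le> 2" by (simp add: Rx)
    then have "r (insert x L) = 2" using L r_le_insert[of L x] by simp
    then have "x \<in> L" using cl x RE by auto
    then show False using x unfolding R_def by auto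
  qed
  have S2: "P2 - L \<subseteq> Q1"
  proof
    fix x assume x: "x \<in> P2 - L"
    then have "x \<notin> P1" "x \<noteq> g1" using R0 C(6) unfolding R_def by auto
    then show "x \<in> Q1" using x b(1) vtriple_mem[OF v1(1), of x] by auto
  qed
  have "y \<notin> P1" "y \<notin> P2" using vtriple_disj[OF v1(1)] v1(3) vtriple_disj[OF v2(1)] v2(3) by auto
  then have d1: "(P1 - L) \<inter> C = {}" "(P2 - L) \<inter> C = {}" using C(4) by auto
  have d2: "P1 - L \<subseteq> E" "P2 - L \<subseteq> E" using a(1) b(1) by auto
  have "r (insert g1 (P1 - L)) \<noteq> r (P1 - L)" using ns1[OF d2(1) d1(1)] by simp
  from vtriple_line_rank(2)[OF v1(1) L v1(2,4) C(6) this S(1)]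
  have r1: "r (Q1 \<union> L) = r Q1 + 1" .
  have n2: "r (insert g2 (P2 - L)) \<noteq> r (P2 - L)" using ns2[OF d2(2) d1(2)] by simp
  from vtriple_line_rank(1)[OF v2(1) L v2(2,4) C(8) this S(2)]
  have r2: "r P2 = r (P2 - L) + 1" .
  \<comment> \<open>\<open>g1\<close> completes \<open>P2 - L\<close> to the span of
    \<open>P2\<close> just as \<open>g2\<close> does, and \<open>g1\<close> is spanned by
    \<open>Q1\<close>.\<close>
  have g12: "r (insert g1 (P2 - L)) = r P2" using ns1[OF d2(2) d1(2)] r2 by simp
  have s: "r (insert l (insert g1 (P2 - L))) = r (insert g1 (P2 - L))" if "l \<in> L" for l
  proof -
    have "insert l (insert g1 (P2 - L)) \<subseteq> insert g2 P2" using that v2(2) C(6) by auto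
    then have "r (insert l (insert g1 (P2 - L))) \<le> r P2" using r_mono b(9) by metis
    then show ?thesis using g12 r_le_insert[of "insert g1 (P2 - L)" l] by linarith
  qed
  have "r (insert l Q1) = r Q1" if "l \<in> L" for l
  proof (rule span_trans[OF s[OF that]])
    show "finite (insert g1 (P2 - L))" using b(1) fin_sub by auto
    show "r (insert x Q1) = r Q1" if "x \<in> insert g1 (P2 - L)" for x
    proof (cases "x = g1")
      case False
      then have "x \<in> Q1" using that S2 by auto
      then show ?thesis by (simp add: insert_absorb)
    qed (simp add: a(10))
  qed
  then have "r (Q1 \<union> L) = r Q1" by (intro span_Un) (use L fin_sub in auto)
  then show False using r1 by simp
qed

text \<open>With one point off the line, \<open>P\<close> has rank 3, so \<open>insert g Q\<close>
  has rank \<open>r E - 1\<close>. It is closed, since an element of \<open>P\<close> spanned by it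
  would give a separation that 3-connectedness excludes.\<close>

lemma single_cocirc:
  assumes vt: "vtriple E r P g Q" and L: "L \<subseteq> E" "r L = 2" "3 \<le> card L" "L - {g} \<subseteq> P" "Q \<inter> L = {}" "g \<in> L"
    and S: "P - L = {z}"
  shows "cocirc E r (insert z (L - {g}))"
proof -
  note v = vtripleD[OF vt]
  have P: "P = insert z (L - {g})" using S L(4) v(4) by auto
  have z: "z \<in> E" "z \<notin> L" using S v by auto
  have e: "E - P = insert g Q" "r (insert g Q) = r Q" using v by auto
  have fL: "finite L" using L fin_sub by auto
  have cL: "2 \<le> card (L - {g})" using L fL by auto
  have rLg: "r (L - {g}) = 2" using r_ge2[of "L - {g}"] cL r_mono[of "L - {g}" L] L by auto
  have "r P \<le> 3" unfolding P using r_insert[of z "L - {g}"] rLg by simp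
  then have rQ: "r Q = r E - 1" using v by simp
  have "r (insert c (insert g Q)) = r E" if "c \<in> P" for c
  proof (rule ccontr)
    assume "\<not> ?thesis"
    then have sp: "r (insert c (insert g Q)) = r (insert g Q)"
      using not_span_insert[of c "insert g Q"] rQ e by auto
    have P': "P \<subseteq> E" "2 \<le> card P" "c \<in> E" using v that by auto
    show False
    proof (cases "c = z")
      case True
      have a: "E - (L - {g}) = insert c (insert g Q)" using P e(1) L(1,6) z True v(1,3) by blast
      have "2 \<le> card (E - (L - {g}))" unfolding a by (rule card_ge2I[of _ z g]) (use True v(2,3) z L(6) in auto)
      then have "2 \<le> lam (L - {g})" using lam2[of "L - {g}"] cL L by auto
      then show False unfolding lam_def a using sp rQ rLg e by simp
    next
      case False
      then have c: "c \<in> L" "c \<noteq> g" using that P by auto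
      have "r (insert l (insert g Q)) = r (insert g Q)" if "l \<in> L" for l
        by (rule line_span[of L g c]) (use that L c sp e in auto)
      then have "r (insert g Q \<union> L) = r (insert g Q)" by (intro span_Un) (use fL in auto)
      moreover have "E - {z} = insert g Q \<union> L" using P z L(1,6) vtriple_disj[OF vt, of z]
        by (auto simp: vtriple_mem[OF vt])
      ultimately have "lam {z} \<le> 0" unfolding lam_def using rQ e r_single[OF z(1)] by simp
      moreover have "1 \<le> lam {z}" by (rule lam1) (use z L in auto)
      ultimately show False by simp
    qed
  qed
  then show ?thesis unfolding cocirc_def P[symmetric] using v rQ e by auto
qed

lemma cocirc_of_hyperplane:
  assumes "H \<subseteq> E" "r H = r E - 1"
  shows "cocirc E r {x \<in> E. r (insert x H) \<noteq> r H}"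
proof -
  define C where "C = {x \<in> E. r (insert x H) \<noteq> r H}"
  have "H \<union> (E - C) = E - C" using assms(1) by (auto simp: C_def insert_absorb)
  moreover have "r (H \<union> (E - C)) = r H" by (rule span_Un) (use fin in \<open>auto simp: C_def\<close>)
  ultimately have h: "r (E - C) = r H" by simp
  have "r (insert c (E - C)) = r E" if "c \<in> C" for c
  proof -
    have "r (insert c (E - C)) \<noteq> r (E - C)"
    proof
      assume "r (insert c (E - C)) = r (E - C)"
      then have "r (insert c H) = r H" by (rule span_trans) (use fin in \<open>auto simp: C_def\<close>)
      then show False using that by (simp add: C_def)
    qed
    then show ?thesis using not_span_insert[of c "E - C"] h assms by simp
  qed
  then show ?thesis unfolding cocirc_def C_def[symmetric] using h assms by (auto simp: C_def)
qed

lemma line_closure: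
  assumes "X \<subseteq> E" "r X = 2"
  obtains L where "L = {x \<in> E. r (insert x X) = 2}" "L \<subseteq> E" "X \<subseteq> L" "r L = 2"
    "\<And>x. x \<in> E \<Longrightarrow> r (insert x L) = 2 \<Longrightarrow> x \<in> L"
proof -
  define L where "L = {x \<in> E. r (insert x X) = 2}"
  have XL: "X \<subseteq> L" using assms by (auto simp: L_def insert_absorb)
  have LE: "L \<subseteq> E" by (auto simp: L_def)
  have "r (X \<union> L) = r X" by (rule span_Un) (use LE fin_sub assms in \<open>auto simp: L_def\<close>)
  then have rL: "r L = 2" using XL assms by (simp add: Un_absorb1)
  have "x \<in> L" if "x \<in> E" "r (insert x L) = 2" for x
  proof -
    have "r (insert x X) = r X" by (rule span_trans[of x L]) (use that rL LE fin_sub assms in \<open>auto simp: L_def\<close>)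
    then show ?thesis using that assms by (simp add: L_def)
  qed
  then show ?thesis using that[of L] XL LE rL L_def by blast
qed

text \<open>Two missed points would put the line in the closed set \<open>E - C\<close>; then
  \<open>C = {y}\<close> and \<open>y\<close> would be a coloop.\<close>

lemma line_misses:
  assumes L: "L \<subseteq> E" "r L = 2" and C: "cocirc E r C" "y \<in> C" "C \<subseteq> insert y L" "y \<notin> L"
    and x: "x \<in> L" "x \<notin> C" "x' \<in> L" "x' \<notin> C"
  shows "x = x'"
proof (rule ccontr)
  assume ne: "x \<noteq> x'"
  have sp: "r (insert l (E - C)) = r (E - C)" if "l \<in> L" for l
    by (rule line_span[of L x x']) (use L x ne that in \<open>auto simp: insert_absorb\<close>)
  have "C \<inter> L = {}" using sp C(1) by (auto simp: cocirc_def)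
  then have C': "C = {y}" using C by auto
  have "y \<in> E" using C by (auto simp: cocirc_def)
  moreover have "1 \<le> lam {y}" by (rule lam1) (use \<open>y \<in> E\<close> x L C' in auto)
  ultimately show False using C(1) r_single[of y] unfolding C' lam_def cocirc_def by simp
qed

lemma cocirc_drk: "cocirc E r C \<Longrightarrow> rd C = int (card C) - 1"
  by (auto simp: cocirc_def drk_def Int_absorb2)

text \<open>Complementarity of closure and dual closure: the middle is spanned in the dual by the
  opposite side.\<close>

lemma dual_triple_span:
  assumes "vtriple E rd P g Q"
  shows "r (insert g P) = r P + 1" "r (insert g Q) = r Q + 1"
proof -
  note d = vtriple_dualD[OF assms]
  show "r (insert g P) = r P + 1"
    using rd_span_iff[of Q g] d(2,3,5,10,15) not_span_insert[of g P] by auto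
  show "r (insert g Q) = r Q + 1"
    using rd_span_iff[of P g] d(1,3,4,9,13) not_span_insert[of g Q] by auto
qed

text \<open>Two further points of the line on one side would span \<open>g\<close> from that side,
  against \<open>dual_triple_span\<close>.\<close>

lemma dual_triple_line:
  assumes vt: "vtriple E rd P g Q" and L: "L \<subseteq> E" "r L = 2" "g \<in> L"
    and b: "b \<in> L" "b \<noteq> g" "c \<in> L" "c \<noteq> g" "b \<noteq> c"
  shows "b \<in> P \<longleftrightarrow> c \<in> Q"
proof -
  have E: "b \<in> P \<or> b \<in> Q" "c \<in> P \<or> c \<in> Q" using L b vt unfolding vtriple_def by blast+
  have no: "\<not> (b \<in> S \<and> c \<in> S)" if "r (insert g S) = r S + 1" for S
  proof
    assume "b \<in> S \<and> c \<in> S"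
    then have "insert b S = S" "insert c S = S" by auto
    then have "r (insert g S) = r S" using line_span[of L b c g S] L b by simp
    then show False using that by simp
  qed
  show ?thesis using E no dual_triple_span[OF vt] vtriple_disj[OF vt] by blast
qed

text \<open>Three further points cannot lie pairwise on opposite sides. So a non-elastic point of a
  long line is always the middle of a primal triple.\<close>

lemma line4_no_dual:
  assumes L: "L \<subseteq> E" "r L = 2" "4 \<le> card L" "g \<in> L"
  shows "\<not> vtriple E rd P g Q"
proof
  assume vt: "vtriple E rd P g Q"
  have "3 \<le> card (L - {g})" using L by (simp add: fin_sub)
  then obtain x y z where xyz: "x \<in> L - {g}" "y \<in> L - {g}" "z \<in> L - {g}" "x \<noteq> y" "x \<noteq> z" "y \<noteq> z"
    by (rule card_ge3E)
  note t = dual_triple_line[OF vt L(1,2,4)]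
  have "x \<in> P \<longleftrightarrow> y \<in> Q" "y \<in> P \<longleftrightarrow> x \<in> Q" "x \<in> P \<longleftrightarrow> z \<in> Q" "z \<in> P \<longleftrightarrow> x \<in> Q"
    "y \<in> P \<longleftrightarrow> z \<in> Q" "z \<in> P \<longleftrightarrow> y \<in> Q"
    using t xyz by (metis Diff_iff singletonI)+
  moreover have "x \<in> P \<or> x \<in> Q" "x \<in> P \<Longrightarrow> x \<notin> Q"
    using xyz L(1) vt vtriple_disj[OF vt] unfolding vtriple_def by blast+
  ultimately show False by blast
qed

lemma nonelast_line:
  assumes L: "L \<subseteq> E" "r L = 2" "4 \<le> card L"
    and C: "cocirc E r C" "y \<in> C" "y \<notin> L" "C \<subseteq> insert y L" "g \<in> C" "g \<in> L" and g: "g \<notin> elast E r"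
  obtains P Q where "vtriple E r P g Q" "L - {g} \<subseteq> P" "y \<in> Q" "Q \<inter> L = {}"
proof -
  have "g \<in> E" using L C by auto
  then obtain P Q where "vtriple E r P g Q"
    using g line4_no_dual[OF L C(6)] unfolding elast_def by auto
  then show ?thesis using vtriple_line[OF _ L(1,2) C] that by blast
qed

text \<open>Adding \<open>f\<close> to \<open>P - L\<close> keeps it disjoint from \<open>C\<close>,
  so \<open>g\<close> still raises the rank afterwards; but the total is at most \<open>r P\<close>,
  which exceeds \<open>r (P - L)\<close> by only one.\<close>

lemma line_triple_span:
  assumes vt: "vtriple E r P g Q" and L: "L \<subseteq> E" "r L = 2" "3 \<le> card L" "L - {g} \<subseteq> P" "Q \<inter> L = {}" "g \<in> L"
    and S: "2 \<le> card (P - L)" and C: "cocirc E r C" "y \<in> C" "C \<subseteq> insert y L" "g \<in> C" "y \<in> Q"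
    and f: "f \<in> L" "f \<notin> C"
  shows "r (insert f (P - L)) = r (P - L)"
proof -
  note v = vtripleD[OF vt]
  have "y \<notin> P" using C(5) vtriple_disj[OF vt] by auto
  then have d: "(P - L) \<inter> C = {}" "insert f (P - L) \<inter> C = {}" using C(3) f by auto
  have s: "P - L \<subseteq> E" "insert f (P - L) \<subseteq> E" using v(1) f L by auto
  have "r (insert g (P - L)) \<noteq> r (P - L)" using cocirc_not_span[OF C(1,4) s(1) d(1)] by simp
  from vtriple_line_rank(1)[OF vt L(1-5) L(6) this S] have "r P = r (P - L) + 1" .
  moreover have "r (insert g (insert f (P - L))) = r (insert f (P - L)) + 1"
    by (rule cocirc_not_span[OF C(1,4) s(2) d(2)])
  moreover have "r (insert g (insert f (P - L))) \<le> r (insert g P)"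
    by (rule r_mono) (use L(4) f in auto)
  ultimately show ?thesis using v(9) r_le_insert[of "P - L" f] by simp
qed

lemma line_triple_nonempty:
  assumes vt: "vtriple E r P g Q" and L: "r L = 2"
  shows "P - L \<noteq> {}"
proof
  assume "P - L = {}"
  then have "r P \<le> r L" by (intro r_mono) auto
  then show False using vtripleD(7)[OF vt] L by simp
qed

end

section \<open>Elastic elements on long lines and in triangles\<close>

locale fan_theta_free = tri_connected +
  assumes nofan: "{a, b, c, d} \<subseteq> E \<Longrightarrow> distinct [a, b, c, d] \<Longrightarrow> r {a, b, c} = 2 \<Longrightarrow>
      drk E r {b, c, d} \<noteq> 2"
    and notheta: "\<not> theta_config E r" "\<not> theta_config E (drk E r)"

context fan_theta_free
begin

text \<open>A four-element fan read backwards is one of the dual, so one orientation in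
  \<open>nofan\<close> covers both.\<close>

lemma dual_fan_theta_free: "fan_theta_free E rd"
proof -
  interpret D: tri_connected E rd by (rule dual_tri_connected)
  show ?thesis
  proof
    show "\<not> theta_config E rd" "\<not> theta_config E (drk E rd)" using notheta by (auto simp: rd_rd)
    fix a b c d assume a: "{a, b, c, d} \<subseteq> E" "distinct [a, b, c, d]" "rd {a, b, c} = 2"
    show "drk E rd {b, c, d} \<noteq> 2"
    proof
      assume "drk E rd {b, c, d} = 2"
      moreover have "{b,c,d} = {d,c,b}" "{a,b,c} = {c,b,a}" by auto
      ultimately show False using nofan[of d c b a] a unfolding rd_rd by auto
    qed
  qed
qed

text \<open>Let \<open>A\<close> be the points \<open>w\<close> of the line for which one point off
  the line completes \<open>L - {w}\<close> to a cocircuit. If \<open>C \<inter> L\<close> had at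
  most one point in \<open>elast\<close>, then of any two other points one would be in
  \<open>A\<close> by \<open>two_line_triples\<close>, and two points of \<open>A\<close> force in
  every non-elastic point. So \<open>A\<close> misses at most one point, which is the excluded
  \<open>theta_config\<close>.\<close>

theorem segment_elastic:
  assumes L: "L \<subseteq> E" "r L = 2" "4 \<le> card L" and cl: "\<And>x. x \<in> E \<Longrightarrow> r (insert x L) = 2 \<Longrightarrow> x \<in> L"
    and C: "cocirc E r C" "y \<in> C" "y \<notin> L" "C \<subseteq> insert y L"
  shows "2 \<le> card (C \<inter> L \<inter> elast E r)"
proof (rule ccontr)
  assume nel: "\<not> ?thesis"
  have L3: "3 \<le> card L" using L by simp
  have sE: "C \<inter> L \<inter> elast E r \<subseteq> E" using L by auto
  have el1: "u = v" if "u \<in> C \<inter> L" "v \<in> C \<inter> L" "u \<in> elast E r" "v \<in> elast E r" for u v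
    using card_ge2I[OF sE, of u v] that nel by blast
  have miss: "u = v" if "u \<in> L - C" "v \<in> L - C" for u v
    using line_misses[OF L(1,2) C(1,2,4,3)] that by blast
  define A where "A = {w \<in> L. \<exists>z \<in> E - L. cocirc E r (insert z (L - {w}))}"
  have yE: "y \<in> E" using C by (auto simp: cocirc_def)
  \<comment> \<open>\<open>C\<close> misses at most one point of the line, and for that point
    \<open>y\<close> itself completes the cocircuit.\<close>
  have LC: "L - C \<subseteq> A"
  proof
    fix h assume h: "h \<in> L - C"
    then have "L - {h} \<subseteq> C" "h \<notin> C" using miss[of h] by blast+
    then have "C = insert y (L - {h})" using C(2,4) by blast
    then show "h \<in> A" using C(1,3) yE h by (auto simp: A_def)
  qed
  have single: "g \<in> A" if s: "vtriple E r P g Q" "L - {g} \<subseteq> P" "Q \<inter> L = {}" "g \<in> L" "card (P - L) \<le> 1" for g P Q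
  proof -
    obtain z where "z \<in> P - L" using line_triple_nonempty[OF s(1) L(2)] by auto
    moreover have "P - L \<subseteq> E" using vtripleD(1)[OF that(1)] by auto
    ultimately have "P - L = {z}" "z \<in> E" using card_lt2[of "P - L" z] that(5) by auto
    then show ?thesis using single_cocirc[OF that(1) L(1,2) L3 that(2-4), of z] that(4) by (auto simp: A_def)
  qed
  have two: "g1 \<in> A \<or> g2 \<in> A"
    if g: "g1 \<in> C \<inter> L" "g2 \<in> C \<inter> L" "g1 \<noteq> g2" "g1 \<notin> elast E r" "g2 \<notin> elast E r" for g1 g2
  proof -
    obtain P1 Q1 where 1: "vtriple E r P1 g1 Q1" "L - {g1} \<subseteq> P1" "y \<in> Q1" "Q1 \<inter> L = {}"
      by (rule nonelast_line[OF L C _ _ g(4)]) (use g in auto)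
    obtain P2 Q2 where 2: "vtriple E r P2 g2 Q2" "L - {g2} \<subseteq> P2" "y \<in> Q2" "Q2 \<inter> L = {}"
      by (rule nonelast_line[OF L C _ _ g(5)]) (use g in auto)
    have "card (P1 - L) \<le> 1 \<or> card (P2 - L) \<le> 1"
      by (rule two_line_triples[OF L(1,2) L3 cl C _ _ _ _ g(3) 1 2]) (use g in auto)
    then show ?thesis using single[OF 1(1,2,4)] single[OF 2(1,2,4)] g by auto
  qed
  have three: "\<exists>g1 g2. g1 \<in> T \<and> g2 \<in> T \<and> g1 \<noteq> g2 \<and> g1 \<notin> elast E r \<and> g2 \<notin> elast E r"
    if T: "T \<subseteq> C \<inter> L" "3 \<le> card T" for T
  proof -
    obtain u v w where u: "u \<in> T" "v \<in> T" "w \<in> T" "u \<noteq> v" "u \<noteq> w" "v \<noteq> w"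
      by (rule card_ge3E[OF T(2)])
    have "x \<notin> elast E r \<or> x' \<notin> elast E r" if "x \<in> T" "x' \<in> T" "x \<noteq> x'" for x x'
      using el1[of x x'] that T(1) by auto
    note u = u this[OF u(1,2,4)] this[OF u(1,3,5)] this[OF u(2,3,6)]
    show ?thesis
    proof (cases "u \<in> elast E r")
      case True
      then show ?thesis using u by (intro exI[of _ v] exI[of _ w]) auto
    next
      case F: False
      then show ?thesis using u by (cases "v \<in> elast E r") (intro exI[of _ u] exI[of _ w], auto)
    qed
  qed
  have fL: "finite L" using L fin_sub by auto
  have rm: "3 \<le> card (L - {h})" for h
    using L(3) fL card_Diff_singleton_if[of L h] by (auto split: if_splits)
  have "\<exists>h. L - {h} \<subseteq> C \<inter> L"
  proof (cases "L \<subseteq> C")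
    case False
    then obtain h where "h \<in> L - C" by blast
    then have "L - {h} \<subseteq> C \<inter> L" using miss by blast
    then show ?thesis by blast
  qed auto
  then obtain T where T: "T \<subseteq> C \<inter> L" "3 \<le> card T" using rm by blast
  obtain g1 g2 where g: "g1 \<in> T" "g2 \<in> T" "g1 \<noteq> g2" "g1 \<notin> elast E r" "g2 \<notin> elast E r"
    using three[OF T] by blast
  have "g1 \<in> C \<inter> L" "g2 \<in> C \<inter> L" using g T by auto
  from two[OF this g(3-5)] obtain f where f: "f \<in> A" by auto
  obtain P0 Q0 where v0: "vtriple E r P0 g1 Q0"
    by (rule nonelast_line[OF L C _ _ g(4)]) (use g T in auto)
  \<comment> \<open>Both sides have rank at least 3, and their ranks sum to
    \<open>r E + 2\<close>.\<close>
  have rE: "4 \<le> r E" using vtripleD[OF v0] by simp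
  have "card L \<le> card A + 1"
  proof (rule ccontr)
    assume "\<not> ?thesis"
    moreover have "card (L - A) = card L - card A" by (rule card_Diff_subset) (use fL in \<open>auto simp: A_def\<close>)
    ultimately have "2 \<le> card (L - A)" by simp
    then obtain h1 h2 where h: "h1 \<in> L - A" "h2 \<in> L - A" "h1 \<noteq> h2" by (rule card_ge2E)
    have "h1 \<in> C \<inter> L" "h2 \<in> C \<inter> L" using h LC by auto
    then obtain k where k: "k \<in> L - A" "k \<notin> elast E r" using el1 h by blast
    show False
    proof (cases "A = {f}")
      case True
      \<comment> \<open>Three points of \<open>C\<close> remain besides \<open>f\<close>; two of
        them are non-elastic, so one of these is in \<open>A\<close>.\<close>
      have "L - {f} \<subseteq> C \<inter> L" using True LC by auto
      from three[OF this rm] obtain k1 k2 where k: "k1 \<in> L - {f}" "k2 \<in> L - {f}" "k1 \<noteq> k2"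
        "k1 \<notin> elast E r" "k2 \<notin> elast E r" by blast
      have "k1 \<in> C \<inter> L" "k2 \<in> C \<inter> L" using k True LC by auto
      then show False using two[OF _ _ k(3-5)] True k by auto
    next
      case False
      then obtain f' where f': "f' \<in> A" "f' \<noteq> f" using f by auto
      obtain z where z: "z \<in> E" "z \<notin> L" "cocirc E r (insert z (L - {f}))" "f \<in> L" using f by (auto simp: A_def)
      obtain z' where z': "z' \<in> E" "z' \<notin> L" "cocirc E r (insert z' (L - {f'}))" "f' \<in> L" using f' by (auto simp: A_def)
      have kf: "k \<in> L" "k \<noteq> f" "k \<noteq> f'" using k f f' by auto
      \<comment> \<open>The triple of \<open>k\<close> is normalised with respect to the cocircuit
        of \<open>f\<close> instead of \<open>C\<close>. Then \<open>f\<close> and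
        \<open>f'\<close>, each missed by its own cocircuit, are spanned by \<open>P - L\<close>;
        hence so is \<open>k\<close>, against orthogonality.\<close>
      obtain P Q where v: "vtriple E r P k Q" "L - {k} \<subseteq> P" "z \<in> Q" "Q \<inter> L = {}"
        by (rule nonelast_line[OF L z(3) _ z(2) _ _ kf(1) k(2)]) (use kf in auto)
      have big: "2 \<le> card (P - L)" using single[OF v(1,2,4) kf(1)] k by force
      have "z' \<notin> P"
      proof
        assume "z' \<in> P"
        then have "Q \<inter> insert z' (L - {f'}) = {}" using v(4) vtriple_disj[OF v(1)] by auto
        then have "r (insert k Q) = r Q + 1"
          by (intro cocirc_not_span[OF z'(3)]) (use kf vtripleD(2)[OF v(1)] in auto)
        then show False using vtripleD(10)[OF v(1)] by simp
      qed
      then have z'Q: "z' \<in> Q" using z' kf vtriple_mem[OF v(1), of z'] by auto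
      have "r (insert f (P - L)) = r (P - L)"
        by (rule line_triple_span[OF v(1) L(1,2) L3 v(2,4) kf(1) big z(3), of z]) (use z v kf in auto)
      moreover have "r (insert f' (P - L)) = r (P - L)"
        by (rule line_triple_span[OF v(1) L(1,2) L3 v(2,4) kf(1) big z'(3), of z']) (use z' z'Q kf in auto)
      ultimately have "r (insert k (P - L)) = r (P - L)"
        by (intro line_span[of L f f' k]) (use L z z' f' kf in auto)
      moreover have "z \<notin> P" using v(3) vtriple_disj[OF v(1)] by auto
      then have "r (insert k (P - L)) = r (P - L) + 1"
        by (intro cocirc_not_span[OF z(3)]) (use kf vtripleD(1)[OF v(1)] in auto)
      ultimately show False by simp
    qed
  qed
  moreover have "\<exists>z. \<forall>w \<in> A. z w \<in> E - L \<and> cocirc E r (insert (z w) (L - {w}))"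
    by (rule bchoice) (auto simp: A_def)
  moreover have "A \<subseteq> L" by (auto simp: A_def)
  ultimately show False using notheta(1) rE L unfolding theta_config_def by blast
qed

text \<open>\<open>Q\<close> has rank \<open>r E - 1\<close>, and the cocircuit avoiding it lies in
  \<open>insert y A\<close> and contains \<open>y\<close>; this is the situation of
  \<open>segment_elastic\<close> on the closure of the line. If \<open>A\<close> had two elements,
  the triangle with \<open>f\<close> and this cocircuit would form a four-element fan.\<close>

lemma line_plus_point_triple:
  assumes vt: "vtriple E r (insert y A) f Q" and y: "y \<notin> A" and rA: "r (insert f A) = 2"
  shows "3 \<le> card A \<and> 2 \<le> card (A \<inter> elast E r)"
proof -
  note v = vtripleD[OF vt]
  have fA: "finite A" using v fin_sub by (metis finite_insert)
  have cA: "2 \<le> card A" using v(16) y fA by simp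
  have AE: "A \<subseteq> E" "f \<in> E" "f \<notin> A" "y \<in> E" "f \<noteq> y" using v(1,3,4) by auto
  have rA2: "r A = 2" using r_ge2[OF AE(1) cA] rA r_le_insert[of A f] by simp
  have r3: "r (insert y A) = 3" using v(7) r_insert[of y A] rA2 by simp
  then have rQ: "r Q = r E - 1" using v(11) by simp
  define C where "C = {x \<in> E. r (insert x Q) \<noteq> r Q}"
  have C: "cocirc E r C" unfolding C_def by (rule cocirc_of_hyperplane[OF v(2) rQ])
  have CA: "C \<subseteq> insert y A" using v(10) by (auto simp: C_def vtriple_mem[OF vt] insert_absorb)
  have yC: "y \<in> C"
  proof (rule ccontr)
    assume "y \<notin> C"
    then have "r (insert y Q) = r Q" using AE by (simp add: C_def)
    then have "r (insert y (insert f Q)) = r (insert f Q)" by (rule span_mono) auto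
    moreover have e: "E - A = insert y (insert f Q)" using y AE(3) vtriple_disj[OF vt]
      by (auto simp: vtriple_mem[OF vt])
    ultimately have "lam A = 1" unfolding lam_def e using rA2 rQ v(10) by simp
    moreover have "2 \<le> card (E - A)" unfolding e by (rule card_ge2I[of _ y f]) (use AE v(2) in auto)
    ultimately show False using lam2[OF AE(1) cA] by simp
  qed
  obtain L where L: "L = {x \<in> E. r (insert x (insert f A)) = 2}" "L \<subseteq> E" "insert f A \<subseteq> L" "r L = 2"
    "\<And>x. x \<in> E \<Longrightarrow> r (insert x L) = 2 \<Longrightarrow> x \<in> L"
    by (rule line_closure[of "insert f A"]) (use AE rA in auto)
  have yL: "y \<notin> L"
  proof
    assume "y \<in> L"
    then have "insert y A \<subseteq> L" using L(3) by auto
    then show False using r_mono[of "insert y A" L] r3 L(4) by simp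
  qed
  have CL: "C \<subseteq> insert y L" using CA L(3) by auto
  have fC: "f \<notin> C" using v(10) by (simp add: C_def)
  have "3 \<le> card A"
  proof (rule ccontr)
    assume "\<not> 3 \<le> card A"
    then have "card A = 2" using cA by simp
    then obtain a b where ab: "A = {a, b}" "a \<noteq> b" by (auto simp: card_2_iff)
    \<comment> \<open>\<open>f\<close> is already the one point that the cocircuit may miss.\<close>
    have "x \<in> C" if "x \<in> A" for x
      using line_misses[OF L(2,4) C yC CL yL, of x f] that fC L(3) AE(3) by blast
    then have "C = {a, b, y}" using CA yC ab by auto
    then have "rd {a, b, y} = 2" using cocirc_drk[OF C] ab y by auto
    moreover have "r {f, a, b} = 2" using rA ab by simp
    ultimately show False using nofan[of f a b y] AE ab y by auto
  qed
  moreover have "2 \<le> card (C \<inter> L \<inter> elast E r)"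
  proof (rule segment_elastic[OF L(2,4) _ L(5) C yC yL CL])
    have "card (insert f A) \<le> card L" by (rule card_mono) (use L fin_sub in auto)
    then show "4 \<le> card L" using \<open>3 \<le> card A\<close> AE fA by simp
  qed
  moreover have "card (C \<inter> L \<inter> elast E r) \<le> card (A \<inter> elast E r)"
    by (rule card_mono) (use fA CA yL in auto)
  ultimately show ?thesis by simp
qed

text \<open>\<open>Y\<close> has rank \<open>r E - 1\<close>, and the cocircuit avoiding it lies in
  \<open>insert e X\<close> and contains \<open>e\<close>. A long closure of \<open>X\<close> is
  covered by \<open>segment_elastic\<close>; a triangle is handled through fans. The last conjunct
  later locates the third element of the triangle relative to a triple that splits the two elastic
  ones.\<close>

lemma line_dual_triple:
  assumes vt: "vtriple E rd X e Y" and rX: "r X = 2"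
  shows "(\<exists>L. L \<subseteq> E \<and> r L = 2 \<and> 4 \<le> card L \<and> 2 \<le> card (L \<inter> X \<inter> elast E r)) \<or>
    (card X = 3 \<and> 2 \<le> card (X \<inter> elast E r) \<and> (\<forall>g \<in> X. \<forall>P Q. \<not> vtriple E rd P g Q))"
proof -
  note v = vtriple_dualD[OF vt]
  note sp = dual_triple_span[OF vt]
  have rY: "r Y = r E - 1" using v(18) sp(2) rX unfolding lam_def v(12) by simp
  define C where "C = {x \<in> E. r (insert x Y) \<noteq> r Y}"
  have C: "cocirc E r C" unfolding C_def by (rule cocirc_of_hyperplane[OF v(2) rY])
  have CX: "C \<subseteq> insert e X" using vt by (auto simp: C_def vtriple_def insert_absorb)
  have eC: "e \<in> C" using sp(2) v(3) by (simp add: C_def)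
  obtain L where L: "L = {x \<in> E. r (insert x X) = 2}" "L \<subseteq> E" "X \<subseteq> L" "r L = 2"
    "\<And>x. x \<in> E \<Longrightarrow> r (insert x L) = 2 \<Longrightarrow> x \<in> L"
    by (rule line_closure[OF v(1) rX]) auto
  have eL: "e \<notin> L" using sp(1) rX by (simp add: L(1))
  have CL: "C \<subseteq> insert e L" using CX L(3) by auto
  have fL: "finite L" using L(2) fin_sub by auto
  have fX: "finite X" using v(1) fin_sub by auto
  show ?thesis
  proof (cases "4 \<le> card L")
    case True
    have "2 \<le> card (C \<inter> L \<inter> elast E r)" by (rule segment_elastic[OF L(2,4) True L(5) C eC eL CL])
    moreover have "card (C \<inter> L \<inter> elast E r) \<le> card (L \<inter> X \<inter> elast E r)"
      by (rule card_mono) (use fL CX eL in auto)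
    ultimately have "2 \<le> card (L \<inter> X \<inter> elast E r)" by simp
    then show ?thesis using L True by blast
  next
    case False
    then have "card L \<le> card X" using v(16) by simp
    then have LX: "L = X" using card_seteq[OF fL L(3)] by simp
    have X3: "card X = 3" using False v(16) LX by simp
    then obtain a b c where abc: "X = {a,b,c}" "a \<noteq> b" "a \<noteq> c" "b \<noteq> c" by (auto simp: card_3_iff)
    have Xsub: "X \<subseteq> E" "e \<notin> X" "e \<in> E" using v by auto
    have split: "\<exists>b c. X = {g, b, c} \<and> distinct [g, b, c]" if "g \<in> X" for g
      using that abc by auto
    \<comment> \<open>Such a cocircuit is a triad that shares two elements with the triangle
      \<open>X\<close>.\<close>
    have fan: False if f: "g \<in> X" "z \<in> E" "z \<notin> X" "cocirc E r (insert z (X - {g}))" for g z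
    proof -
      obtain b c where bc: "X = {g, b, c}" "distinct [g, b, c]" using split[OF f(1)] by auto
      then have s: "insert z (X - {g}) = {b, c, z}" by auto
      have "rd {b, c, z} = 2" using cocirc_drk[OF that(4)] bc that(3) unfolding s by auto
      then show False using nofan[of g b c z] bc that Xsub rX by auto
    qed
    \<comment> \<open>Uncrossing the two dual triples leaves \<open>{g, c, e}\<close> with
      \<open>lam\<close> at most 2. It has rank 3, hence corank 2, and forms a four-element fan with
      the triangle \<open>{b, g, c}\<close>.\<close>
    have nodual: False if "vtriple E rd P g Q" "X = {g, b, c}" "distinct [g, b, c]" "b \<in> P" "c \<in> Q" "e \<in> Q" for P Q g b c
    proof -
      note w = vtriple_dualD[OF that(1)]
      have I: "insert e X \<inter> insert g Q = {g, c, e}" using that w(6) by auto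
      have "E - (insert e X \<union> insert g Q) = P - {b}"
      proof -
        have "b \<notin> Q" "c \<notin> P" "e \<notin> P" using that(4-6) vtriple_disj[OF that(1)] by auto
        moreover have "E - (insert e X \<union> insert g Q) = P - insert e X" using w(15) by blast
        ultimately show ?thesis using that(2) w(4) by auto
      qed
      moreover have "2 \<le> card (P - {b})" using w(16) that(4) fin_sub[OF w(1)] by simp
      moreover have "2 \<le> card (insert e X \<union> insert g Q)"
        by (rule card_ge2I[of _ e g]) (use Xsub w(2,3) that(2) in auto)
      ultimately have "2 \<le> lam (insert e X \<union> insert g Q)" using lam2[of "insert e X \<union> insert g Q"] Xsub w(2,3) by simp
      then have l: "lam {g, c, e} \<le> 2"
        using lam_submod[of "insert e X" "insert g Q"] w(21) v(20) unfolding I by simp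
      have "r (insert e {g, c}) \<noteq> r {g, c}"
      proof
        assume "r (insert e {g, c}) = r {g, c}"
        then have "r (insert e X) = r X" by (rule span_mono) (use that(2) in auto)
        then show False using sp(1) by simp
      qed
      moreover have "insert e {g, c} = {g, c, e}" by auto
      moreover have gc: "g \<in> E" "c \<in> E" "g \<noteq> c" "e \<noteq> g" "e \<noteq> c" using that(2,3) Xsub by auto
      ultimately have "r {g, c, e} = 3" using not_span_insert[of e "{g,c}"] r_pair[of g c] by simp
      then have "rd {g, c, e} \<le> 2" using rd_lam[of "{g,c,e}"] l gc Xsub by simp
      moreover have "2 \<le> rd {g, c, e}"
      proof -
        interpret D: tri_connected E rd by (rule dual_tri_connected)
        show ?thesis using D.r_ge2[of "{g,c,e}"] gc Xsub by simp
      qed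
      moreover have "r {b, g, c} = 2" using rX that(2) by (metis insert_commute)
      ultimately show False using nofan[of b g c e] that(2,3) Xsub gc by auto
    qed
    have nod: "\<not> vtriple E rd P g Q" if gX: "g \<in> X" for P g Q
    proof
      assume w: "vtriple E rd P g Q"
      obtain b c where bc: "X = {g, b, c}" "distinct [g, b, c]" using split[OF gX] by auto
      then have bc': "X = {g, c, b}" "distinct [g, c, b]" by auto
      note iff = dual_triple_line[OF w v(1) rX that]
      have m: "b \<in> P \<longleftrightarrow> c \<in> Q" "c \<in> P \<longleftrightarrow> b \<in> Q" using iff[of b c] iff[of c b] bc by auto
      have "b \<in> P \<or> b \<in> Q" "e \<in> P \<or> e \<in> Q" using w bc Xsub unfolding vtriple_def by auto
      then show False
        using m nodual[OF w bc] nodual[OF w bc'] nodual[OF vtriple_sym[OF w] bc]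
          nodual[OF vtriple_sym[OF w] bc'] by blast
    qed
    have one: "g1 = g2" if g: "g1 \<in> X" "g2 \<in> X" "g1 \<notin> elast E r" "g2 \<notin> elast E r" for g1 g2
    proof (rule ccontr)
      assume ne: "g1 \<noteq> g2"
      \<comment> \<open>By the fan argument \<open>C\<close> misses no point of \<open>X\<close>, so
        triples with middle \<open>g1\<close> and \<open>g2\<close> can both be normalised along
        \<open>C\<close>.\<close>
      have CX': "C = insert e X"
      proof (rule ccontr)
        assume "C \<noteq> insert e X"
        then obtain h where h: "h \<in> X" "h \<notin> C" using CX eC by auto
        then have "C = insert e (X - {h})"
          using line_misses[OF L(2,4) C eC CL eL, of _ h] CX eC unfolding LX by blast
        then show False using fan[of h e] h Xsub C by auto
      qed
      have gC: "g1 \<in> C" "g2 \<in> C" using g CX' by auto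
      obtain P1 Q1 where "vtriple E r P1 g1 Q1" using g nod Xsub unfolding elast_def by blast
      from vtriple_line[OF this L(2,4) C eC eL CL gC(1)] obtain P1 Q1 where
        1: "vtriple E r P1 g1 Q1" "X - {g1} \<subseteq> P1" "e \<in> Q1" "Q1 \<inter> X = {}" using g unfolding LX by blast
      obtain P2 Q2 where "vtriple E r P2 g2 Q2" using g nod Xsub unfolding elast_def by blast
      from vtriple_line[OF this L(2,4) C eC eL CL gC(2)] obtain P2 Q2 where
        2: "vtriple E r P2 g2 Q2" "X - {g2} \<subseteq> P2" "e \<in> Q2" "Q2 \<inter> X = {}" using g unfolding LX by blast
      have one1: False if w: "vtriple E r P g Q" "X - {g} \<subseteq> P" "Q \<inter> X = {}" "g \<in> X" "card (P - X) \<le> 1" for P g Q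
      proof -
        obtain z where "z \<in> P - X" using line_triple_nonempty[OF w(1) rX] by auto
        moreover have "P - X \<subseteq> E" using vtripleD(1)[OF w(1)] by auto
        ultimately have z: "P - X = {z}" "z \<in> E" "z \<notin> X" using card_lt2[of "P - X" z] w(5) by auto
        show False using fan[OF w(4) z(2,3) single_cocirc[OF w(1) v(1) rX _ w(2-4) z(1)]] X3 by simp
      qed
      have "card (P1 - X) \<le> 1 \<or> card (P2 - X) \<le> 1"
        by (rule two_line_triples[of X C e g1 g2 P1 Q1 P2 Q2])
           (use v(1) rX X3 L(5) C eC eL CL gC g ne 1 2 LX in auto)
      then show False using one1[OF 1(1,2,4) g(1)] one1[OF 2(1,2,4) g(2)] by blast
    qed
    have "2 \<le> card (X \<inter> elast E r)"
    proof -
      have "(a \<in> elast E r \<and> b \<in> elast E r) \<or> (a \<in> elast E r \<and> c \<in> elast E r) \<or> (b \<in> elast E r \<and> c \<in> elast E r)"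
        using one[of a b] one[of a c] one[of b c] abc by blast
      moreover have "X \<inter> elast E r \<subseteq> E" using Xsub(1) by auto
      ultimately show ?thesis using card_ge2I[of "X \<inter> elast E r"] abc by blast
    qed
    then show ?thesis using X3 nod by blast
  qed
qed

end

section \<open>Guts elements and shrinking a side\<close>

context tri_connected
begin

text \<open>The bounds on \<open>lam\<close> and the spanning of \<open>g\<close> by
  \<open>B\<close> give every equation of a triple. Only \<open>3 \<le> r A\<close> can fail, and
  then \<open>insert g A\<close> lies on a line.\<close>

lemma guts_triple:
  assumes A: "A \<subseteq> E" "2 \<le> card A" and g: "g \<in> E" "g \<notin> A"
    and l: "lam A \<le> 2" "lam (insert g A) \<le> 2"
    and B: "B = E - insert g A" "3 \<le> r B" "r (insert g B) = r B"
    and no: "\<not> vtriple E r A g B"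
  shows "r A = 2" "r (insert g A) = 2"
proof -
  have BE: "B \<subseteq> E" using B(1) by auto
  have c: "2 \<le> card B" using card_ge3[OF BE B(2)] by simp
  have e: "E - A = insert g B" using g B(1) by auto
  have "2 \<le> card (E - A)" unfolding e using c card_mono[of "insert g B" B] fin_sub[OF BE] by fastforce
  then have l1: "lam A = 2" using lam2[OF A] l by simp
  have e': "E - insert g A = B" using B(1) by simp
  have "2 \<le> card (insert g A)" using A card_mono[of "insert g A" A] fin_sub[of A] by fastforce
  then have l2: "lam (insert g A) = 2" using lam2[of "insert g A"] A(1) g(1) c l unfolding e' by simp
  have r1: "r A + r B = r E + 2" using l1 B(3) unfolding lam_def e by simp
  have r2: "r (insert g A) = r A" using l2 r1 unfolding lam_def e' by simp
  have "\<not> 3 \<le> r A"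
  proof
    assume "3 \<le> r A"
    then have "vtriple E r A g B" unfolding vtriple_def using A g B r1 r2 by auto
    then show False using no by simp
  qed
  then show "r A = 2" "r (insert g A) = 2" using r_ge2[OF A] r2 by auto
qed

lemma lam_le_rd_span:
  assumes "X \<subseteq> E" "x \<in> E" "rd (insert x X) = rd X" shows "lam (insert x X) \<le> lam X"
proof -
  interpret D: tri_connected E rd by (rule dual_tri_connected)
  show ?thesis using D.lam_le_span[OF assms(3)] dual_lam[of X] dual_lam[of "insert x X"] assms(1,2) by simp
qed

lemma rd_span_mono: "rd (insert x X) = rd X \<Longrightarrow> X \<subseteq> Y \<Longrightarrow> rd (insert x Y) = rd Y"
proof -
  interpret D: tri_connected E rd by (rule dual_tri_connected)
  show "rd (insert x X) = rd X \<Longrightarrow> X \<subseteq> Y \<Longrightarrow> rd (insert x Y) = rd Y" by (rule D.span_mono)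
qed

lemma rd_not_span: 
  assumes "A \<subseteq> E" "f \<in> E" "f \<notin> A" "B = E - insert f A" "r (insert f B) = r B"
  shows "rd (insert f A) = rd A + 1"
proof -
  interpret D: tri_connected E rd by (rule dual_tri_connected)
  show ?thesis using rd_span_iff[OF assms(1-3)] assms(4,5) D.not_span_insert[of f A] by auto
qed

end

text \<open>Both kinds of triples are compared, so the notion is self-dual and can be used against
  primal and dual triples alike.\<close>

definition minimal_side :: "'a set \<Rightarrow> ('a set \<Rightarrow> int) \<Rightarrow> 'a set \<Rightarrow> bool" where
  "minimal_side E r X \<longleftrightarrow>
     (\<forall>A g B. A \<subset> X \<longrightarrow> \<not> vtriple E r A g B \<and> \<not> vtriple E (drk E r) A g B)"

section \<open>Minimal triples\<close>

text \<open>The case \<open>drk E r X = 2\<close> left out here is \<open>line_dual_triple\<close>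
  read in the dual.\<close>

locale minimal_triple = fan_theta_free +
  fixes X e Y
  assumes vt: "vtriple E r X e Y" and min: "minimal_side E r X" and not_coline: "drk E r X \<noteq> 2"
begin

lemmas v = vtripleD[OF vt]

text \<open>
  Otherwise \<open>g\<close> would be the middle of a triple with side \<open>A\<close>, contradicting the minimality of \<open>X\<close>.
\<close>
lemma min_guts:
  assumes A: "A \<subset> X" "2 \<le> card A" and g: "g \<in> insert e X" "g \<notin> A"
    and l: "lam A \<le> 2" "lam (insert g A) \<le> 2"
    and s: "r (insert g (E - insert g A)) = r (E - insert g A)"
  shows "r A = 2" "r (insert g A) = 2"
proof -
  have a: "A \<subseteq> E" "g \<in> E" using A g v(1,3) by auto
  have "Y \<subseteq> E - insert g A" using A(1) g(1) v(2,5,6) by auto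
  then have "r Y \<le> r (E - insert g A)" by (rule r_mono)
  then have 3: "3 \<le> r (E - insert g A)" using v(8) by simp
  have no: "\<not> vtriple E r A g (E - insert g A)" using min A(1) by (simp add: minimal_side_def)
  show "r A = 2" "r (insert g A) = 2"
    using guts_triple[OF a(1) A(2) a(2) g(2) l refl 3 s no] by auto
qed

text \<open>The dual of \<open>min_guts\<close>, where the bound on the far side needs an argument:
  \<open>insert e Y\<close> has corank at least 3, since its \<open>lam\<close> is 2 and its rank is
  at most its size minus one.\<close>

lemma min_coguts:
  assumes A: "A \<subset> X" "2 \<le> card A" and g: "g \<in> X" "g \<notin> A"
    and l: "lam A \<le> 2" "lam (insert g A) \<le> 2"
    and s: "rd (insert g (E - insert g A)) = rd (E - insert g A)"
  shows "rd A = 2" "rd (insert g A) = 2"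
proof -
  interpret D: tri_connected E rd by (rule dual_tri_connected)
  have a: "A \<subseteq> E" "g \<in> E" "insert g A \<subseteq> E" using A g v(1,3) by auto
  have "insert e Y \<subseteq> E - insert g A" using A(1) g(1) v(2-6) by auto
  then have "rd (insert e Y) \<le> rd (E - insert g A)" by (rule D.r_mono)
  moreover have "r Y \<le> int (card Y)" by (rule r_le_card) (use v(2) fin_sub in auto)
  then have "3 \<le> rd (insert e Y)" using rd_lam[of "insert e Y"] v(2,3,5,10,21) fin_sub[of Y] by simp
  ultimately have 3: "3 \<le> rd (E - insert g A)" by simp
  have no: "\<not> vtriple E rd A g (E - insert g A)" using min A(1) by (simp add: minimal_side_def)
  have l': "D.lam A \<le> 2" "D.lam (insert g A) \<le> 2" using l dual_lam a by auto
  show "rd A = 2" "rd (insert g A) = 2"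
    using D.guts_triple[OF a(1) A(2) a(2) g(2) l' refl 3 s no] by auto
qed

text \<open>If \<open>insert e Y\<close> spanned \<open>f\<close>, in the matroid or in the dual,
  moving \<open>f\<close> across would give a triple with the smaller side \<open>X - {f}\<close>,
  unless \<open>X\<close> has rank 2 or corank 2 respectively; \<open>vt\<close> and
  \<open>not_coline\<close> exclude these.\<close>

lemma outside_closed:
  assumes f: "f \<in> X"
  shows "r (insert f (insert e Y)) \<noteq> r (insert e Y)" "rd (insert f (insert e Y)) \<noteq> rd (insert e Y)"
proof -
  have fE: "f \<in> E" "f \<notin> insert e Y" "insert e Y \<subseteq> E" using f v by auto
  have i: "insert f (X - {f}) = X" "X - {f} \<subset> X" using f by auto
  have c: "2 \<le> card (X - {f})" using v(16) f fin_sub[OF v(1)] by simp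
  have e: "E - (X - {f}) = insert f (insert e Y)" using fE v(12) by auto
  have E': "E - insert f (X - {f}) = insert e Y" using i v(12) by simp
  have l: "lam (X - {f}) \<le> 2" if "lam (insert f (insert e Y)) \<le> 2"
  proof -
    have "X - {f} \<subseteq> E" using v(1) by auto
    then have "lam (X - {f}) = lam (E - (X - {f}))" by (rule lam_compl[symmetric])
    then show ?thesis using that unfolding e by simp
  qed
  show "r (insert f (insert e Y)) \<noteq> r (insert e Y)"
  proof
    assume a: "r (insert f (insert e Y)) = r (insert e Y)"
    have "lam (X - {f}) \<le> 2" using lam_le_span[OF a] v(21) l by simp
    then have "r (insert f (X - {f})) = 2"
      using min_guts(2)[OF i(2) c, of f] i(1) f v(18) a E' by simp
    then show False using i v(7) by simp
  qed
  show "rd (insert f (insert e Y)) \<noteq> rd (insert e Y)"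
  proof
    assume a: "rd (insert f (insert e Y)) = rd (insert e Y)"
    have "lam (X - {f}) \<le> 2" using lam_le_rd_span[OF fE(3,1) a] v(21) l by simp
    then have "rd (insert f (X - {f})) = 2"
      using min_coguts(2)[OF i(2) c f] i(1) v(18) a E' by simp
    then show False using i not_coline by simp
  qed
qed

text \<open>By \<open>rd_lam\<close> the set \<open>A\<close> has two elements; \<open>p\<close>
  completes it to a triangle and \<open>q\<close> to a triad, a four-element fan.\<close>

lemma two_guts:
  assumes A: "A \<subseteq> E" "lam A = 2" "r A = 2" "rd A = 2"
    and ef: "p \<in> E" "q \<in> E" "p \<noteq> q" "p \<notin> A" "q \<notin> A" "r (insert p A) = 2" "rd (insert q A) = 2"
  shows False
proof -
  have "card A = 2" using rd_lam[OF A(1)] A by simp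
  then obtain a b where ab: "A = {a, b}" "a \<noteq> b" by (auto simp: card_2_iff)
  then have "insert p A = {p, a, b}" "insert q A = {a, b, q}" by auto
  then show False using nofan[of p a b q] A ef ab by auto
qed

definition has_segment :: bool where
  "has_segment \<longleftrightarrow> (\<exists>L. L \<subseteq> E \<and> (r L = 2 \<or> rd L = 2) \<and> 4 \<le> card L \<and> 2 \<le> card (L \<inter> X \<inter> elast E r))"

text \<open>When at least two elements stay outside the union, its \<open>lam\<close> is at least 2
  and submodularity bounds the intersection. For the unions with \<open>P\<close> the outside
  contains \<open>e\<close> and a point of \<open>Y \<inter> Q\<close>; for those with
  \<open>Q\<close> it is \<open>Y \<inter> P\<close>.\<close>

lemma uncross:
  assumes P: "E = insert f (P \<union> Q)" "f \<notin> P" "f \<notin> Q" "P \<inter> Q = {}"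
    and l: "lam P = 2" "lam Q = 2" "lam (insert f P) = 2" "lam (insert f Q) = 2"
    and f: "f \<in> X" and e: "e \<in> Q"
  shows "Y \<inter> Q \<noteq> {} \<Longrightarrow> lam (X \<inter> P) \<le> 2" "Y \<inter> Q \<noteq> {} \<Longrightarrow> lam (insert f (X \<inter> P)) \<le> 2"
    "2 \<le> card (Y \<inter> P) \<Longrightarrow> lam (X \<inter> Q) \<le> 2"
    "2 \<le> card (Y \<inter> P) \<Longrightarrow> lam (insert e (X \<inter> Q)) \<le> 2"
    "2 \<le> card (Y \<inter> P) \<Longrightarrow> lam (insert f (X \<inter> Q)) \<le> 2"
    "2 \<le> card (Y \<inter> P) \<Longrightarrow> lam (insert e (insert f (X \<inter> Q))) \<le> 2"
proof -
  have m: "x \<in> E \<longleftrightarrow> x = e \<or> x \<in> X \<or> x \<in> Y" for x by (rule vtriple_mem[OF vt])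
  have n: "x \<in> E \<longleftrightarrow> x = f \<or> x \<in> P \<or> x \<in> Q" for x using P(1) by auto
  have dis: "x \<in> X \<Longrightarrow> x \<notin> Y" "x \<in> P \<Longrightarrow> x \<notin> Q" for x using v(6) P(4) by auto
  have cu: "2 \<le> card (X \<union> S)" if "S \<subseteq> E" for S
  proof -
    have "card X \<le> card (X \<union> S)" by (rule card_mono) (use that v(1) fin_sub in auto)
    then show ?thesis using v(16) by simp
  qed
  have PE: "P \<subseteq> E" "Q \<subseteq> E" using P(1) by auto
  {
    assume "Y \<inter> Q \<noteq> {}"
    then obtain y where y: "y \<in> Y" "y \<in> Q" by auto
    have eP: "e \<notin> P" using e dis by auto
    have "2 \<le> card (E - (X \<union> P))"
      by (rule card_ge2I[of _ y e]) (use y v(2-6) e eP dis in auto)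
    then have u: "2 \<le> lam (X \<union> P)" using lam2[of "X \<union> P"] cu[OF PE(1)] v(1) PE by simp
    show "lam (X \<inter> P) \<le> 2" using lam_submod[of X P] u v(18) l(1) by simp
    have "X \<inter> insert f P = insert f (X \<inter> P)" "X \<union> insert f P = X \<union> P" using f by auto
    then show "lam (insert f (X \<inter> P)) \<le> 2" using lam_submod[of X "insert f P"] u v(18) l(3) by simp
  }
  assume c: "2 \<le> card (Y \<inter> P)"
  have "E - (X \<union> Q) = Y \<inter> P" 
  proof (rule set_eqI)
    fix x show "x \<in> E - (X \<union> Q) \<longleftrightarrow> x \<in> Y \<inter> P"
      using m[of x] n[of x] dis[of x] e f by auto
  qed
  then have u: "2 \<le> lam (X \<union> Q)" using lam2[of "X \<union> Q"] cu[OF PE(2)] v(1) PE c by simp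
  show "lam (X \<inter> Q) \<le> 2" using lam_submod[of X Q] u v(18) l(2) by simp
  have "insert e X \<inter> Q = insert e (X \<inter> Q)" "insert e X \<union> Q = X \<union> Q" using e by auto
  then show "lam (insert e (X \<inter> Q)) \<le> 2" using lam_submod[of "insert e X" Q] u v(20) l(2) by simp
  have "X \<inter> insert f Q = insert f (X \<inter> Q)" "X \<union> insert f Q = X \<union> Q" using f by auto
  then show "lam (insert f (X \<inter> Q)) \<le> 2" using lam_submod[of X "insert f Q"] u v(18) l(4) by simp
  have "insert e X \<inter> insert f Q = insert e (insert f (X \<inter> Q))" "insert e X \<union> insert f Q = X \<union> Q"
    using e f by auto
  then show "lam (insert e (insert f (X \<inter> Q))) \<le> 2"
    using lam_submod[of "insert e X" "insert f Q"] u v(20) l(4) by simp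
qed

text \<open>Closedness of \<open>insert e Y\<close> and minimality make all four intersections
  nonempty. Uncrossing puts \<open>X \<inter> P\<close> and \<open>X \<inter> Q\<close> on lines
  through \<open>f\<close>, unless \<open>Y \<inter> P\<close> is a single point; then
  \<open>P\<close> is a line plus a point and \<open>line_plus_point_triple\<close> yields a long
  line.\<close>

lemma same_type_cross:
  assumes w: "vtriple E r P f Q" and f: "f \<in> X" and e: "e \<in> Q"
  shows "has_segment \<or> (\<exists>A B. X = insert f (A \<union> B) \<and> f \<notin> A \<and> f \<notin> B \<and> A \<inter> B = {} \<and> A \<noteq> {} \<and> B \<noteq> {} \<and>
      r (insert f A) \<le> 2 \<and> r (insert e (insert f B)) = 2)"
proof -
  note u = vtripleD[OF w]
  have m: "x \<in> E \<longleftrightarrow> x = e \<or> x \<in> X \<or> x \<in> Y" for x by (rule vtriple_mem[OF vt])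
  have n: "x \<in> E \<longleftrightarrow> x = f \<or> x \<in> P \<or> x \<in> Q" for x by (rule vtriple_mem[OF w])
  have dis: "x \<in> X \<Longrightarrow> x \<notin> Y" "x \<in> P \<Longrightarrow> x \<notin> Q" for x using v(6) u(6) by auto
  have eP: "e \<notin> P" using e dis by auto
  have out: "r (insert f Z) \<noteq> r Z" if "Z \<subseteq> insert e Y" for Z
    using outside_closed(1)[OF f] span_mono[OF _ that] by blast
  have q1: "X \<inter> P \<noteq> {}"
  proof
    assume "X \<inter> P = {}"
    moreover have "P \<subseteq> insert e (X \<union> Y)" using u(1) m by auto
    ultimately have "P \<subseteq> insert e Y" by blast
    then show False using out u(9) by blast
  qed
  have q2: "X \<inter> Q \<noteq> {}"
  proof
    assume "X \<inter> Q = {}"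
    moreover have "Q \<subseteq> insert e (X \<union> Y)" using u(2) m by auto
    ultimately have "Q \<subseteq> insert e Y" by blast
    then show False using out u(10) by blast
  qed
  have q3: "Y \<inter> P \<noteq> {}"
  proof
    assume "Y \<inter> P = {}"
    moreover have "P \<subseteq> insert e (X \<union> Y)" using u(1) m by auto
    ultimately have "P \<subseteq> X" using eP by blast
    then have "P \<subset> X" using u(4) f by auto
    then show False using min w by (auto simp: minimal_side_def)
  qed
  \<comment> \<open>Otherwise \<open>Q - {e}\<close> is a proper subset of \<open>X\<close> and
    \<open>P\<close> contains \<open>Y\<close>, hence spans \<open>e\<close>; then
    \<open>min_guts\<close> would give \<open>Q\<close> rank 2.\<close>
  have q4: "Y \<inter> Q \<noteq> {}"
  proof
    assume a: "Y \<inter> Q = {}"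
    have "Y \<subseteq> insert f (P \<union> Q)" using v(2) n by auto
    then have YP: "Y \<subseteq> P" using a dis(1)[OF f] by blast
    have "Q \<subseteq> insert e (X \<union> Y)" using u(2) m by auto
    then have "Q - {e} \<subseteq> X" using a by blast
    then have A: "Q - {e} \<subset> X" using u(5) f by auto
    have i: "insert e (Q - {e}) = Q" using e by auto
    have E': "E - insert e (Q - {e}) = insert f P" using i u(14) by simp
    have s: "r (insert e (insert f P)) = r (insert f P)" by (rule span_mono[OF v(10)]) (use YP in auto)
    have "E - (Q - {e}) = insert e (insert f P)" using u(14) e v(3) by auto
    then have "lam (Q - {e}) = lam (insert e (insert f P))" using lam_compl[of "Q - {e}"] u(2) by (metis Diff_subset subset_trans)
    then have l: "lam (Q - {e}) \<le> 2" using lam_le_span[OF s] u(20) by simp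
    have c: "2 \<le> card (Q - {e})" using u(17) e fin_sub[OF u(2)] by simp
    have "r (insert e (Q - {e})) = 2"
      by (rule min_guts(2)[OF A c]) (use l i u(19) s E' in auto)
    then show False using i u(8) by simp
  qed
  have un: "E = insert f (P \<union> Q)" using w by (auto simp: vtriple_def)
  note ux = uncross[OF un u(4,5,6,18,19,20,21) f e]
  define A where "A = X \<inter> P"
  define B where "B = X \<inter> Q"
  have A: "A \<subset> X" "f \<notin> A" "A \<subseteq> E" "finite A" using f u(4) v(1) fin_sub by (auto simp: A_def)
  have B: "B \<subset> X" "f \<notin> B" "B \<subseteq> E" "finite B" "e \<notin> B" using f u(5) v(1,4) fin_sub by (auto simp: B_def)
  have fE: "f \<in> E" "e \<in> E" "e \<noteq> f" using u(3) v(3) f v(4) by auto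
  have rA: "r (insert f A) \<le> 2"
  proof (cases "2 \<le> card A")
    case True
    have "Q \<subseteq> E - insert f A" using u(2,5,6) by (auto simp: A_def)
    then have "r (insert f (E - insert f A)) = r (E - insert f A)" by (rule span_mono[OF u(10)])
    then show ?thesis using min_guts[OF A(1) True _ A(2)] ux(1,2)[OF q4] f unfolding A_def by simp
  next
    case False
    then show ?thesis using r_le_card[of "insert f A"] A by simp
  qed
  show ?thesis
  proof (cases "2 \<le> card (Y \<inter> P)")
    case True
    have YB: "Y \<subseteq> E - insert e B" "P \<subseteq> E - insert f B"
      using v(2,5,6) u(1,4,6) by (auto simp: B_def)
    have rB: "r (insert e (insert f B)) = 2"
    proof (cases "2 \<le> card B")
      case c: True
      have s: "r (insert e (E - insert e B)) = r (E - insert e B)" "r (insert f (E - insert f B)) = r (E - insert f B)"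
        using span_mono[OF v(10) YB(1)] span_mono[OF u(9) YB(2)] by auto
      have "r B = 2" "r (insert e B) = 2" "r (insert f B) = 2"
        using min_guts[OF B(1) c _ B(5)] min_guts[OF B(1) c _ B(2)] s ux(3-6)[OF True] f unfolding B_def by auto
      then show ?thesis using span_mono[of e B "insert f B"] by auto
    next
      case False
      \<comment> \<open>For a single point \<open>g\<close>, the set \<open>{e, f, g}\<close> has
        \<open>lam\<close> at most 2 and corank at least 3, so its rank is 2.\<close>
      obtain g where "g \<in> B" using q2 by (auto simp: B_def)
      then have g: "B = {g}" using card_lt2[OF B(3) False] by auto
      have ge: "g \<in> E" "g \<noteq> e" "g \<noteq> f" using g B by auto
      have l: "lam {e, f, g} \<le> 2" using ux(6)[OF True] g unfolding B_def by simp
      have "Y \<subseteq> E - insert e {f, g}" using v(2,5) dis f g by (auto simp: B_def)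
      then have "rd (insert e {f, g}) = rd {f, g} + 1"
        by (intro rd_not_span[OF _ _ _ refl]) (use ge fE span_mono[OF v(10)] in auto)
      moreover have "2 \<le> rd {f, g}"
      proof -
        interpret D: tri_connected E rd by (rule dual_tri_connected)
        show ?thesis using D.r_ge2[of "{f,g}"] ge fE by simp
      qed
      moreover have "r {e,f,g} + rd {e,f,g} = lam {e,f,g} + 3" using rd_lam[of "{e,f,g}"] ge fE by simp
      moreover have "2 \<le> r {e,f,g}" by (rule r_ge2) (use ge fE in auto)
      ultimately show ?thesis using l g by simp
    qed
    have "X = insert f (A \<union> B)" using n v(1) f by (auto simp: A_def B_def)
    moreover have "A \<inter> B = {}" using u(6) by (auto simp: A_def B_def)
    moreover have "A \<noteq> {}" "B \<noteq> {}" using q1 q2 by (auto simp: A_def B_def)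
    ultimately show ?thesis using A(2) B(2) rA rB by blast
  next
    case False
    obtain y where "y \<in> Y \<inter> P" using q3 by auto
    then have y: "Y \<inter> P = {y}" using card_lt2[of "Y \<inter> P" y] False u(1) by auto
    have "P \<subseteq> insert e (X \<union> Y)" "y \<in> P" using u(1) m y by auto
    then have PA: "P = insert y A" using y eP unfolding A_def by blast
    have yA: "y \<notin> A" using y v(6) by (auto simp: A_def)
    have "2 \<le> card A" using u(16) PA yA A by simp
    then have "2 \<le> card (insert f A)" using A by simp
    then have "r (insert f A) = 2" using rA r_ge2[of "insert f A"] A fE by simp
    then have *: "3 \<le> card A \<and> 2 \<le> card (A \<inter> elast E r)"
      by (intro line_plus_point_triple[OF _ yA]) (use w PA in auto)
    moreover have "card (A \<inter> elast E r) \<le> card (insert f A \<inter> X \<inter> elast E r)"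
      by (rule card_mono) (use A in auto)
    ultimately have "has_segment" unfolding has_segment_def
      by (intro exI[of _ "insert f A"]) (use A fE \<open>r (insert f A) = 2\<close> in auto)
    then show ?thesis by simp
  qed
qed

text \<open>In the uncrossing, \<open>e\<close> is now a guts element and \<open>f\<close> a coguts
  element of the same set, which \<open>two_guts\<close> forbids. Only a single point in
  \<open>Y \<inter> P\<close> survives, and there \<open>line_plus_point_triple\<close> in the dual
  gives a long line of the dual.\<close>

lemma other_type_cross:
  assumes w: "vtriple E rd P f Q" and f: "f \<in> X" and e: "e \<in> Q"
  shows "has_segment"
proof -
  interpret D: fan_theta_free E rd by (rule dual_fan_theta_free)
  note u = vtriple_dualD[OF w]
  have m: "x \<in> E \<longleftrightarrow> x = e \<or> x \<in> X \<or> x \<in> Y" for x by (rule vtriple_mem[OF vt])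
  have n: "x \<in> E \<longleftrightarrow> x = f \<or> x \<in> P \<or> x \<in> Q" for x by (rule vtriple_mem[OF w])
  have dis: "x \<in> X \<Longrightarrow> x \<notin> Y" "x \<in> P \<Longrightarrow> x \<notin> Q" for x using v(6) u(6) by auto
  have eP: "e \<notin> P" using e dis by auto
  have fE: "f \<in> E" "e \<in> E" "e \<noteq> f" using u(3) v(3) f v(4) by auto
  have out: "rd (insert f Z) \<noteq> rd Z" if "Z \<subseteq> insert e Y" for Z
    using outside_closed(2)[OF f] rd_span_mono[OF _ that] by blast
  have q1: "X \<inter> P \<noteq> {}"
  proof
    assume "X \<inter> P = {}"
    moreover have "P \<subseteq> insert e (X \<union> Y)" using u(1) m by auto
    ultimately have "P \<subseteq> insert e Y" by blast
    then show False using out u(9) by blast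
  qed
  have q2: "X \<inter> Q \<noteq> {}"
  proof
    assume "X \<inter> Q = {}"
    moreover have "Q \<subseteq> insert e (X \<union> Y)" using u(2) m by auto
    ultimately have "Q \<subseteq> insert e Y" by blast
    then show False using out u(10) by blast
  qed
  have q3: "Y \<inter> P \<noteq> {}"
  proof
    assume "Y \<inter> P = {}"
    moreover have "P \<subseteq> insert e (X \<union> Y)" using u(1) m by auto
    ultimately have "P \<subseteq> X" using eP by blast
    then have "P \<subset> X" using u(4) f by auto
    then show False using min w by (auto simp: minimal_side_def)
  qed
  have q4: "Y \<inter> Q \<noteq> {}"
  proof
    assume a: "Y \<inter> Q = {}"
    have "Y \<subseteq> insert f (P \<union> Q)" using v(2) n by auto
    then have YP: "Y \<subseteq> P" using a dis(1)[OF f] by blast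
    have "Q \<subseteq> insert e (X \<union> Y)" using u(2) m by auto
    then have "Q - {e} \<subseteq> X" using a by blast
    then have A: "Q - {e} \<subset> X" using u(5) f by auto
    have AE: "Q - {e} \<subseteq> E" "f \<notin> Q - {e}" "e \<notin> Q - {e}" using u(2,5) by auto
    have i: "insert e (Q - {e}) = Q" using e by auto
    have E': "E - insert e (Q - {e}) = insert f P" using i u(14) by simp
    have s0: "r (insert e P) = r P" by (rule span_mono[OF v(10) YP])
    have s: "r (insert e (insert f P)) = r (insert f P)" by (rule span_mono[OF s0]) auto
    have e1: "E - (Q - {e}) = insert e (insert f P)" using u(14) e v(3) by auto
    then have "lam (Q - {e}) = lam (insert e (insert f P))" using lam_compl[of "Q - {e}"] u(2) by (metis Diff_subset subset_trans)
    then have l: "lam (Q - {e}) \<le> 2" using lam_le_span[OF s] u(20) by simp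
    have c: "2 \<le> card (Q - {e})" using u(17) e fin_sub[OF u(2)] by simp
    have 1: "r (Q - {e}) = 2" "r (insert e (Q - {e})) = 2"
      using min_guts[OF A c _ AE(3) l] i u(19) s E' by auto
    have e2: "E - insert f (Q - {e}) = insert e P"
      using e1 fE u(4) by (metis Diff_insert Diff_insert_absorb insert_commute insert_iff)
    then have "lam (insert f (Q - {e})) = lam (insert e P)"
      using lam_compl[of "insert f (Q - {e})"] AE(1) fE(1) by simp
    then have l2: "lam (insert f (Q - {e})) \<le> 2" using lam_le_span[OF s0] u(18) by simp
    have s2: "rd (insert f (insert e P)) = rd (insert e P)" by (rule rd_span_mono[OF u(9)]) auto
    have 2: "rd (Q - {e}) = 2" "rd (insert f (Q - {e})) = 2"
      using min_coguts[OF A c f AE(2) l l2] s2 unfolding e2 by auto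
    have "2 \<le> card (E - (Q - {e}))" unfolding e1 by (rule card_ge2I[of _ e f]) (use fE u(1) in auto)
    then have "lam (Q - {e}) = 2" using lam2[OF AE(1) c] l by simp
    then show False using two_guts[OF AE(1) _ 1(1) 2(1) fE(2,1,3) AE(3,2) 1(2) 2(2)] by blast
  qed
  have un: "E = insert f (P \<union> Q)" using w by (auto simp: vtriple_def)
  note ux = uncross[OF un u(4,5,6,18,19,20,21) f e]
  define A where "A = X \<inter> P"
  define B where "B = X \<inter> Q"
  have A: "A \<subset> X" "f \<notin> A" "A \<subseteq> E" "finite A" using f u(4) v(1) fin_sub by (auto simp: A_def)
  have B: "B \<subset> X" "f \<notin> B" "B \<subseteq> E" "finite B" "e \<notin> B" using f u(5) v(1,4) fin_sub by (auto simp: B_def)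
  have YB: "Y \<subseteq> E - insert e B" "P \<subseteq> E - insert f B"
    using v(2,5,6) u(1,4,6) by (auto simp: B_def)
  have one: "\<not> 2 \<le> card (Y \<inter> P)"
  proof
    assume big: "2 \<le> card (Y \<inter> P)"
    show False
    proof (cases "2 \<le> card B")
      case c: True
      have s: "r (insert e (E - insert e B)) = r (E - insert e B)" "rd (insert f (E - insert f B)) = rd (E - insert f B)"
        using span_mono[OF v(10) YB(1)] rd_span_mono[OF u(9) YB(2)] by auto
      have 1: "r B = 2" "r (insert e B) = 2" "rd B = 2" "rd (insert f B) = 2"
        using min_guts[OF B(1) c _ B(5)] min_coguts[OF B(1) c _ B(2)] s ux(3-6)[OF big] f unfolding B_def by auto
      have "2 \<le> card (E - B)" by (rule card_ge2I[of _ e f]) (use fE B in auto)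
      then have "lam B = 2" using lam2[OF B(3) c] ux(3)[OF big] by (simp add: B_def)
      then show False using two_guts[OF B(3) _ 1(1,3) fE(2,1,3) B(5,2) 1(2,4)] by blast
    next
      case False
      \<comment> \<open>For a single point \<open>g\<close>, the set \<open>{e, f, g}\<close> would
        have rank 3 and corank 3, hence \<open>lam\<close> equal to 3.\<close>
      obtain g where "g \<in> B" using q2 by (auto simp: B_def)
      then have g: "B = {g}" using card_lt2[OF B(3) False] by auto
      have ge: "g \<in> E" "g \<noteq> e" "g \<noteq> f" using g B by auto
      have l: "lam {e, f, g} \<le> 2" using ux(6)[OF big] g unfolding B_def by simp
      have "Y \<subseteq> E - insert e {f, g}" using v(2,5) dis f g by (auto simp: B_def)
      then have "rd (insert e {f, g}) = rd {f, g} + 1"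
        by (intro rd_not_span[OF _ _ _ refl]) (use ge fE span_mono[OF v(10)] in auto)
      moreover have "rd {f, g} = 2" using D.r_pair[of f g] ge fE by simp
      ultimately have a: "rd {e, f, g} = 3" by simp
      have Pn: "P \<subseteq> E - insert f {e, g}" using u(1,4) eP g dis(2) by (auto simp: B_def)
      have "r (insert f {e, g}) = r {e, g} + 1"
      proof -
        have "drk E rd (insert f {e, g}) = drk E rd {e, g} + 1"
          by (rule D.rd_not_span[OF _ _ _ refl]) (use ge fE D.span_mono[OF u(9) Pn] in auto)
        then show ?thesis by (simp add: rd_rd)
      qed
      moreover have "r {e, g} = 2" using r_pair[of e g] ge fE by simp
      moreover have "insert f {e, g} = {e, f, g}" by auto
      ultimately have "r {e, f, g} = 3" by simp
      then show False using a rd_lam[of "{e,f,g}"] l ge fE by simp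
    qed
  qed
  obtain y where "y \<in> Y \<inter> P" using q3 by auto
  then have y: "Y \<inter> P = {y}" using card_lt2[of "Y \<inter> P" y] one u(1) by auto
  have "P \<subseteq> insert e (X \<union> Y)" "y \<in> P" using u(1) m y by auto
  then have PA: "P = insert y A" using y eP unfolding A_def by blast
  have yA: "y \<notin> A" using y v(6) by (auto simp: A_def)
  have c: "2 \<le> card A" using u(16) PA yA A by simp
  have "Q \<subseteq> E - insert f A" using u(2,5,6) by (auto simp: A_def)
  then have "rd (insert f (E - insert f A)) = rd (E - insert f A)" by (rule rd_span_mono[OF u(10)])
  then have rA: "rd (insert f A) = 2" using min_coguts[OF A(1) c f A(2)] ux(1,2)[OF q4] unfolding A_def by simp
  then have *: "3 \<le> card A \<and> 2 \<le> card (A \<inter> elast E rd)"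
    by (intro D.line_plus_point_triple[OF _ yA]) (use w PA in auto)
  then have "2 \<le> card (A \<inter> elast E r)" by (simp add: elast_dual)
  moreover have "card (A \<inter> elast E r) \<le> card (insert f A \<inter> X \<inter> elast E r)"
    by (rule card_mono) (use A in auto)
  ultimately show ?thesis unfolding has_segment_def
    by (intro exI[of _ "insert f A"]) (use * A fE rA in auto)
qed

text \<open>The two lines through \<open>f\<close> differ, as \<open>X\<close> has rank at least 3.
  So \<open>r X = 3\<close>, and \<open>insert e Y\<close> has rank \<open>r E - 1\<close> and is
  closed by \<open>outside_closed\<close>. A cocircuit with three elements would have corank 2,
  against \<open>not_coline\<close>.\<close>

lemma crossing_lines:
  assumes E: "X = insert f (A \<union> B)" "f \<notin> A" "f \<notin> B" "A \<inter> B = {}" "A \<noteq> {}" "B \<noteq> {}"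
    "r (insert f A) \<le> 2" "r (insert e (insert f B)) = 2"
  shows "a \<in> A \<Longrightarrow> r (insert a {e, f}) \<noteq> r {e, f}"
    "k \<in> B \<Longrightarrow> r (insert k {e, f}) = r {e, f}"
    "cocirc E r X" "4 \<le> card X"
proof -
  have AE: "insert f A \<subseteq> E" "insert e (insert f B) \<subseteq> E" "e \<noteq> f" using v(1,3,4) E(1) by auto
  have spB: "r (insert k {e, f}) = r {e, f}" if "k \<in> B" for k
    by (rule line_span[OF _ AE(2), of e f]) (use that AE E(8) in \<open>auto simp: insert_absorb\<close>)
  then show "k \<in> B \<Longrightarrow> r (insert k {e, f}) = r {e, f}" .
  have ef: "r {e, f} = 2" using r_pair[of e f] AE by simp
  show "r (insert a {e, f}) \<noteq> r {e, f}" if a: "a \<in> A"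
  proof
    assume sa: "r (insert a {e, f}) = r {e, f}"
    have "r (insert x {e, f}) = r {e, f}" if "x \<in> A" for x
      by (rule line_span[OF E(7) AE(1), of f a]) (use that a E(2) sa in \<open>auto simp: insert_absorb\<close>)
    then have "r (insert x {e, f}) = r {e, f}" if "x \<in> X" for x
      using that spB unfolding E(1) by (auto simp: insert_absorb)
    then have "r ({e, f} \<union> X) = r {e, f}" by (intro span_Un) (use v(1) fin_sub in auto)
    moreover have "r X \<le> r ({e, f} \<union> X)" by (rule r_mono) auto
    ultimately show False using v(7) ef by simp
  qed
  have "r (insert f A \<union> insert e (insert f B)) + r (insert f A \<inter> insert e (insert f B)) \<le> 4"
    using r_sub[of "insert f A" "insert e (insert f B)"] E(7,8) by simp
  moreover have "r {f} \<le> r (insert f A \<inter> insert e (insert f B))" by (rule r_mono) auto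
  moreover have "r X \<le> r (insert f A \<union> insert e (insert f B))" by (rule r_mono) (use E(1) in auto)
  moreover have "r {f} = 1" using AE by (intro r_single) auto
  ultimately have r3: "r X = 3" using v(7) by simp
  then have rY: "r (insert e Y) = r E - 1" using v(10,11) by simp
  show C: "cocirc E r X" unfolding cocirc_def v(12)
    using v(1) rY outside_closed(1) not_span_insert[of _ "insert e Y"] by auto
  have "card X \<noteq> 3" using cocirc_drk[OF C] not_coline by auto
  then show "4 \<le> card X" using v(16) by simp
qed

text \<open>Without a segment, every non-elastic \<open>f\<close> in \<open>X\<close> decomposes
  \<open>X\<close> into two crossing lines. A second one, \<open>f'\<close>, lies on the line
  through \<open>e\<close> and \<open>f\<close>; then the other line has only one point
  \<open>y\<close> besides \<open>f\<close>, so the cocircuit \<open>X\<close> is contained in a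
  long line plus \<open>y\<close> and \<open>segment_elastic\<close> applies.\<close>

lemma segment_or_three: "has_segment \<or> 3 \<le> card (X \<inter> elast E r)"
proof (rule ccontr)
  assume "\<not> ?thesis"
  then have no: "\<not> has_segment" "\<not> 3 \<le> card (X \<inter> elast E r)" by auto
  define dec where "dec f A B \<longleftrightarrow> X = insert f (A \<union> B) \<and> f \<notin> A \<and> f \<notin> B \<and> A \<inter> B = {} \<and> A \<noteq> {} \<and> B \<noteq> {} \<and>
      r (insert f A) \<le> 2 \<and> r (insert e (insert f B)) = 2" for f A B
  have fX: "finite X" using v(1) fin_sub by auto
  have ex: "\<exists>A B. dec f A B" if f: "f \<in> X" "f \<notin> elast E r" for f
  proof -
    have fE: "f \<in> E" "e \<noteq> f" using f v(1,4) by auto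
    then obtain P Q where w: "vtriple E r P f Q \<or> vtriple E rd P f Q" using f unfolding elast_def by auto
    have "e \<in> P \<or> e \<in> Q" using w fE v(3) unfolding vtriple_def by auto
    then obtain P' Q' where "vtriple E r P' f Q' \<or> vtriple E rd P' f Q'" "e \<in> Q'"
      using w vtriple_sym by metis
    then show ?thesis using same_type_cross[OF _ f(1), of P' Q'] other_type_cross[OF _ f(1), of P' Q'] no(1)
      unfolding dec_def by blast
  qed
  have lines: "r (insert f A) \<le> 2" "insert f A \<subseteq> E" "r (insert e (insert f B)) \<le> 2" "insert e (insert f B) \<subseteq> E"
    "e \<notin> A" "e \<notin> B" "e \<noteq> f" "f \<notin> A" "f \<notin> B" "A \<inter> B = {}" "X = insert f (A \<union> B)" "B \<noteq> {}"
    "\<And>a. a \<in> A \<Longrightarrow> r (insert a {e, f}) \<noteq> r {e, f}" "\<And>k. k \<in> B \<Longrightarrow> r (insert k {e, f}) = r {e, f}"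
    if "dec f A B" for f A B
  proof -
    note d = that[unfolded dec_def]
    then have X: "X = insert f (A \<union> B)" by blast
    show "r (insert f A) \<le> 2" "r (insert e (insert f B)) \<le> 2" "f \<notin> A" "f \<notin> B" "A \<inter> B = {}" 
      "X = insert f (A \<union> B)" "B \<noteq> {}" using d by auto
    show "insert f A \<subseteq> E" "insert e (insert f B) \<subseteq> E" "e \<notin> A" "e \<notin> B" "e \<noteq> f"
      using v(1,3,4) unfolding X by auto
    show "\<And>a. a \<in> A \<Longrightarrow> r (insert a {e, f}) \<noteq> r {e, f}" "\<And>k. k \<in> B \<Longrightarrow> r (insert k {e, f}) = r {e, f}"
      using crossing_lines(1,2)[of f A B] d by blast+
  qed
  have X4: "cocirc E r X" "4 \<le> card X" if "dec f A B" for f A B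
    using crossing_lines(3,4)[of f A B] that unfolding dec_def by blast+
  \<comment> \<open>\<open>e\<close> is joined to \<open>B'\<close>, while \<open>f\<close> and a
    point \<open>k\<close> of \<open>B\<close> are distributed over \<open>A'\<close> and
    \<open>B'\<close>. So one of the lines through \<open>f'\<close> has two points on the line of
    \<open>e\<close> and \<open>f\<close>, and \<open>f'\<close> lies there too.\<close>
  have notA: "f' \<notin> A" if d: "dec f A B" "dec f' A' B'" "f' \<noteq> f" for f A B f' A' B'
  proof
    assume f': "f' \<in> A"
    note l = lines[OF d(1)] and l' = lines[OF d(2)]
    have ef: "r (insert e {e, f}) = r {e, f}" "r (insert f {e, f}) = r {e, f}" by (simp_all add: insert_absorb)
    obtain k where k: "k \<in> B" using l(12) by auto
    have kf: "k \<noteq> f'" "k \<noteq> f" "k \<noteq> e" using k f' l(6,9,10) by auto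
    have "k \<in> X" "f \<in> X" using k l(11) by auto
    then have "k \<in> A' \<or> k \<in> B'" "f \<in> A' \<or> f \<in> B'" using kf d(3) l'(11) by auto
    then consider "k \<in> B'" | "f \<in> B'" | "k \<in> A'" "f \<in> A'" by blast
    then have "r (insert f' {e, f}) = r {e, f}"
    proof cases
      case 1
      show ?thesis by (rule line_span[OF l'(3,4), of e k]) (use 1 kf ef l(14)[OF k] in auto)
    next
      case 2
      show ?thesis by (rule line_span[OF l'(3,4), of e f]) (use 2 l(7) ef in auto)
    next
      case 3
      show ?thesis by (rule line_span[OF l'(1,2), of f k]) (use 3 kf ef l(14)[OF k] in auto)
    qed
    then show False using l(13)[OF f'] by simp
  qed
  \<comment> \<open>With a single non-elastic element, the bound \<open>4 \<le> card X\<close> would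
    leave three elastic ones.\<close>
  have "\<exists>f f'. f \<in> X \<and> f' \<in> X \<and> f \<noteq> f' \<and> f \<notin> elast E r \<and> f' \<notin> elast E r"
  proof (rule ccontr)
    assume a: "\<not> ?thesis"
    show False
    proof (cases "X \<subseteq> elast E r")
      case True
      then have "X \<inter> elast E r = X" by auto
      then show False using v(16) no by simp
    next
      case False
      then obtain f where f: "f \<in> X" "f \<notin> elast E r" by auto
      then have "X - {f} \<subseteq> X \<inter> elast E r" using a by blast
      then have "card (X - {f}) \<le> card (X \<inter> elast E r)" by (rule card_mono[rotated]) (use fX in auto)
      moreover have "4 \<le> card X" using ex[OF f] X4 by blast
      ultimately show False using no f fX by simp
    qed
  qed
  then obtain f f' where ff: "f \<in> X" "f' \<in> X" "f \<noteq> f'" "f \<notin> elast E r" "f' \<notin> elast E r" by blast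
  obtain A B where d: "dec f A B" using ex ff by blast
  obtain A' B' where d': "dec f' A' B'" using ex ff by blast
  note l = lines[OF d] and l' = lines[OF d']
  have f'B: "f' \<in> B" using notA[OF d d'] ff l(11) by blast
  \<comment> \<open>Two points of \<open>A\<close> would both be in \<open>A'\<close>, so the lines
    \<open>insert f A\<close> and \<open>insert f' A'\<close> span each other. They contain
    \<open>f\<close> and \<open>f'\<close>, hence span \<open>e\<close>, and \<open>a\<close> would
    lie on the line through \<open>e\<close> and \<open>f\<close>.\<close>
  have A1: "a = a'" if a: "a \<in> A" "a' \<in> A" for a a'
  proof (rule ccontr)
    assume ne: "a \<noteq> a'"
    have ef: "r (insert e {e, f}) = r {e, f}" by (simp add: insert_absorb)
    have inA: "x \<in> A'" if x: "x \<in> A" for x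
    proof -
      have "x \<noteq> f'" using x f'B l(10) by auto
      moreover have "x \<notin> B'"
      proof
        assume "x \<in> B'"
        then have "r (insert x {e, f}) = r {e, f}"
          using line_span[OF l'(3,4) _ _ l'(7) _ ef l(14)[OF f'B], of x] by blast
        then show False using l(13)[OF x] by simp
      qed
      ultimately show ?thesis using x l(11) l'(11) by blast
    qed
    define T where "T = {a, f'}"
    have af: "a \<noteq> f'" using inA[OF a(1)] l'(8) by auto
    have T: "r (insert a T) = r T" "r (insert f' T) = r T" by (auto simp: T_def insert_absorb)
    have 1: "r (insert a' T) = r T"
      by (rule line_span[OF l'(1,2), of f' a]) (use inA a af T in auto)
    have 2: "r (insert f T) = r T"
      by (rule line_span[OF l(1,2), of a a']) (use a ne 1 T in auto)
    have 3: "r (insert e T) = r T"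
      by (rule line_span[OF l(3,4), of f f']) (use ff f'B 2 T in auto)
    have "r (T \<union> {a, e, f}) = r T" by (rule span_Un) (use T 2 3 in auto)
    moreover have "r {a, e, f} \<le> r (T \<union> {a, e, f})" by (rule r_mono) auto
    moreover have "r T \<le> int (card T)" by (rule r_le_card) (simp add: T_def)
    moreover have "card T = 2" using af by (simp add: T_def)
    moreover have "r {e, f} = 2" using r_pair[of e f] l(4,7) by simp
    moreover have "r {e, f} \<le> r (insert a {e, f})" by (rule r_le_insert)
    ultimately show False using l(13)[OF a(1)] by simp
  qed
  obtain y where y: "y \<in> A" using d unfolding dec_def by auto
  then have Ay: "A = {y}" using A1 by auto
  define K where "K = insert e (insert f B)"
  have rK: "r K = 2" "K \<subseteq> E" using d l(4) unfolding dec_def K_def by auto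
  obtain L where L: "L = {x \<in> E. r (insert x K) = 2}" "L \<subseteq> E" "K \<subseteq> L" "r L = 2"
    "\<And>x. x \<in> E \<Longrightarrow> r (insert x L) = 2 \<Longrightarrow> x \<in> L"
    by (rule line_closure[OF rK(2,1)]) auto
  have yL: "y \<notin> L"
  proof
    assume "y \<in> L"
    then have "{y, e, f} \<subseteq> L" using L(3) by (auto simp: K_def)
    then have "r (insert y {e, f}) \<le> 2" using r_mono[of "{y,e,f}" L] L(4) by simp
    moreover have "r {e, f} = 2" using r_pair[of e f] l(4,7) by simp
    ultimately show False using l(13)[OF y] r_le_insert[of "{e,f}" y] by simp
  qed
  have yX: "y \<in> X" using y l(11) by auto
  have XL: "X \<subseteq> insert y L" using l(11) L(3) unfolding K_def Ay by auto
  have fB: "finite B" using l(4) fin_sub by (metis finite_insert)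
  have "card X \<le> Suc (Suc (card B))" unfolding l(11) Ay using fB by (auto simp: card_insert_if)
  then have "2 \<le> card B" using X4(2)[OF d] by simp
  moreover have "card K = card B + 2" unfolding K_def using fB l(6,7,9) by simp
  moreover have "card K \<le> card L" by (rule card_mono) (use L fin_sub in auto)
  ultimately have L4: "4 \<le> card L" by simp
  have "2 \<le> card (X \<inter> L \<inter> elast E r)"
    by (rule segment_elastic[OF L(2,4) L4 L(5) X4(1)[OF d] yX yL XL])
  then have has_segment unfolding has_segment_def using L(2,4) L4 by (metis inf_commute)
  then show False using no by simp
qed

end

section \<open>Exactly four elastic elements\<close>

abbreviation any_triple :: "'a set \<Rightarrow> ('a set \<Rightarrow> int) \<Rightarrow> 'a set \<Rightarrow> 'a \<Rightarrow> 'a set \<Rightarrow> bool" where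
  "any_triple E r P g Q \<equiv> vtriple E r P g Q \<or> vtriple E (drk E r) P g Q"

lemma any_triple_sym: "any_triple E r P g Q \<Longrightarrow> any_triple E r Q g P"
  using vtriple_sym by metis

context fan_theta_free
begin

lemma minimal_side_elastic:
  assumes vt: "vtriple E r X e Y" and min: "minimal_side E r X"
  shows "3 \<le> card (X \<inter> elast E r) \<or>
    (\<exists>L. L \<subseteq> E \<and> (r L = 2 \<or> rd L = 2) \<and> 4 \<le> card L \<and> 2 \<le> card (L \<inter> X \<inter> elast E r)) \<or>
    (rd X = 2 \<and> card X = 3 \<and> 2 \<le> card (X \<inter> elast E r) \<and> (\<forall>g \<in> X. \<forall>P Q. \<not> vtriple E r P g Q))"
proof (cases "rd X = 2")
  case True
  interpret D: fan_theta_free E rd by (rule dual_fan_theta_free)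
  have "vtriple E (drk E rd) X e Y" using vt by (simp add: rd_rd)
  from D.line_dual_triple[OF this True] show ?thesis using True unfolding rd_rd elast_dual by blast
next
  case False
  interpret minimal_triple E r X e Y by unfold_locales (use vt min False in auto)
  show ?thesis using segment_or_three unfolding has_segment_def by blast
qed

lemma minimal_side_dual: "minimal_side E rd X \<longleftrightarrow> minimal_side E r X"
  by (auto simp: minimal_side_def rd_rd)

lemma ex_minimal_triple:
  assumes "any_triple E r P g Q"
  obtains A h B where "any_triple E r A h B" "A \<subseteq> P" "minimal_side E r A"
proof -
  define S where "S A \<longleftrightarrow> A \<subseteq> P \<and> (\<exists>h B. any_triple E r A h B)" for A
  have PE: "finite P" using assms vtripleD(1) vtriple_dualD(1) fin_sub by metis
  have "S P" using assms by (auto simp: S_def)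
  then obtain A where A: "S A" "\<And>A'. S A' \<Longrightarrow> card A \<le> card A'"
    using ex_has_least_nat[of S P card] by blast
  have "minimal_side E r A"
    unfolding minimal_side_def
  proof (intro allI impI)
    fix A' g B assume a: "A' \<subset> A"
    have "A \<subseteq> P" using A(1) by (simp add: S_def)
    then have "card A' < card A" using a PE by (metis psubset_card_mono finite_subset)
    then have "\<not> S A'" using A(2) by force
    then show "\<not> vtriple E r A' g B \<and> \<not> vtriple E rd A' g B" using a \<open>A \<subseteq> P\<close> unfolding S_def by blast
  qed
  then show ?thesis using A(1) that unfolding S_def by blast
qed

text \<open>A minimal side inside \<open>P\<close> already supplies two elements of
  \<open>elast\<close> in each of its alternatives.\<close>

lemma triple_elastic:
  assumes "any_triple E r P g Q"
  shows "2 \<le> card (P \<inter> elast E r)"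
proof -
  interpret D: fan_theta_free E rd by (rule dual_fan_theta_free)
  obtain A h B where A: "any_triple E r A h B" "A \<subseteq> P" "minimal_side E r A"
    by (rule ex_minimal_triple[OF assms])
  have fP: "finite P" using assms vtripleD(1) vtriple_dualD(1) fin_sub by metis
  have fA: "finite A" using A(2) fP finite_subset by auto
  have sub: "2 \<le> card (A \<inter> elast E r)" if "2 \<le> card (L \<inter> A \<inter> elast E r)" for L
  proof -
    have "card (L \<inter> A \<inter> elast E r) \<le> card (A \<inter> elast E r)" by (rule card_mono) (use fA in auto)
    then show ?thesis using that by simp
  qed
  have "2 \<le> card (A \<inter> elast E r)"
  proof (cases "vtriple E r A h B")
    case True
    show ?thesis using minimal_side_elastic[OF True A(3)] sub by auto
  next
    case False
    then have "vtriple E rd A h B" using A(1) by simp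
    then show ?thesis using D.minimal_side_elastic[of A h B] A(3) sub unfolding minimal_side_dual elast_dual by auto
  qed
  moreover have "card (A \<inter> elast E r) \<le> card (P \<inter> elast E r)" by (rule card_mono) (use A fP in auto)
  ultimately show ?thesis by simp
qed

text \<open>A spanned \<open>b\<close> could move to \<open>P\<close>, leaving the side
  \<open>Q - {b}\<close> with at most one elastic element, against \<open>triple_elastic\<close>. In
  the dual-spanned case the result fails to be a triple only if \<open>Q - {b}\<close> and
  \<open>g\<close> lie on a line; then \<open>line_plus_point_triple\<close> finds two elastic
  elements in \<open>Q - {b}\<close>.\<close>

lemma elastic_not_spanned_vtriple:
  assumes vt: "vtriple E r P g Q" and b: "b \<in> Q" "b \<in> elast E r" and c: "card (Q \<inter> elast E r) \<le> 2"
  shows "r (insert b P) \<noteq> r P" "rd (insert b P) \<noteq> rd P"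
proof -
  note v = vtripleD[OF vt]
  have fQ: "finite Q" using v(2) fin_sub by auto
  have lt: "\<not> 2 \<le> card ((Q - {b}) \<inter> elast E r)"
  proof -
    have "(Q - {b}) \<inter> elast E r \<subset> Q \<inter> elast E r" using b by auto
    then have "card ((Q - {b}) \<inter> elast E r) < card (Q \<inter> elast E r)"
      by (rule psubset_card_mono[rotated]) (use fQ in auto)
    then show ?thesis using c by simp
  qed
  have nt: "\<not> any_triple E r (Q - {b}) g S" for S using triple_elastic lt by blast
  have bE: "b \<in> E" "b \<notin> P" "b \<noteq> g" using b v(2,5,6) by auto
  have c2: "2 \<le> card (Q - {b})" using v(17) b fQ by simp
  have e: "E - (Q - {b}) = insert b (insert g P)" using v(14) bE(1) b by auto
  have e': "E - insert g (Q - {b}) = insert b P" using e v(4) bE v(3) 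
    by (metis Diff_insert Diff_insert_absorb insert_commute insert_iff)
  have i: "insert g (insert b P \<union> (Q - {b})) = E" using b vt by (auto simp: vtriple_def)
  have QE: "Q - {b} \<subseteq> E" "g \<notin> Q - {b}" using v(2,5) by auto
  have dis: "(Q - {b}) \<inter> insert b P = {}" using v(6) by auto
  show "r (insert b P) \<noteq> r P"
  proof
    assume s: "r (insert b P) = r P"
    have "r (insert b (insert g P)) = r (insert g P)" by (rule span_mono[OF s]) auto
    then have s2: "r (insert b (insert g P)) = r P" using v(9) by simp
    have "2 \<le> card (E - (Q - {b}))" unfolding e by (rule card_ge2I[of _ b g]) (use bE v(1,3) in auto)
    then have "2 \<le> lam (Q - {b})" using lam2[OF QE(1) c2] by simp
    then have "r Q \<le> r (Q - {b})" unfolding lam_def e s2 using v(11) by simp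
    then have rQ: "r (Q - {b}) = r Q" using r_mono[of "Q - {b}" Q] by auto
    have "r (insert g (Q - {b})) \<le> r (insert g Q)" by (rule r_mono) auto
    then have "r (insert g (Q - {b})) = r (Q - {b})" using rQ v(10) r_le_insert[of "Q - {b}" g] by simp
    moreover have "insert g (Q - {b} \<union> insert b P) = E" using i by (simp add: Un_commute)
    moreover have "r (insert g (insert b P)) = r (insert b P)" using s2 s by (simp add: insert_commute)
    ultimately have "vtriple E r (Q - {b}) g (insert b P)" unfolding vtriple_def
      using dis QE(2) v(4,7,8,11) bE rQ s by simp
    then show False using nt by blast
  qed
  show "rd (insert b P) \<noteq> rd P"
  proof
    assume s: "rd (insert b P) = rd P"
    have "rd (insert b (insert g P)) = rd (insert g P)" by (rule rd_span_mono[OF s]) auto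
    then have "lam (insert b (insert g P)) \<le> 2"
      using lam_le_rd_span[of "insert g P" b] v(1,3,20) bE(1) by simp
    then have l1: "lam (Q - {b}) \<le> 2" using lam_compl[OF QE(1)] unfolding e by simp
    have "lam (insert b P) \<le> 2" using lam_le_rd_span[OF v(1) bE(1) s] v(18) by simp
    then have l2: "lam (insert g (Q - {b})) \<le> 2"
      using lam_compl[of "insert g (Q - {b})"] QE(1) v(3) unfolding e' by simp
    have r3: "3 \<le> r (insert b P)" using v(7) r_le_insert[of P b] by simp
    have sp: "r (insert g (insert b P)) = r (insert b P)" by (rule span_mono[OF v(9)]) auto
    have "r (insert g (Q - {b})) = 2"
      by (rule guts_triple(2)[OF QE(1) c2 v(3) QE(2) l1 l2 e'[symmetric] r3 sp]) (use nt in blast)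
    moreover have "insert b (Q - {b}) = Q" using b by auto
    ultimately have "2 \<le> card ((Q - {b}) \<inter> elast E r)"
      using line_plus_point_triple[of b "Q - {b}" g P] vtriple_sym[OF vt] by simp
    then show False using lt by simp
  qed
qed

lemma elastic_not_spanned:
  assumes t: "any_triple E r P g Q" and b: "b \<in> Q" "b \<in> elast E r" and c: "card (Q \<inter> elast E r) \<le> 2"
  shows "r (insert b P) \<noteq> r P" "rd (insert b P) \<noteq> rd P"
proof -
  interpret D: fan_theta_free E rd by (rule dual_fan_theta_free)
  have "r (insert b P) \<noteq> r P \<and> rd (insert b P) \<noteq> rd P"
  proof (cases "vtriple E r P g Q")
    case True
    then show ?thesis using elastic_not_spanned_vtriple[OF True b c] by simp
  next
    case False
    then have w: "vtriple E rd P g Q" using t by simp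
    show ?thesis using D.elastic_not_spanned_vtriple[OF w b(1)] b(2) c unfolding rd_rd elast_dual by simp
  qed
  then show "r (insert b P) \<noteq> r P" "rd (insert b P) \<noteq> rd P" by auto
qed

text \<open>Of three points of the line other than \<open>g\<close>, two are on one side. That side
  spans the line, hence the elastic element on the opposite side.\<close>

lemma segment_not_split:
  assumes L: "L \<subseteq> E" "r L = 2" "4 \<le> card L" and ab: "a \<in> L" "b \<in> L" "a \<in> elast E r" "b \<in> elast E r"
    and t: "any_triple E r P g Q" and c: "card (P \<inter> elast E r) \<le> 2" "card (Q \<inter> elast E r) \<le> 2"
  shows "\<not> (a \<in> P \<and> b \<in> Q)"
proof
  assume s: "a \<in> P \<and> b \<in> Q"
  have "3 \<le> card (L - {g})" using L fin_sub[OF L(1)] card_Diff_singleton_if[of L g] by (auto split: if_splits)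
  then obtain x y z where xyz: "x \<in> L - {g}" "y \<in> L - {g}" "z \<in> L - {g}" "x \<noteq> y" "x \<noteq> z" "y \<noteq> z"
    by (rule card_ge3E)
  have mem: "x \<in> P \<or> x \<in> Q" if "x \<in> L - {g}" for x
    using that L(1) t unfolding vtriple_def by blast
  have sp: "r (insert l S) = r S" if "x \<in> L" "y \<in> L" "x \<noteq> y" "x \<in> S" "y \<in> S" "l \<in> L" for l x y S
    by (rule line_span[of L x y]) (use that L in \<open>auto simp: insert_absorb\<close>)
  have P: "\<not> (u \<in> P \<and> w \<in> P)" if "u \<in> L" "w \<in> L" "u \<noteq> w" for u w
    using sp[OF that, of P b] elastic_not_spanned(1)[OF t _ ab(4) c(2)] s ab by blast
  have Q: "\<not> (u \<in> Q \<and> w \<in> Q)" if "u \<in> L" "w \<in> L" "u \<noteq> w" for u w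
    using sp[OF that, of Q a] elastic_not_spanned(1)[OF any_triple_sym[OF t] _ ab(3) c(1)] s ab by blast
  show False using mem[OF xyz(1)] mem[OF xyz(2)] mem[OF xyz(3)] P[of x y] P[of x z] P[of y z]
      Q[of x y] Q[of x z] Q[of y z] xyz by blast
qed

text \<open>A long line is covered by \<open>segment_not_split\<close>. Otherwise \<open>X\<close>
  has three elements and corank 2. Its third element \<open>h\<close> is on one of the sides, or it
  is the middle, and then the triple is a dual one; either way some side spans \<open>h\<close> in
  the dual, hence all of \<open>X\<close>, against \<open>elastic_not_spanned\<close>.\<close>

lemma minimal_not_split:
  assumes vt: "vtriple E r X e Y" and min: "minimal_side E r X"
    and X: "X \<inter> elast E r = {a, b}" "a \<noteq> b"
    and c: "\<And>P g Q. any_triple E r P g Q \<Longrightarrow> card (P \<inter> elast E r) \<le> 2"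
    and t: "any_triple E r P g Q"
  shows "\<not> (a \<in> P \<and> b \<in> Q)"
proof -
  interpret D: fan_theta_free E rd by (rule dual_fan_theta_free)
  have ab: "a \<in> elast E r" "b \<in> elast E r" "a \<in> X" "b \<in> X" using X by auto
  note cP = c[OF t] and cQ = c[OF any_triple_sym[OF t]]
  consider L where "L \<subseteq> E" "r L = 2 \<or> rd L = 2" "4 \<le> card L" "2 \<le> card (L \<inter> X \<inter> elast E r)"
    | "rd X = 2" "card X = 3" "\<forall>g \<in> X. \<forall>P Q. \<not> vtriple E r P g Q"
    using minimal_side_elastic[OF vt min] X by auto
  then show ?thesis
  proof cases
    case 1
    have "L \<inter> X \<inter> elast E r = {a, b}"
    proof (rule card_seteq)
      show "L \<inter> X \<inter> elast E r \<subseteq> {a, b}" using X by auto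
    qed (use 1 X in auto)
    then have aL: "a \<in> L" "b \<in> L" by auto
    show ?thesis
    proof (cases "r L = 2")
      case True
      show ?thesis by (rule segment_not_split[OF 1(1) True 1(3) aL ab(1,2) t cP cQ])
    next
      case False
      then have rL: "rd L = 2" using 1 by simp
      have t': "any_triple E rd P g Q" using t by (auto simp: rd_rd)
      show ?thesis using D.segment_not_split[OF 1(1) rL 1(3) aL _ _ t'] ab cP cQ unfolding elast_dual by simp
    qed
  next
    case 2
    have XE: "X \<subseteq> E" using vtripleD(1)[OF vt] .
    show ?thesis
    proof
      assume s: "a \<in> P \<and> b \<in> Q"
      have "card (X - {a, b}) = 1" using 2 X ab by (simp add: card_Diff_subset)
      then obtain h where h: "X - {a, b} = {h}" by (auto simp: card_1_singleton_iff)
      then have hX: "h \<in> X" "h \<noteq> a" "h \<noteq> b" by auto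
      have sp: "rd (insert l S) = rd S" if "x \<in> X" "y \<in> X" "x \<noteq> y" "rd (insert x S) = rd S" "rd (insert y S) = rd S" "l \<in> X" for l x y S
        by (rule D.line_span[of X x y]) (use that XE 2 in auto)
      have no: "rd (insert b P) \<noteq> rd P" "rd (insert a Q) \<noteq> rd Q"
        using elastic_not_spanned(2)[OF t _ ab(2) cQ] elastic_not_spanned(2)[OF any_triple_sym[OF t] _ ab(1) cP] s by auto
      have "rd (insert h P) = rd P \<or> rd (insert h Q) = rd Q"
      proof (cases "h = g")
        case True
        then have "vtriple E rd P h Q" using t 2 hX by auto
        then show ?thesis using vtriple_dualD(9) by blast
      next
        case False
        then have "h \<in> P \<or> h \<in> Q" using hX XE t unfolding vtriple_def by blast
        then show ?thesis by (auto simp: insert_absorb)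
      qed
      then show False
      proof
        assume "rd (insert h P) = rd P"
        moreover have "insert a P = P" using s by auto
        ultimately have "rd (insert b P) = rd P" using sp[OF ab(3) hX(1) hX(2)[symmetric] _ _ ab(4)] by simp
        then show False using no by simp
      next
        assume "rd (insert h Q) = rd Q"
        moreover have "insert b Q = Q" using s by auto
        ultimately have "rd (insert a Q) = rd Q" using sp[OF ab(4) hX(1) hX(3)[symmetric] _ _ ab(3)] by simp
        then show False using no by simp
      qed
    qed
  qed
qed

end

section \<open>Chains of 3-separating sets\<close>

context tri_connected
begin

definition narrow :: "'a list \<Rightarrow> bool" where
  "narrow es \<longleftrightarrow> (\<forall>i. lam (set (take i es)) \<le> 2)"

lemma narrow_snoc: "narrow es \<Longrightarrow> lam (insert x (set es)) \<le> 2 \<Longrightarrow> narrow (es @ [x])"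
  unfolding narrow_def
proof
  fix i assume a: "\<forall>i. lam (set (take i es)) \<le> 2" "lam (insert x (set es)) \<le> 2"
  show "lam (set (take i (es @ [x]))) \<le> 2"
  proof (cases "i \<le> length es")
    case False
    then have "take i (es @ [x]) = es @ [x]" by simp
    then show ?thesis using a by simp
  qed (use a in simp)
qed

text \<open>A maximal proper subset \<open>B\<close> of \<open>A\<close> is compared with the set
  \<open>Z\<close> supplied for some \<open>g\<close> in \<open>A - B\<close>. By maximality
  \<open>B \<union> Z\<close> meets \<open>A\<close> in \<open>B\<close>, so
  \<open>B \<union> insert g Z\<close> meets it in \<open>insert g B\<close>, which is 3-separating
  and therefore equals \<open>A\<close>.\<close>

lemma narrow_ordering:
  assumes abcd: "{a, b, c, d} \<subseteq> E" "distinct [a, b, c, d]"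
    and P: "\<And>g. g \<in> E - {a, b, c, d} \<Longrightarrow> \<exists>P \<subseteq> E. {a, b} \<subseteq> P \<and> P \<inter> {c, d, g} = {} \<and> lam P \<le> 2 \<and> lam (insert g P) \<le> 2"
  shows "\<exists>es. distinct es \<and> set es = E \<and> narrow es"
proof -
  have ordA: "\<exists>es. distinct es \<and> set es = A \<and> narrow es"
    if "A \<subseteq> E" "{a, b} \<subseteq> A" "A \<inter> {c, d} = {}" "lam A \<le> 2" for A
    using that
  proof (induction "card A" arbitrary: A rule: less_induct)
    case less
    have fA: "finite A" using less fin_sub by auto
    show ?case
    proof (cases "A = {a, b}")
      case True
      have "narrow [a, b]" unfolding narrow_def
      proof
        fix i
        have "set (take i [a, b]) \<subseteq> {a, b}" using set_take_subset by force
        moreover from this have "card (set (take i [a, b])) \<le> card {a, b}" by (intro card_mono) auto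
        moreover have "card {a, b} = 2" using abcd by simp
        ultimately show "lam (set (take i [a, b])) \<le> 2"
          using lam_le_card[of "set (take i [a, b])"] abcd(1) by fastforce
      qed
      then show ?thesis using True abcd by (intro exI[of _ "[a, b]"]) auto
    next
      case False
      define S where "S B \<longleftrightarrow> B \<subset> A \<and> {a, b} \<subseteq> B \<and> lam B \<le> 2" for B
      have "lam {a, b} \<le> 2" using lam_le_card[of "{a,b}"] abcd by simp
      then have "S {a, b}" using False less.prems(2) unfolding S_def by auto
      moreover have "\<forall>B. S B \<longrightarrow> card B < Suc (card A)"
        unfolding S_def using fA by (auto intro: card_mono simp: less_Suc_eq_le)
      ultimately have "\<exists>B. S B \<and> (\<forall>B'. S B' \<longrightarrow> card B' \<le> card B)" by (rule ex_has_greatest_nat)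
      then obtain B where B: "S B" "\<And>B'. S B' \<Longrightarrow> card B' \<le> card B" by blast
      then have B': "B \<subset> A" "{a, b} \<subseteq> B" "lam B \<le> 2" by (auto simp: S_def)
      have mx: "B' = A" if "B \<subset> B'" "B' \<subseteq> A" "lam B' \<le> 2" for B'
      proof (rule ccontr)
        assume "B' \<noteq> A"
        then have "S B'" using that B'(2) unfolding S_def by blast
        moreover have "card B < card B'" using that fA by (metis psubset_card_mono finite_subset)
        ultimately show False using B(2) by force
      qed
      obtain g where g: "g \<in> A" "g \<notin> B" using B' by auto
      then have "g \<in> E - {a, b, c, d}" using less.prems(1,3) B'(2) by auto
      from P[OF this] obtain Z where Z: "Z \<subseteq> E" "{a, b} \<subseteq> Z" "Z \<inter> {c, d, g} = {}" "lam Z \<le> 2" "lam (insert g Z) \<le> 2"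
        by blast
      \<comment> \<open>With \<open>a\<close>, \<open>b\<close> inside and \<open>c\<close>,
        \<open>d\<close> outside, intersection and union both have \<open>lam\<close> at least 2, so
        submodularity leaves no slack.\<close>
      have meet: "lam (S \<inter> T) \<le> 2 \<and> lam (S \<union> T) \<le> 2"
        if "lam S \<le> 2" "lam T \<le> 2" "{a, b} \<subseteq> S" "{a, b} \<subseteq> T" "S \<inter> {c, d} = {}" "T \<inter> {c, d} = {}" "S \<subseteq> E" "T \<subseteq> E" for S T
      proof -
        have "2 \<le> card (S \<inter> T)" "2 \<le> card (S \<union> T)"
          by (rule card_ge2I[of _ a b]; use that abcd in auto)+
        moreover have "2 \<le> card (E - (S \<inter> T))" "2 \<le> card (E - (S \<union> T))"
          by (rule card_ge2I[of _ c d]; use that abcd in auto)+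
        ultimately have "2 \<le> lam (S \<inter> T)" "2 \<le> lam (S \<union> T)" using lam2[of "S \<inter> T"] lam2[of "S \<union> T"] that(7,8) by auto
        then show ?thesis using lam_submod[of S T] that(1,2) by simp
      qed
      have BE: "B \<subseteq> E" "B \<inter> {c, d} = {}" using B'(1) less.prems by auto
      have "lam ((B \<union> Z) \<inter> A) \<le> 2"
        by (rule conjunct1[OF meet]) (use meet[of B Z] B' BE Z less.prems in auto)
      moreover have "B \<subseteq> (B \<union> Z) \<inter> A" "g \<notin> (B \<union> Z) \<inter> A" using B'(1) g Z by auto
      ultimately have e1: "(B \<union> Z) \<inter> A = B" using mx[of "(B \<union> Z) \<inter> A"] g(1) by blast
      have gcd: "g \<noteq> c" "g \<noteq> d" using g(1) less.prems(3) by auto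
      have "lam ((B \<union> insert g Z) \<inter> A) \<le> 2"
        by (rule conjunct1[OF meet])
           (use meet[of B "insert g Z"] B' BE Z less.prems gcd g in auto)
      moreover have "(B \<union> insert g Z) \<inter> A = insert g B" using e1 g(1) by auto
      ultimately have "lam (insert g B) \<le> 2" by simp
      then have A: "A = insert g B" using mx[of "insert g B"] g B'(1) by blast
      have "card B < card A" using B'(1) fA by (rule psubset_card_mono[rotated])
      then obtain es where "distinct es" "set es = B" "narrow es" using less.hyps[of B] BE B' by blast
      then show ?thesis using narrow_snoc[of es g] less.prems(4) A g by (intro exI[of _ "es @ [g]"]) auto
    qed
  qed
  \<comment> \<open>\<open>c\<close> and \<open>d\<close> come last: the remaining initial segments
    have complements with at most two elements.\<close>
  define A where "A = E - {c, d}"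
  have cd: "{c, d} \<subseteq> E" "c \<noteq> d" using abcd by auto
  have "lam A = lam {c, d}" unfolding A_def by (rule lam_compl) (use abcd in auto)
  then have "lam A \<le> 2" using lam_le_card[OF cd(1)] cd(2) by simp
  then obtain es where es: "distinct es" "set es = A" "narrow es" using ordA[of A] abcd unfolding A_def by auto
  have "insert c A = E - {d}" using cd unfolding A_def by auto
  moreover have "lam (E - {d}) = lam {d}" by (rule lam_compl) (use abcd in auto)
  ultimately have "lam (insert c (set es)) \<le> 2" using es lam_le_card[of "{d}"] cd by simp
  then have n1: "narrow (es @ [c])" by (rule narrow_snoc[OF es(3)])
  have sE: "insert d (set (es @ [c])) = E" using es cd unfolding A_def by auto
  have "lam E \<le> 2" by (simp add: lam_def r_empty)
  then have "narrow ((es @ [c]) @ [d])" using narrow_snoc[OF n1, of d] unfolding sE by simp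
  moreover have "distinct ((es @ [c]) @ [d])" using es cd unfolding A_def by auto
  moreover have "set ((es @ [c]) @ [d]) = E" using sE by auto
  ultimately show ?thesis by blast
qed

end

context fan_theta_free
begin

text \<open>Two elements of \<open>elast\<close> on each side and at most four in all leave exactly
  two per side, and no triple with non-elastic middle separates \<open>a\<close> from
  \<open>b\<close>. So each other \<open>g\<close> has a triple with a side that contains
  \<open>a\<close>, \<open>b\<close> and avoids \<open>c\<close>, \<open>d\<close>,
  \<open>g\<close>, as \<open>narrow_ordering\<close> requires.\<close>

lemma narrow_of_minimal:
  assumes c4: "card (elast E r) \<le> 4" and vt: "vtriple E r X e Y" and min: "minimal_side E r X"
  shows "\<exists>es. distinct es \<and> set es = E \<and> narrow es"
proof -
  have fE: "finite (elast E r)" using fin by (auto simp: elast_def)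
  have two: "card (P \<inter> elast E r) = 2" if t: "any_triple E r P g Q" for P g Q
  proof -
    have "P \<inter> Q = {}" using t unfolding vtriple_def by blast
    then have "card (P \<inter> elast E r \<union> Q \<inter> elast E r) = card (P \<inter> elast E r) + card (Q \<inter> elast E r)"
      by (intro card_Un_disjoint) (use fE in auto)
    moreover have "card (P \<inter> elast E r \<union> Q \<inter> elast E r) \<le> card (elast E r)" by (rule card_mono) (use fE in auto)
    ultimately show ?thesis using triple_elastic[OF t] triple_elastic[OF any_triple_sym[OF t]] c4 by simp
  qed
  have tX: "any_triple E r X e Y" using vt by simp
  obtain a b where ab: "X \<inter> elast E r = {a, b}" "a \<noteq> b" using two[OF tX] by (auto simp: card_2_iff)
  obtain c d where cd: "Y \<inter> elast E r = {c, d}" "c \<noteq> d"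
    using two[OF any_triple_sym[OF tX]] by (auto simp: card_2_iff)
  have "X \<inter> Y = {}" by (rule vtripleD(6)[OF vt])
  then have dist: "distinct [a, b, c, d]" using ab cd by auto
  have sub: "{a, b, c, d} \<subseteq> elast E r" using ab cd by auto
  have "card {a, b, c, d} = 4" using dist by simp
  then have El: "{a, b, c, d} = elast E r" by (intro card_seteq[OF fE sub]) (use c4 in simp)
  have split: "(a \<in> P \<and> b \<in> P) \<or> (a \<in> Q \<and> b \<in> Q)" if t: "any_triple E r P g Q" "g \<notin> elast E r" for P g Q
  proof -
    have "a \<in> P \<or> a \<in> Q" "b \<in> P \<or> b \<in> Q"
      using t sub unfolding vtriple_def elast_def by blast+
    moreover have "\<not> (a \<in> P \<and> b \<in> Q)" by (rule minimal_not_split[OF vt min ab _ t(1)]) (use two in simp)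
    moreover have "\<not> (a \<in> Q \<and> b \<in> P)"
      by (rule minimal_not_split[OF vt min ab _ any_triple_sym[OF t(1)]]) (use two in simp)
    ultimately show ?thesis by blast
  qed
  show ?thesis
  proof (rule narrow_ordering[OF _ dist])
    show "{a, b, c, d} \<subseteq> E" unfolding El by (auto simp: elast_def)
    fix g assume g: "g \<in> E - {a, b, c, d}"
    then have ng: "g \<in> E" "g \<notin> elast E r" using El by auto
    then obtain P Q where t: "any_triple E r P g Q" unfolding elast_def by blast
    then obtain P Q where t: "any_triple E r P g Q" and PA: "a \<in> P" "b \<in> P"
      using split[OF t ng(2)] any_triple_sym by metis
    have "P \<inter> elast E r = {a, b}"
    proof (rule card_seteq[symmetric])
      show "finite (P \<inter> elast E r)" using fE by auto
      show "{a, b} \<subseteq> P \<inter> elast E r" using PA sub by auto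
      show "card (P \<inter> elast E r) \<le> card {a, b}" using two[OF t] ab by simp
    qed
    then have "c \<notin> P" "d \<notin> P" using dist El by auto
    moreover have "g \<notin> P" "P \<subseteq> E" "lam P = 2" "lam (insert g P) = 2"
      using t vtripleD(1,4,18,20)[of P g Q] vtriple_dualD(1,4,18,20)[of P g Q] by auto
    ultimately show "\<exists>P \<subseteq> E. {a, b} \<subseteq> P \<and> P \<inter> {c, d, g} = {} \<and> lam P \<le> 2 \<and> lam (insert g P) \<le> 2"
      using PA by (intro exI[of _ P]) auto
  qed
qed

theorem narrow_of_nonelastic:
  assumes c4: "card (elast E r) \<le> 4" and g: "g \<in> E" "g \<notin> elast E r"
  shows "\<exists>es. distinct es \<and> set es = E \<and> narrow es"
proof -
  interpret D: fan_theta_free E rd by (rule dual_fan_theta_free)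
  obtain P Q where t: "any_triple E r P g Q" using g unfolding elast_def by blast
  obtain A h B where A: "any_triple E r A h B" "minimal_side E r A" by (rule ex_minimal_triple[OF t])
  show ?thesis
  proof (cases "vtriple E r A h B")
    case True
    then show ?thesis using narrow_of_minimal[OF c4 True A(2)] by simp
  next
    case False
    then have "vtriple E rd A h B" using A by simp
    then obtain es where es: "distinct es" "set es = E" "D.narrow es"
      using D.narrow_of_minimal[of A h B] c4 A(2) unfolding elast_dual minimal_side_dual by auto
    have "narrow es" unfolding narrow_def
    proof
      fix i
      have "set (take i es) \<subseteq> E" using es(2) set_take_subset by force
      then show "lam (set (take i es)) \<le> 2" using es(3) dual_lam unfolding D.narrow_def by metis
    qed
    then show ?thesis using es by blast
  qed
qed

end

section \<open>From matroids to rank functions\<close>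

abbreviation irk :: "'a matroid \<Rightarrow> 'a set \<Rightarrow> int" where
  "irk M X \<equiv> int (rk M X)"

context matroid
begin

lemma finite_indep: "I \<in> indep_sets M \<Longrightarrow> finite I"
  using indep_subset_ground finite_ground finite_subset by metis

lemma finite_indep_sets: "finite {I \<in> indep_sets M. I \<subseteq> X}"
proof (rule finite_subset)
  show "{I \<in> indep_sets M. I \<subseteq> X} \<subseteq> Pow (ground M)" using indep_subset_ground by auto
qed (simp add: finite_ground)

lemma card_le_rk: "I \<in> indep_sets M \<Longrightarrow> I \<subseteq> X \<Longrightarrow> card I \<le> rk M X"
  unfolding rk_def by (rule Max_ge) (use finite_indep_sets in auto)

lemma rk_witness: "\<exists>I \<in> indep_sets M. I \<subseteq> X \<and> card I = rk M X"
proof -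
  have "Max (card ` {I \<in> indep_sets M. I \<subseteq> X}) \<in> card ` {I \<in> indep_sets M. I \<subseteq> X}"
    by (rule Max_in) (use finite_indep_sets indep_empty in auto)
  then show ?thesis unfolding rk_def by auto
qed

lemma extend_indep:
  assumes "I \<in> indep_sets M" "I \<subseteq> X"
  shows "\<exists>J \<in> indep_sets M. I \<subseteq> J \<and> J \<subseteq> X \<and> card J = rk M X"
proof -
  define S where "S J \<longleftrightarrow> J \<in> indep_sets M \<and> I \<subseteq> J \<and> J \<subseteq> X" for J
  have "S I" using assms by (simp add: S_def)
  moreover have "\<forall>J. S J \<longrightarrow> card J < Suc (rk M X)" using card_le_rk by (auto simp: S_def less_Suc_eq_le)
  ultimately have "\<exists>J. S J \<and> (\<forall>J'. S J' \<longrightarrow> card J' \<le> card J)" by (rule ex_has_greatest_nat)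
  then obtain J where J: "S J" "\<And>J'. S J' \<Longrightarrow> card J' \<le> card J" by blast
  obtain K where K: "K \<in> indep_sets M" "K \<subseteq> X" "card K = rk M X" using rk_witness by blast
  have "\<not> card J < card K"
  proof
    assume "card J < card K"
    then obtain x where x: "x \<in> K - J" "insert x J \<in> indep_sets M"
      using indep_augment[of J K] J(1) K(1) unfolding S_def by blast
    then have "S (insert x J)" using J(1) K(2) by (auto simp: S_def)
    moreover have "card (insert x J) = Suc (card J)" using x(1) finite_indep J(1) by (auto simp: S_def)
    ultimately show False using J(2) by force
  qed
  then show ?thesis using J(1) K(3) card_le_rk[of J X] unfolding S_def by auto
qed

lemma rank_function_rk: "rank_function (ground M) (irk M)"
proof
  show "finite (ground M)" by (rule finite_ground)
  fix X Y :: "'a set" and x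
  have "{I \<in> indep_sets M. I \<subseteq> X \<inter> ground M} = {I \<in> indep_sets M. I \<subseteq> X}"
    using indep_subset_ground by auto
  then show "irk M (X \<inter> ground M) = irk M X" by (simp add: rk_def)
  obtain I where "I \<in> indep_sets M" "I \<subseteq> {}" "card I = rk M {}" using rk_witness by blast
  then show "irk M {} = 0" by simp
  show "irk M X \<le> irk M Y" if "X \<subseteq> Y"
  proof -
    obtain I where "I \<in> indep_sets M" "I \<subseteq> X" "card I = rk M X" using rk_witness by blast
    then show ?thesis using card_le_rk[of I Y] that by auto
  qed
  show "irk M (insert x X) \<le> irk M X + 1"
  proof -
    obtain I where I: "I \<in> indep_sets M" "I \<subseteq> insert x X" "card I = rk M (insert x X)" using rk_witness by blast
    have "I - {x} \<in> indep_sets M" using indep_hereditary[OF I(1)] by auto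
    then have "card (I - {x}) \<le> rk M X" using card_le_rk[of "I - {x}" X] I(2) by auto
    moreover have "card I \<le> card (I - {x}) + 1" by (metis Suc_eq_plus1 card_Suc_Diff1 card_Diff_singleton_if finite_indep[OF I(1)] le_SucI order_refl)
    ultimately show ?thesis using I(3) by simp
  qed
  obtain I where I: "I \<in> indep_sets M" "I \<subseteq> X \<inter> Y" "card I = rk M (X \<inter> Y)" using rk_witness by blast
  \<comment> \<open>Submodularity: \<open>J\<close> extends a maximal independent subset
    \<open>I\<close> of the intersection, and its traces on \<open>X\<close> and on \<open>Y\<close>
    both contain \<open>I\<close>.\<close>
  obtain J where J: "J \<in> indep_sets M" "I \<subseteq> J" "J \<subseteq> X \<union> Y" "card J = rk M (X \<union> Y)"
    using extend_indep[OF I(1), of "X \<union> Y"] I(2) by blast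
  have sub: "J \<inter> X \<in> indep_sets M" "J \<inter> Y \<in> indep_sets M" using indep_hereditary[OF J(1)] by auto
  have fJ: "finite J" by (rule finite_indep[OF J(1)])
  have "card (J \<inter> X) + card (J \<inter> Y) = card ((J \<inter> X) \<union> (J \<inter> Y)) + card ((J \<inter> X) \<inter> (J \<inter> Y))"
    by (rule card_Un_Int) (use fJ in auto)
  moreover have "(J \<inter> X) \<union> (J \<inter> Y) = J" using J(3) by auto
  moreover have "card I \<le> card ((J \<inter> X) \<inter> (J \<inter> Y))" by (rule card_mono) (use fJ J(2) I(2) in auto)
  ultimately have "card J + card I \<le> card (J \<inter> X) + card (J \<inter> Y)" by simp
  moreover have "card (J \<inter> X) \<le> rk M X" "card (J \<inter> Y) \<le> rk M Y" using card_le_rk sub by auto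
  ultimately show "irk M (X \<union> Y) + irk M (X \<inter> Y) \<le> irk M X + irk M Y" using I(3) J(4) by simp
qed

lemma indep_iff: "I \<in> indep_sets M \<longleftrightarrow> I \<subseteq> ground M \<and> irk M I = int (card I)"
proof
  assume I: "I \<in> indep_sets M"
  obtain J where J: "J \<in> indep_sets M" "J \<subseteq> I" "card J = rk M I" using rk_witness by blast
  have "card J \<le> card I" by (rule card_mono[OF finite_indep[OF I] J(2)])
  then show "I \<subseteq> ground M \<and> irk M I = int (card I)"
    using card_le_rk[OF I, of I] indep_subset_ground[OF I] J(3) by simp
next
  assume I: "I \<subseteq> ground M \<and> irk M I = int (card I)"
  obtain J where J: "J \<in> indep_sets M" "J \<subseteq> I" "card J = rk M I" using rk_witness by blast
  have "J = I" by (rule card_seteq) (use I J finite_ground finite_subset in auto)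
  then show "I \<in> indep_sets M" using J(1) by simp
qed

lemma basis_iff: "basis M B \<longleftrightarrow> B \<in> indep_sets M \<and> card B = rk M (ground M)"
proof
  assume B: "basis M B"
  then have Bi: "B \<in> indep_sets M" by (simp add: basis_def)
  obtain J where "J \<in> indep_sets M" "B \<subseteq> J" "card J = rk M (ground M)"
    using extend_indep[OF Bi indep_subset_ground[OF Bi]] by blast
  then show "B \<in> indep_sets M \<and> card B = rk M (ground M)" using B Bi by (auto simp: basis_def)
next
  assume B: "B \<in> indep_sets M \<and> card B = rk M (ground M)"
  have "I = B" if "I \<in> indep_sets M" "B \<subseteq> I" for I
    by (rule card_seteq[symmetric, OF finite_indep[OF that(1)] that(2)])
       (use card_le_rk[OF that(1) indep_subset_ground[OF that(1)]] B in simp)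
  then show "basis M B" using B by (auto simp: basis_def)
qed

end

text \<open>Turns \<open>drk\<close> back into a matroid, so that the rank function and the double
  dual of \<open>dual_matroid M\<close> can be read off.\<close>

definition matroid_of_rank :: "'a set \<Rightarrow> ('a set \<Rightarrow> int) \<Rightarrow> 'a matroid" where
  "matroid_of_rank E r = \<lparr>ground = E, indep_sets = {I. I \<subseteq> E \<and> r I = int (card I)}\<rparr>"

lemma ground_matroid_of_rank [simp]: "ground (matroid_of_rank E r) = E"
  by (simp add: matroid_of_rank_def)

lemma matroid_eqI: "ground M = ground N \<Longrightarrow> indep_sets M = indep_sets N \<Longrightarrow> M = (N :: 'a matroid)"
  by simp

lemma (in matroid) matroid_of_rank_rk: "matroid_of_rank (ground M) (irk M) = M"
  by (rule matroid_eqI) (auto simp: matroid_of_rank_def indep_iff)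

context rank_function
begin

lemma r_Un_le: "finite S \<Longrightarrow> r (X \<union> S) \<le> r X + int (card S)"
proof (induction S rule: finite_induct)
  case (insert s S)
  then show ?case using r_insert[of s "X \<union> S"] by simp
qed simp

lemma matroid_matroid_of_rank: "matroid (matroid_of_rank E r)"
proof
  let ?M = "matroid_of_rank E r"
  show "finite (ground ?M)" by (simp add: fin)
  show "I \<in> indep_sets ?M \<Longrightarrow> I \<subseteq> ground ?M" for I by (simp add: matroid_of_rank_def)
  show "{} \<in> indep_sets ?M" by (simp add: matroid_of_rank_def r_empty)
  show "I \<in> indep_sets ?M" if J: "J \<in> indep_sets ?M" "I \<subseteq> J" for I J
  proof -
    have JE: "J \<subseteq> E" "r J = int (card J)" "finite J" using J(1) fin finite_subset by (auto simp: matroid_of_rank_def)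
    have fI: "finite I" using J(2) JE(3) finite_subset by auto
    have "I \<union> (J - I) = J" using J(2) by auto
    then have "r J \<le> r I + int (card (J - I))" using r_Un_le[of "J - I" I] JE(3) by simp
    moreover have "card J = card I + card (J - I)" using J(2) JE(3)
      by (metis card_Diff_subset card_mono fI le_add_diff_inverse)
    ultimately show ?thesis using r_le_card[OF fI] JE J(2) by (auto simp: matroid_of_rank_def)
  qed
  show "\<exists>x \<in> J - I. insert x I \<in> indep_sets ?M"
    if IJ: "I \<in> indep_sets ?M" "J \<in> indep_sets ?M" "card I < card J" for I J
  proof (rule ccontr)
    assume a: "\<not> ?thesis"
    have I: "I \<subseteq> E" "r I = int (card I)" "finite I" and J: "J \<subseteq> E" "r J = int (card J)" "finite J"
      using IJ(1,2) fin finite_subset by (auto simp: matroid_of_rank_def)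
    have "r (insert x I) = r I" if "x \<in> J" for x
    proof (cases "x \<in> I")
      case False
      then have "r (insert x I) \<noteq> int (card (insert x I))" using a that I J by (auto simp: matroid_of_rank_def)
      then show ?thesis using not_span_insert[of x I] I False by auto
    qed (simp add: insert_absorb)
    then have "r (I \<union> J) = r I" using span_Un[OF J(3)] by blast
    then have "r J \<le> r I" using r_mono[of J "I \<union> J"] by simp
    then show False using I J IJ(3) by simp
  qed
qed

lemma irk_matroid_of_rank: "irk (matroid_of_rank E r) = r"
proof
  let ?M = "matroid_of_rank E r"
  interpret M: matroid ?M by (rule matroid_matroid_of_rank)
  fix X
  obtain I where I: "I \<in> indep_sets ?M" "I \<subseteq> X" "card I = rk ?M X" using M.rk_witness by blast
  have IE: "I \<subseteq> E" "r I = int (card I)" "finite I"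
    using I(1) fin finite_subset by (auto simp: matroid_of_rank_def)
  have "r (insert x I) = r I" if x: "x \<in> X \<inter> E" for x
  proof (cases "x \<in> I")
    case False
    have "insert x I \<notin> indep_sets ?M"
    proof
      assume "insert x I \<in> indep_sets ?M"
      then have "card (insert x I) \<le> rk ?M X" using M.card_le_rk I(2) x by auto
      then show False using I(3) False IE(3) by simp
    qed
    then have "r (insert x I) \<noteq> int (card (insert x I))" using x IE by (auto simp: matroid_of_rank_def)
    then show ?thesis using not_span_insert[of x I] IE False by auto
  qed (simp add: insert_absorb)
  then have "r (I \<union> (X \<inter> E)) = r I" by (intro span_Un) (use fin in auto)
  moreover have "I \<union> (X \<inter> E) = X \<inter> E" using I(2) IE(1) by auto
  ultimately show "irk ?M X = r X" using I(3) IE(2) r_Int[of X] by simp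
qed

end

context matroid
begin

text \<open>Some basis avoids \<open>I\<close> exactly when \<open>ground M - I\<close> still has
  full rank, and this is the equation between \<open>drk\<close> of \<open>I\<close> and
  \<open>card I\<close>.\<close>

lemma dual_eq: "dual_matroid M = matroid_of_rank (ground M) (drk (ground M) (irk M))"
proof (rule matroid_eqI)
  interpret R: rank_function "ground M" "irk M" by (rule rank_function_rk)
  show "ground (dual_matroid M) = ground (matroid_of_rank (ground M) (drk (ground M) (irk M)))"
    by (simp add: dual_matroid_def)
  have "(\<exists>B. basis M B \<and> I \<inter> B = {}) \<longleftrightarrow> drk (ground M) (irk M) I = int (card I)" if I: "I \<subseteq> ground M" for I
  proof -
    have d: "drk (ground M) (irk M) I = int (card I) \<longleftrightarrow> rk M (ground M - I) = rk M (ground M)"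
      using I by (auto simp: drk_def Int_absorb2)
    have "(\<exists>B. basis M B \<and> I \<inter> B = {}) \<longleftrightarrow> rk M (ground M - I) = rk M (ground M)"
    proof
      assume "\<exists>B. basis M B \<and> I \<inter> B = {}"
      then obtain B where B: "B \<in> indep_sets M" "card B = rk M (ground M)" "I \<inter> B = {}" by (auto simp: basis_iff)
      then have "card B \<le> rk M (ground M - I)"
        using card_le_rk[OF B(1), of "ground M - I"] indep_subset_ground[OF B(1)] by auto
      then show "rk M (ground M - I) = rk M (ground M)"
        using R.r_mono[of "ground M - I" "ground M"] B(2) by auto
    next
      assume a: "rk M (ground M - I) = rk M (ground M)"
      obtain B where "B \<in> indep_sets M" "B \<subseteq> ground M - I" "card B = rk M (ground M - I)" using rk_witness by blast
      then show "\<exists>B. basis M B \<and> I \<inter> B = {}" using a by (auto simp: basis_iff)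
    qed
    then show ?thesis using d by simp
  qed
  then show "indep_sets (dual_matroid M) = indep_sets (matroid_of_rank (ground M) (drk (ground M) (irk M)))"
    by (auto simp: dual_matroid_def matroid_of_rank_def)
qed

lemma ground_dual: "ground (dual_matroid M) = ground M"
  by (simp add: dual_matroid_def)

lemma irk_dual: "irk (dual_matroid M) = drk (ground M) (irk M)"
  unfolding dual_eq
  by (rule rank_function.irk_matroid_of_rank[OF rank_function.dual_rank_function[OF rank_function_rk]])

lemma irk_dual_apply: "irk (dual_matroid M) X = drk (ground M) (irk M) X"
  using fun_cong[OF irk_dual] .

lemma matroid_dual: "matroid (dual_matroid M)"
  unfolding dual_eq
  by (rule rank_function.matroid_matroid_of_rank[OF rank_function.dual_rank_function[OF rank_function_rk]])

lemma dual_dual: "dual_matroid (dual_matroid M) = M"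
proof -
  interpret D: matroid "dual_matroid M" by (rule matroid_dual)
  show ?thesis
    unfolding D.dual_eq irk_dual ground_dual rank_function.rd_rd[OF rank_function_rk] by (rule matroid_of_rank_rk)
qed

lemma matroid_restrict: "matroid (restrict_matroid M X)"
proof
  show "finite (ground (restrict_matroid M X))" using finite_ground by (simp add: restrict_matroid_def)
  show "{} \<in> indep_sets (restrict_matroid M X)" using indep_empty by (simp add: restrict_matroid_def)
  show "I \<in> indep_sets (restrict_matroid M X) \<Longrightarrow> I \<subseteq> ground (restrict_matroid M X)" for I
    using indep_subset_ground by (auto simp: restrict_matroid_def)
  show "J \<in> indep_sets (restrict_matroid M X) \<Longrightarrow> I \<subseteq> J \<Longrightarrow> I \<in> indep_sets (restrict_matroid M X)" for I J
    using indep_hereditary by (auto simp: restrict_matroid_def)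
  show "\<exists>x \<in> J - I. insert x I \<in> indep_sets (restrict_matroid M X)"
    if "I \<in> indep_sets (restrict_matroid M X)" "J \<in> indep_sets (restrict_matroid M X)" "card I < card J" for I J
    using indep_augment[of I J] that by (auto simp: restrict_matroid_def)
qed

lemma irk_restrict: "irk (restrict_matroid M X) Y = irk M (X \<inter> Y)"
proof -
  have "{I \<in> indep_sets (restrict_matroid M X). I \<subseteq> Y} = {I \<in> indep_sets M. I \<subseteq> X \<inter> Y}"
    by (auto simp: restrict_matroid_def)
  then show ?thesis by (simp add: rk_def)
qed

lemma connectivity_eq: "connectivity M X = rank_function.lam (ground M) (irk M) X"
  unfolding connectivity_def rank_function.lam_def[OF rank_function_rk] by simp

lemma n_connected_dual: "n_connected k (dual_matroid M) \<longleftrightarrow> n_connected k M"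
proof -
  interpret D: matroid "dual_matroid M" by (rule matroid_dual)
  have "connectivity (dual_matroid M) X = connectivity M X" if "X \<subseteq> ground M" for X
    unfolding D.connectivity_eq connectivity_eq unfolding ground_dual irk_dual
    by (rule rank_function.dual_lam[OF rank_function_rk that])
  then have "separation j (dual_matroid M) X Y \<longleftrightarrow> separation j M X Y" for j X Y
    by (auto simp: separation_def separating_def ground_dual)
  then show ?thesis by (simp add: n_connected_def)
qed

lemma tri_connected_irk:
  assumes "three_connected M" "4 \<le> card (ground M)"
  shows "tri_connected (ground M) (irk M)"
proof -
  interpret R: rank_function "ground M" "irk M" by (rule rank_function_rk)
  show ?thesis
  proof
    show "4 \<le> card (ground M)" by fact
    fix X assume X: "X \<subseteq> ground M"
    have fX: "finite X" "finite (ground M - X)" using X finite_ground finite_subset by auto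
    have *: "int j \<le> connectivity M X" if "1 \<le> j" "j < 3" "j \<le> card X" "j \<le> card (ground M - X)" for j
    proof (rule ccontr)
      assume "\<not> ?thesis"
      then have "separation j M X (ground M - X)" using X that by (auto simp: separation_def separating_def)
      then show False using assms(1) that unfolding n_connected_def by blast
    qed
    show "irk M (ground M) + 1 \<le> irk M X + irk M (ground M - X)" if "X \<noteq> {}" "X \<noteq> ground M"
    proof -
      have "1 \<le> card X" "1 \<le> card (ground M - X)" using that X fX by (auto simp: Suc_le_eq card_gt_0_iff)
      then show ?thesis using *[of 1] by (simp add: connectivity_def)
    qed
    show "irk M (ground M) + 2 \<le> irk M X + irk M (ground M - X)" if "2 \<le> card X" "2 \<le> card (ground M - X)"
      using *[of 2] that by (simp add: connectivity_def)
  qed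
qed

lemma ground_contract: "ground (contract_matroid M {e}) = ground M - {e}"
  by (auto simp: contract_matroid_def dual_matroid_def delete_matroid_def restrict_matroid_def)

lemma matroid_contract: "matroid (contract_matroid M {e})"
  unfolding contract_matroid_def delete_matroid_def
  by (intro matroid.matroid_dual matroid.matroid_restrict matroid_dual)

text \<open>Contraction is deletion in the dual, so \<open>drk\<close> is applied twice and the
  cardinalities cancel.\<close>

lemma irk_contract:
  assumes "e \<in> ground M" "X \<subseteq> ground M - {e}"
  shows "irk (contract_matroid M {e}) X = irk M (insert e X) - irk M {e}"
proof -
  interpret R: rank_function "ground M" "irk M" by (rule rank_function_rk)
  interpret D: matroid "dual_matroid M" by (rule matroid_dual)
  define N where "N = restrict_matroid (dual_matroid M) (ground M - {e})"
  have gN: "ground N = ground M - {e}" by (auto simp: N_def restrict_matroid_def ground_dual)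
  interpret N: matroid N unfolding N_def by (rule D.matroid_restrict)
  have rN: "irk N Y = drk (ground M) (irk M) Y" if "Y \<subseteq> ground M - {e}" for Y
  proof -
    have "(ground M - {e}) \<inter> Y = Y" using that by auto
    then show ?thesis unfolding N_def D.irk_restrict by (simp add: irk_dual_apply)
  qed
  have c: "contract_matroid M {e} = dual_matroid N"
    by (simp add: contract_matroid_def delete_matroid_def N_def ground_dual)
  have f: "finite X" "finite (ground M - {e} - X)" using assms finite_ground finite_subset by auto
  have e1: "ground M - (ground M - {e} - X) = insert e X" using assms by auto
  have e2: "ground M - (ground M - {e}) = {e}" using assms by auto
  have i: "X \<inter> (ground M - {e}) = X" "(ground M - {e} - X) \<inter> ground M = ground M - {e} - X"
    "(ground M - {e}) \<inter> ground M = ground M - {e}" using assms by auto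
  have cd: "card (ground M - {e}) = card X + card (ground M - {e} - X)"
    using assms f by (metis card_Diff_subset card_mono finite_Diff finite_ground le_add_diff_inverse)
  have "irk (contract_matroid M {e}) X = int (card X) + irk N (ground M - {e} - X) - irk N (ground M - {e})"
    unfolding c N.irk_dual_apply gN by (simp add: drk_def i)
  also have "\<dots> = irk M (insert e X) - irk M {e}"
    by (subst (1 2) rN) (auto simp: drk_def e1 e2 i cd)
  finally show ?thesis .
qed

lemma parallel_rel_eq:
  assumes nl: "\<And>x. x \<in> ground M \<Longrightarrow> irk M {x} = 1"
  shows "parallel_rel M = {(x, y). x \<in> ground M \<and> y \<in> ground M \<and> irk M {x, y} = 1}"
    and "x \<in> ground M \<Longrightarrow> \<not> loop M x"
proof -
  interpret R: rank_function "ground M" "irk M" by (rule rank_function_rk)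
  have s: "{x} \<in> indep_sets M" if "x \<in> ground M" for x using that nl by (simp add: indep_iff)
  then show nloop: "\<not> loop M x" if "x \<in> ground M" for x using that by (auto simp: loop_def circuit_def)
  have "circuit M {x, y} \<longleftrightarrow> irk M {x, y} = 1" if xy: "x \<in> ground M" "y \<in> ground M" "x \<noteq> y" for x y
  proof -
    have "irk M {x, y} \<le> 2" using R.r_insert[of x "{y}"] nl[OF xy(2)] by simp
    moreover have "1 \<le> irk M {x, y}" using R.r_le_insert[of "{y}" x] nl[OF xy(2)] by simp
    ultimately have "{x, y} \<notin> indep_sets M \<longleftrightarrow> irk M {x, y} = 1" using xy by (auto simp: indep_iff)
    moreover have "D \<in> indep_sets M" if "D \<subset> {x, y}" for D
    proof -
      have "D = {} \<or> D = {x} \<or> D = {y}" using that by auto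
      then show ?thesis using s xy indep_empty by auto
    qed
    ultimately show ?thesis using xy by (auto simp: circuit_def)
  qed
  then show "parallel_rel M = {(x, y). x \<in> ground M \<and> y \<in> ground M \<and> irk M {x, y} = 1}"
    using nloop nl unfolding parallel_rel_def by fastforce
qed

text \<open>Hides the choice made by \<open>SOME\<close>: what remains is a transversal
  \<open>T\<close> of the parallel classes, with parallelism expressed as rank 1 of a pair.\<close>

lemma simplification_representatives:
  assumes nl: "\<And>x. x \<in> ground M \<Longrightarrow> irk M {x} = 1"
  obtains T where "simplification M = restrict_matroid M T" "T \<subseteq> ground M"
    "\<And>x. x \<in> ground M \<Longrightarrow> \<exists>t \<in> T. irk M {x, t} = 1"
    "\<And>t t'. t \<in> T \<Longrightarrow> t' \<in> T \<Longrightarrow> irk M {t, t'} = 1 \<Longrightarrow> t = t'"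
proof -
  interpret R: rank_function "ground M" "irk M" by (rule rank_function_rk)
  define E where "E = ground M"
  define p where "p = parallel_rel M"
  note pr = parallel_rel_eq[OF nl]
  have p: "(x, y) \<in> p \<longleftrightarrow> x \<in> E \<and> y \<in> E \<and> irk M {x, y} = 1" for x y
    by (auto simp: p_def pr(1) E_def)
  have eq: "equiv E p"
  proof (rule equivI)
    show "p \<subseteq> E \<times> E" using p by auto
    show "refl_on E p" using p nl by (auto simp: refl_on_def E_def)
    show "sym p" using p by (auto simp: sym_def insert_commute)
    show "trans p"
    proof (rule transI)
      fix x y z assume a: "(x, y) \<in> p" "(y, z) \<in> p"
      then have m: "x \<in> E" "y \<in> E" "z \<in> E" "irk M {x, y} = 1" "irk M {y, z} = 1" using p by auto
      have "irk M ({x, y} \<union> {y, z}) + irk M ({x, y} \<inter> {y, z}) \<le> 2" using R.r_sub[of "{x,y}" "{y,z}"] m by simp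
      moreover have "irk M {y} \<le> irk M ({x, y} \<inter> {y, z})" by (rule R.r_mono) auto
      moreover have "irk M {x, z} \<le> irk M ({x, y} \<union> {y, z})" by (rule R.r_mono) auto
      moreover have "irk M {x} \<le> irk M {x, z}" by (rule R.r_mono) auto
      ultimately have "irk M {x, z} = 1" using nl m unfolding E_def by force
      then show "(x, z) \<in> p" using m p by simp
    qed
  qed
  have pc: "parallel_classes M = E // p"
    unfolding parallel_classes_def p_def E_def using pr(2) by (metis (no_types, lifting) Collect_cong Collect_mem_eq)
  define c where "c P = (SOME x. x \<in> P)" for P :: "'a set"
  define T where "T = c ` (E // p)"
  have cP: "c P \<in> P" if "P \<in> E // p" for P
    using in_quotient_imp_non_empty[OF eq that] unfolding c_def by (simp add: some_in_eq)
  have "simplification M = restrict_matroid M T"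
    unfolding simplification_def pc T_def c_def ..
  moreover have "T \<subseteq> ground M" using cP in_quotient_imp_subset[OF eq] unfolding T_def E_def by blast
  moreover have "\<exists>t \<in> T. irk M {x, t} = 1" if "x \<in> ground M" for x
  proof -
    have "p `` {x} \<in> E // p" using that by (simp add: quotientI E_def)
    then have "c (p `` {x}) \<in> T" "(x, c (p `` {x})) \<in> p" using cP by (auto simp: T_def)
    then show ?thesis using p by blast
  qed
  moreover have "t = t'" if t: "t \<in> T" "t' \<in> T" "irk M {t, t'} = 1" for t t'
  proof -
    obtain P P' where P: "P \<in> E // p" "t = c P" "P' \<in> E // p" "t' = c P'" using t unfolding T_def by auto
    have "t \<in> P" "t' \<in> P'" using cP P by auto
    moreover have "t \<in> E" "t' \<in> E" using calculation in_quotient_imp_subset[OF eq] P by auto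
    then have "(t, t') \<in> p" using t(3) p by simp
    ultimately have "P = P'" using quotient_eq_iff[OF eq P(1,3)] by blast
    then show ?thesis using P by simp
  qed
  ultimately show ?thesis using that by blast
qed

text \<open>A separation of the simplification lifts to the contraction with unchanged ranks when
  each element joins the side of its representative. In \<open>M\<close> this reads
  \<open>r (insert e X) + r (insert e Y) \<le> r E + k\<close>; 3-connectedness excludes
  \<open>k = 1\<close> and for \<open>k = 2\<close> forces both sides to span
  \<open>e\<close>.\<close>

lemma contract_not_connected:
  assumes c3: "three_connected M" "4 \<le> card (ground M)" and e: "e \<in> ground M"
    and n: "\<not> three_connected (simplification (contract_matroid M {e}))"
  shows "\<exists>X Y. vtriple (ground M) (irk M) X e Y"
proof -
  define E where "E = ground M"
  define r where "r = irk M"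
  interpret T: tri_connected E r unfolding E_def r_def by (rule tri_connected_irk[OF c3])
  define N where "N = contract_matroid M {e}"
  interpret N: matroid N unfolding N_def by (rule matroid_contract)
  have gN: "ground N = E - {e}" unfolding N_def E_def by (rule ground_contract)
  have eE: "e \<in> E" using e by (simp add: E_def)
  have rN: "irk N X = r (insert e X) - 1" if "X \<subseteq> E - {e}" for X
    using irk_contract[OF e, of X] that T.r_single[OF eE] unfolding N_def E_def r_def by simp
  interpret RN: rank_function "E - {e}" "irk N" using N.rank_function_rk unfolding gN .
  have nl: "irk N {x} = 1" if "x \<in> ground N" for x
    using rN[of "{x}"] that T.r_pair[of e x] eE unfolding gN by auto
  obtain S where S: "simplification N = restrict_matroid N S" "S \<subseteq> ground N"
    "\<And>x. x \<in> ground N \<Longrightarrow> \<exists>t \<in> S. irk N {x, t} = 1"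
    "\<And>t t'. t \<in> S \<Longrightarrow> t' \<in> S \<Longrightarrow> irk N {t, t'} = 1 \<Longrightarrow> t = t'"
    by (rule N.simplification_representatives[OF nl]) auto
  have gS: "ground (restrict_matroid N S) = S" using S(2) by (auto simp: restrict_matroid_def)
  obtain k X' Y' where k: "1 \<le> k" "k < 3" "separation k (restrict_matroid N S) X' Y'"
    using n unfolding N_def[symmetric] S(1) n_connected_def by blast
  have sep: "X' \<union> Y' = S" "X' \<inter> Y' = {}" "k \<le> card X'" "k \<le> card Y'"
    "irk N (S \<inter> X') + irk N (S \<inter> (S - X')) - irk N (S \<inter> S) \<le> int k - 1"
    using k(3) unfolding separation_def separating_def connectivity_def gS N.irk_restrict by auto
  have SE: "S \<subseteq> E - {e}" using S(2) gN by simp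
  define X where "X = {x \<in> E - {e}. \<exists>t \<in> X'. irk N {x, t} = 1}"
  define Y where "Y = E - {e} - X"
  have sub: "X' \<subseteq> S" "Y' \<subseteq> S" using sep(1) by auto
  have X'X: "X' \<subseteq> X"
  proof
    fix x assume x: "x \<in> X'"
    then have "x \<in> E - {e}" using sub SE by auto
    moreover from this have "irk N {x, x} = 1" using nl[of x] gN by simp
    ultimately show "x \<in> X" using x unfolding X_def by blast
  qed
  have Y't: "\<exists>t \<in> Y'. irk N {y, t} = 1" if "y \<in> Y" for y
    using S(3)[of y] that sep(1) unfolding Y_def X_def gN by blast
  have Y'Y: "Y' \<subseteq> Y"
  proof
    fix y assume y: "y \<in> Y'"
    have "y \<notin> X"
    proof
      assume "y \<in> X"
      then obtain t where "t \<in> X'" "irk N {y, t} = 1" by (auto simp: X_def)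
      then show False using S(4)[of y t] sub y sep(2) by blast
    qed
    then show "y \<in> Y" using y sub SE by (auto simp: Y_def)
  qed
  have par: "irk N (insert x Z) = irk N Z" if "t \<in> Z" "irk N {x, t} = 1" "Z \<subseteq> E - {e}" for x t Z
  proof -
    have "irk N (insert x {t}) = irk N {t}" using that nl[of t] gN by auto
    then show ?thesis by (rule RN.span_mono) (use that in auto)
  qed
  have fE: "finite E" by (rule T.fin)
  have "irk N (X' \<union> X) = irk N X'"
    by (rule RN.span_Un) (use par sub SE fE in \<open>auto simp: X_def\<close>)
  then have rX: "irk N X = irk N X'" using X'X by (simp add: Un_absorb1)
  have "irk N (Y' \<union> Y) = irk N Y'"
  proof (rule RN.span_Un)
    show "finite Y" using fE by (simp add: Y_def)
    show "irk N (insert y Y') = irk N Y'" if "y \<in> Y" for y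
      using Y't[OF that] par[of _ Y' y] sub SE by blast
  qed
  then have rY: "irk N Y = irk N Y'" using Y'Y by (simp add: Un_absorb1)
  have "irk N (S \<union> (E - {e})) = irk N S"
    by (rule RN.span_Un) (use S(3) par SE fE gN in auto)
  then have rS: "irk N (E - {e}) = irk N S" using SE by (simp add: Un_absorb1)
  have XE: "X \<subseteq> E - {e}" "Y \<subseteq> E - {e}" "X \<inter> Y = {}" "insert e (X \<union> Y) = E" using eE by (auto simp: X_def Y_def)
  have "S \<inter> X' = X'" "S \<inter> (S - X') = Y'" using sep(1,2) by auto
  then have "irk N X + irk N Y - irk N (E - {e}) \<le> int k - 1" using sep(5) rX rY rS by simp
  moreover have "insert e (E - {e}) = E" using eE by auto
  ultimately have main: "r (insert e X) + r (insert e Y) \<le> r E + int k"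
    using rN[OF XE(1)] rN[OF XE(2)] rN[of "E - {e}"] by simp
  have fXY: "finite X" "finite Y" using XE fE finite_subset by (metis finite_Diff)+
  have cXY: "k \<le> card X" "k \<le> card Y"
    using card_mono[OF fXY(1) X'X] card_mono[OF fXY(2) Y'Y] sep(3,4) by auto
  have eXY: "e \<notin> X" "e \<notin> Y" "X \<subseteq> E" "Y \<subseteq> E" using XE by auto
  have comp: "E - X = insert e Y" "E - Y = insert e X" using XE eE by auto
  have big: "r E + 2 \<le> r X + r (insert e Y)" if "2 \<le> card X" "1 \<le> card Y"
    using T.conn2[OF eXY(3) that(1)] that(2) fXY eXY unfolding comp by simp
  have big': "r E + 2 \<le> r Y + r (insert e X)" if "2 \<le> card Y" "1 \<le> card X"
    using T.conn2[OF eXY(4) that(1)] that(2) fXY eXY unfolding comp by simp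
  have "k \<noteq> 1"
  proof
    assume k1: "k = 1"
    have "card E = Suc (card (X \<union> Y))" using XE fXY eXY by (metis UnE card_insert_disjoint finite_UnI)
    also have "card (X \<union> Y) = card X + card Y" using XE(3) fXY by (simp add: card_Un_disjoint)
    finally have "2 \<le> card X \<or> 2 \<le> card Y" using T.card4 by auto
    then show False using big big' main cXY k1 T.r_le_insert[of X e] T.r_le_insert[of Y e] by auto
  qed
  then have k2: "k = 2" using k by simp
  \<comment> \<open>Two non-parallel representatives give each side rank at least 2 in the
    contraction, hence rank at least 3 together with \<open>e\<close> in \<open>M\<close>.\<close>
  have rank2: "2 \<le> irk N Z" if Z: "2 \<le> card Z" "Z \<subseteq> S" for Z
  proof -
    obtain t t' where t: "t \<in> Z" "t' \<in> Z" "t \<noteq> t'" by (rule T.card_ge2E[OF Z(1)])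
    have "irk N {t, t'} \<noteq> 1" using S(4) t Z by blast
    moreover have "1 \<le> irk N {t, t'}" using RN.r_le_insert[of "{t'}" t] nl[of t'] t Z S(2) by auto
    moreover have "irk N {t, t'} \<le> irk N Z" by (rule RN.r_mono) (use t in auto)
    ultimately show ?thesis by simp
  qed
  have 3: "3 \<le> r (insert e X)" "3 \<le> r (insert e Y)"
    using rank2[of X'] rank2[of Y'] sep(3,4) k2 sub rX rY rN[OF XE(1)] rN[OF XE(2)] by auto
  have b: "r E + 2 \<le> r X + r (insert e Y)" "r E + 2 \<le> r Y + r (insert e X)"
    using big big' cXY k2 by auto
  have "r (insert e X) = r X" "r (insert e Y) = r Y" "r X + r Y = r E + 2"
    using b main k2 T.r_le_insert[of X e] T.r_le_insert[of Y e] by auto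
  then have "vtriple E r X e Y" unfolding vtriple_def using XE eXY 3 by auto
  then show ?thesis unfolding E_def r_def by blast
qed

text \<open>The half about deletion is the half about contraction in the dual: contracting
  \<open>e\<close> there is dual to deleting \<open>e\<close> from \<open>M\<close>, and
  cosimplification is the dual of simplification.\<close>

lemma elast_subset_elastic:
  assumes c3: "three_connected M" "4 \<le> card (ground M)"
  shows "elast (ground M) (irk M) \<subseteq> {e. elastic M e}"
proof
  fix e assume e: "e \<in> elast (ground M) (irk M)"
  interpret D: matroid "dual_matroid M" by (rule matroid_dual)
  have eE: "e \<in> ground M" using e by (simp add: elast_def)
  have a: "three_connected (simplification (contract_matroid M {e}))"
    using contract_not_connected[OF c3 eE] e by (auto simp: elast_def)
  have "three_connected (dual_matroid M)" "4 \<le> card (ground (dual_matroid M))" "e \<in> ground (dual_matroid M)"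
    using c3 eE by (auto simp: n_connected_dual ground_dual)
  from D.contract_not_connected[OF this]
  have b: "three_connected (simplification (contract_matroid (dual_matroid M) {e}))"
    using e unfolding ground_dual irk_dual by (auto simp: elast_def)
  define N where "N = contract_matroid (dual_matroid M) {e}"
  have "N = dual_matroid (delete_matroid M {e})" unfolding N_def contract_matroid_def dual_dual ..
  then have co: "cosimplification (delete_matroid M {e}) = dual_matroid (simplification N)"
    by (simp add: cosimplification_def)
  have "matroid N" unfolding N_def by (rule D.matroid_contract)
  then have "matroid (simplification N)" unfolding simplification_def by (rule matroid.matroid_restrict)
  then have "three_connected (cosimplification (delete_matroid M {e}))"
    unfolding co using b N_def matroid.n_connected_dual by blast
  then show "e \<in> {e. elastic M e}" using a eE by (simp add: elastic_def)
qed

lemma triangleI: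
  assumes c3: "three_connected M" "4 \<le> card (ground M)" and T: "T \<subseteq> ground M" "card T = 3" "irk M T = 2"
  shows "triangle M T"
proof -
  interpret T: tri_connected "ground M" "irk M" by (rule tri_connected_irk[OF c3])
  have fT: "finite T" using T(2) by (metis card.infinite zero_neq_numeral)
  have "D \<in> indep_sets M" if D: "D \<subset> T" for D
  proof -
    have fD: "finite D" using D fT finite_subset by blast
    have "card D < 3" using psubset_card_mono[OF fT D] T(2) by simp
    then consider "card D = 0" | "card D = 1" | "card D = 2" by linarith
    then have "irk M D = int (card D)"
    proof cases
      case 1
      then show ?thesis using fD T.r_empty by simp
    next
      case 2
      then obtain x where "D = {x}" by (auto simp: card_1_singleton_iff)
      then show ?thesis using T.r_single[of x] D T(1) by auto
    next
      case 3
      then obtain x y where "D = {x, y}" "x \<noteq> y" by (auto simp: card_2_iff)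
      then show ?thesis using T.r_pair[of x y] D T(1) by auto
    qed
    then show ?thesis using D T(1) by (auto simp: indep_iff)
  qed
  moreover have "T \<notin> indep_sets M" using T by (simp add: indep_iff)
  ultimately show ?thesis using T by (simp add: triangle_def circuit_def)
qed

end

section \<open>Recognising theta separators\<close>

text \<open>The three kinds of circuits of \<open>\<Theta>\<close>, with \<open>L\<close> for the
  \<open>z\<close>-points and \<open>z w\<close> for the partner of \<open>w\<close>. Only points of
  \<open>A\<close> have a partner, which accounts for the deleted point of the minus
  variant.\<close>

definition theta_dependent :: "'a set \<Rightarrow> 'a set \<Rightarrow> ('a \<Rightarrow> 'a) \<Rightarrow> 'a set \<Rightarrow> bool" where
  "theta_dependent L A z X \<longleftrightarrow>
     (\<exists>u \<in> A. \<exists>v \<in> A. \<exists>w \<in> A. u \<noteq> v \<and> u \<noteq> w \<and> v \<noteq> w \<and> z u \<in> X \<and> z v \<in> X \<and> z w \<in> X) \<or>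
     (\<exists>w \<in> A. L - {w} \<subseteq> X \<and> z w \<in> X) \<or>
     (\<exists>w \<in> L. \<exists>u \<in> A. \<exists>v \<in> A. w \<noteq> u \<and> w \<noteq> v \<and> u \<noteq> v \<and> L - {w} \<subseteq> X \<and> z u \<in> X \<and> z v \<in> X)"

context rank_function
begin

lemma independent_subset:
  assumes "r X = int (card X)" "finite X" "Y \<subseteq> X"
  shows "r Y = int (card Y)"
proof -
  have f: "finite Y" using assms finite_subset by auto
  have "Y \<union> (X - Y) = X" using assms by auto
  then have "r X \<le> r Y + int (card (X - Y))" using r_Un_le[of "X - Y" Y] assms(2) by simp
  moreover have "card X = card Y + card (X - Y)" using assms
    by (metis card_Diff_subset card_mono f le_add_diff_inverse)
  ultimately show ?thesis using r_le_card[OF f] assms(1) by simp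
qed

end

context tri_connected
begin

text \<open>In the dual, \<open>L\<close> is independent and spans every \<open>z w\<close>, and
  \<open>z w\<close> is spanned by \<open>L - {w}\<close> but not by \<open>L\<close> minus another
  point. While two points of \<open>L\<close> are missing, they span the line in the matroid, so the
  points of \<open>L\<close> present add their full number to the corank. These facts decide every
  subset.\<close>

lemma theta_structure:
  assumes L: "L \<subseteq> E" "r L = 2" "4 \<le> card L" and rE: "4 \<le> r E" and A: "A \<subseteq> L" "card L \<le> card A + 1"
    and z: "\<And>w. w \<in> A \<Longrightarrow> z w \<in> E - L \<and> cocirc E r (insert (z w) (L - {w}))"
  shows "inj_on z A" "rd (z ` A) = 2" "4 \<le> rd E"
    "X \<subseteq> L \<union> z ` A \<Longrightarrow> rd X = int (card X) \<longleftrightarrow> \<not> theta_dependent L A z X"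
proof -
  interpret D: tri_connected E rd by (rule dual_tri_connected)
  have fL: "finite L" and fA: "finite A" using L A fin_sub finite_subset by auto
  have zE: "z ` A \<subseteq> E" "z ` A \<inter> L = {}" using z by auto
  have "r (L \<union> (E - L)) + r (L \<inter> (E - L)) \<le> r L + r (E - L)" by (rule r_sub)
  moreover have "L \<union> (E - L) = E" using L by auto
  ultimately have "2 \<le> r (E - L)" using rE L(2) r_nonneg[of "L \<inter> (E - L)"] by simp
  then have "2 \<le> card (E - L)" using r_le_card[of "E - L"] fin by simp
  then have "2 \<le> lam L" using lam2[OF L(1)] L(3) by simp
  then have rdL: "rd L = int (card L)" using rd_lam[OF L(1)] L(2) D.r_le_card[OF fL] by simp
  then show "4 \<le> rd E" using D.r_mono[OF L(1)] L(3) by simp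
  have rdJ: "rd J = int (card J)" if "J \<subseteq> L" for J by (rule D.independent_subset[OF rdL fL that])
  have rdC: "rd (insert (z w) (L - {w})) = int (card L) - 1" if "w \<in> A" for w
  proof -
    have "card (insert (z w) (L - {w})) = card L" using z[OF that] that A fL
      by (metis Diff_iff card_Suc_Diff1 card_insert_disjoint finite_Diff subsetD)
    then show ?thesis using cocirc_drk z[OF that] by fastforce
  qed
  have sp: "rd (insert (z w) (L - {w})) = rd (L - {w})" if w: "w \<in> A" for w
    using rdC[OF w] rdJ[of "L - {w}"] w A fL L(3) by (simp add: subset_iff of_nat_diff)
  have spL: "rd (insert (z w) L) = rd L" if "w \<in> A" for w
    by (rule D.span_mono[OF sp[OF that]]) auto
  have nsp: "rd (insert (z u) (L - {w})) \<noteq> rd (L - {w})" if u: "u \<in> A" "w \<in> L" "u \<noteq> w" for u w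
  proof -
    \<comment> \<open>\<open>insert u H\<close> is the hyperplane avoiding the cocircuit of
      \<open>u\<close>, and \<open>H\<close> has the same rank. As \<open>w\<close> lies outside
      that hyperplane, \<open>insert w H\<close> has full rank and spans \<open>z u\<close>;
      complementarity gives the claim.\<close>
    define H where "H = E - insert (z u) L"
    have zu: "z u \<in> E" "z u \<notin> L" "cocirc E r (insert (z u) (L - {u}))" using z[OF u(1)] by auto
    have wE: "w \<in> E" "w \<noteq> z u" "u \<in> E" using u L A zu by auto
    have EC: "E - insert (z u) (L - {u}) = insert u H" using u A wE zu unfolding H_def by auto
    have "insert (z u) L \<inter> E = insert (z u) L" using L zu by auto
    then have rH: "r H = r E - 1" using spL[OF u(1)] rdL zu fL unfolding H_def by (simp add: drk_def)
    have h: "r (insert u H) = r E - 1" "r (insert w (insert u H)) = r E"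
      using zu(3) u unfolding cocirc_def EC by auto
    have "r (insert w H) \<noteq> r H"
    proof
      assume "r (insert w H) = r H"
      then have "r (insert w (insert u H)) = r (insert u H)" by (rule span_mono) auto
      then show False using h by simp
    qed
    then have rw: "r (insert w H) = r E" using not_span_insert[of w H] rH by simp
    have B: "E - insert (z u) (L - {w}) = insert w H" using u wE unfolding H_def by auto
    have "insert (z u) (insert w H) \<subseteq> E" using zu wE unfolding H_def by auto
    then have "r (insert (z u) (insert w H)) = r (insert w H)"
      using r_mono[of "insert (z u) (insert w H)" E] r_le_insert[of "insert w H" "z u"] rw by simp
    moreover have "L - {w} \<subseteq> E" "z u \<notin> L - {w}" using L zu by auto
    ultimately show ?thesis using rd_span_iff[of "L - {w}" "z u"] zu unfolding B by auto
  qed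
  show inj: "inj_on z A"
  proof (rule inj_onI, rule ccontr)
    fix u w assume "u \<in> A" "w \<in> A" "z u = z w" "u \<noteq> w"
    then show False using sp[of w] nsp[of u w] A by auto
  qed
  have addL: "rd (K \<union> J) = rd K + int (card J)"
    if J: "J \<subseteq> L" and K: "K \<subseteq> E - L" and vw: "v \<in> L - J" "w \<in> L - J" "v \<noteq> w" for J K v w
  proof -
    have "finite J" using J fL finite_subset by auto
    then show ?thesis using J vw
    proof (induction J rule: finite_induct)
      case (insert u J)
      have "rd (insert u (K \<union> J)) = rd (K \<union> J) + 1"
      proof (rule rd_not_span[OF _ _ _ refl])
        have m: "u \<in> L" "v \<in> E - insert u (K \<union> J)" "w \<in> E - insert u (K \<union> J)"
          using insert.prems insert.hyps K L by auto
        have "insert v (E - insert u (K \<union> J)) = E - insert u (K \<union> J)" "insert w (E - insert u (K \<union> J)) = E - insert u (K \<union> J)"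
          using m by (simp_all only: insert_absorb)
        then show "r (insert u (E - insert u (K \<union> J))) = r (E - insert u (K \<union> J))"
          using line_span[of L v w u "E - insert u (K \<union> J)"] m(1) L insert.prems by simp
        show "K \<union> J \<subseteq> E" "u \<in> E" "u \<notin> K \<union> J" using K insert.prems insert.hyps L by auto
      qed
      then show ?case using insert by simp
    qed simp
  qed
  have spanZ: "rd (L \<union> K) = int (card L)" if "K \<subseteq> z ` A" for K
  proof -
    have "rd (L \<union> K) = rd L"
      by (rule D.span_Un) (use that fA finite_subset spL in auto)
    then show ?thesis using rdL by simp
  qed
  have cZ: "card (z ` A) = card A" by (rule card_image[OF inj])
  obtain u v where uv: "u \<in> L" "v \<in> L" "u \<noteq> v" by (rule card_ge2E[of L]) (use L in auto)
  have ZL: "z ` A \<subseteq> E - L" using zE by auto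
  \<comment> \<open>All but two points of \<open>L\<close> add their full number to the corank of
    the image of \<open>A\<close>, yet the total is at most \<open>card L\<close>; so the image has
    corank at most 2.\<close>
  have "rd (z ` A \<union> (L - {u, v})) = rd (z ` A) + int (card (L - {u, v}))"
    by (rule addL[OF _ ZL, of _ u v]) (use uv in auto)
  moreover have "card (L - {u, v}) = card L - 2" using uv by (simp add: card_Diff_subset)
  moreover have "rd (z ` A \<union> (L - {u, v})) \<le> rd (L \<union> z ` A)" by (rule D.r_mono) auto
  ultimately have "rd (z ` A) \<le> 2" using spanZ[of "z ` A"] L(3) by simp
  moreover have "2 \<le> rd (z ` A)" using D.r_ge2[OF zE(1)] cZ A(2) L(3) by simp
  ultimately show rdZ: "rd (z ` A) = 2" by simp
  have dep: "rd X \<noteq> int (card X)" if X: "X \<subseteq> L \<union> z ` A" and d: "theta_dependent L A z X" for X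
  proof
    assume i: "rd X = int (card X)"
    have fX: "finite X" using X fL fA finite_subset by (metis finite_UnI finite_imageI)
    have sub: "rd Y = int (card Y)" if "Y \<subseteq> X" for Y by (rule D.independent_subset[OF i fX that])
    from d consider (1) u v w where "u \<in> A" "v \<in> A" "w \<in> A" "u \<noteq> v" "u \<noteq> w" "v \<noteq> w" "z u \<in> X" "z v \<in> X" "z w \<in> X"
      | (2) w where "w \<in> A" "L - {w} \<subseteq> X" "z w \<in> X"
      | (3) w u v where "w \<in> L" "u \<in> A" "v \<in> A" "w \<noteq> u" "w \<noteq> v" "u \<noteq> v" "L - {w} \<subseteq> X" "z u \<in> X" "z v \<in> X"
      unfolding theta_dependent_def by blast
    then show False
    proof cases
      case 1
      then have "z u \<noteq> z v" "z u \<noteq> z w" "z v \<noteq> z w" using inj_on_eq_iff[OF inj] by auto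
      then have "card {z u, z v, z w} = 3" by simp
      then have "rd {z u, z v, z w} = 3" using sub[of "{z u, z v, z w}"] 1 by simp
      moreover have "rd {z u, z v, z w} \<le> rd (z ` A)" by (rule D.r_mono) (use 1 in auto)
      ultimately show False using rdZ by simp
    next
      case 2
      have "rd (insert (z w) (L - {w})) = int (card (insert (z w) (L - {w})))" by (rule sub) (use 2 in auto)
      moreover have "card (insert (z w) (L - {w})) = card L" using z[OF 2(1)] 2(1) A fL
        by (metis Diff_iff card_Suc_Diff1 card_insert_disjoint finite_Diff subsetD)
      ultimately show False using rdC[OF 2(1)] by simp
    next
      case 3
      define Y where "Y = insert (z u) (insert (z v) (L - {w}))"
      have "rd Y = int (card Y)" by (rule sub) (use 3 in \<open>auto simp: Y_def\<close>)
      moreover have "z u \<noteq> z v" using 3 inj by (auto simp: inj_on_def)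
      then have "card Y = card (L - {w}) + 2" using z[OF 3(2)] z[OF 3(3)] fL unfolding Y_def by simp
      moreover have "card (L - {w}) = card L - 1" using 3(1) fL by simp
      moreover have "rd Y \<le> rd (L \<union> z ` A)" by (rule D.r_mono) (use 3 in \<open>auto simp: Y_def\<close>)
      ultimately show False using spanZ[of "z ` A"] L(3) by simp
    qed
  qed
  have indep: "rd X = int (card X)" if X: "X \<subseteq> L \<union> z ` A" and d: "\<not> theta_dependent L A z X" for X
  proof -
    define K where "K = X \<inter> z ` A"
    define J where "J = X \<inter> L"
    have XJK: "X = K \<union> J" "K \<inter> J = {}" using X zE unfolding K_def J_def by auto
    have fK: "finite K" "finite J" using fA fL unfolding K_def J_def by auto
    have cX: "card X = card K + card J" unfolding XJK(1) by (rule card_Un_disjoint[OF fK XJK(2)])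
    have KE: "K \<subseteq> E - L" "K \<subseteq> z ` A" "J \<subseteq> L" using ZL unfolding K_def J_def by auto
    have d1: "\<not> (u \<in> A \<and> v \<in> A \<and> w \<in> A \<and> u \<noteq> v \<and> u \<noteq> w \<and> v \<noteq> w \<and> z u \<in> X \<and> z v \<in> X \<and> z w \<in> X)" for u v w
      using d unfolding theta_dependent_def by blast
    have d2: "\<not> (w \<in> A \<and> L - {w} \<subseteq> X \<and> z w \<in> X)" for w
      using d unfolding theta_dependent_def by blast
    have d3: "\<not> (w \<in> L \<and> u \<in> A \<and> v \<in> A \<and> w \<noteq> u \<and> w \<noteq> v \<and> u \<noteq> v \<and> L - {w} \<subseteq> X \<and> z u \<in> X \<and> z v \<in> X)" for u v w
      using d unfolding theta_dependent_def by blast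
    show ?thesis
    proof (cases "\<exists>v \<in> L - J. \<exists>w \<in> L - J. v \<noteq> w")
      case True
      then obtain v w where "v \<in> L - J" "w \<in> L - J" "v \<noteq> w" by auto
      from addL[OF KE(3,1) this] have rX: "rd X = rd K + int (card J)" using XJK(1) by simp
      have "\<not> 3 \<le> card K"
      proof
        assume "3 \<le> card K"
        then obtain a b c where abc: "a \<in> K" "b \<in> K" "c \<in> K" "a \<noteq> b" "a \<noteq> c" "b \<noteq> c" by (rule card_ge3E)
        then obtain a' b' c' where "a = z a'" "b = z b'" "c = z c'" "a' \<in> A" "b' \<in> A" "c' \<in> A"
          using KE(2) by blast
        then show False using d1[of a' b' c'] abc unfolding K_def by blast
      qed
      then consider "card K = 0" | "card K = 1" | "card K = 2" by linarith
      then have "rd K = int (card K)"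
      proof cases
        case 1
        then show ?thesis using fK D.r_empty by simp
      next
        case 2
        then obtain x where "K = {x}" by (auto simp: card_1_singleton_iff)
        then show ?thesis using D.r_single[of x] KE(1) by auto
      next
        case 3
        then obtain x y where "K = {x, y}" "x \<noteq> y" by (auto simp: card_2_iff)
        then show ?thesis using D.r_pair[of x y] KE(1) by auto
      qed
      then show ?thesis using rX cX by simp
    next
      case False
      \<comment> \<open>With at most one point \<open>w\<close> of \<open>L\<close> missing, the
        last two kinds of dependent sets leave room for at most one \<open>z u\<close>, and only
        with \<open>w\<close> missing and \<open>u\<close> different from \<open>w\<close>.\<close>
      have "K = {} \<or> (\<exists>w \<in> L. J = L - {w} \<and> (\<exists>u \<in> A. u \<noteq> w \<and> K = {z u}))"
      proof (rule ccontr)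
        assume a: "\<not> ?thesis"
        then obtain k where k: "k \<in> A" "z k \<in> K" using KE(2) by blast
        have "J \<noteq> L" using d2[of k] k unfolding K_def J_def by blast
        then obtain w where w: "w \<in> L" "w \<notin> J" using KE(3) by auto
        then have J: "J = L - {w}" using False KE(3) by blast
        have sX: "L - {w} \<subseteq> X" using J unfolding J_def by auto
        have "k \<noteq> w" using d2[of k] k sX unfolding K_def by blast
        have "K = {z k}"
        proof (rule ccontr)
          assume "K \<noteq> {z k}"
          then obtain k' where k': "k' \<in> A" "z k' \<in> K" "z k' \<noteq> z k" using k KE(2) by blast
          have "k' \<noteq> w" using d2[of k'] k' sX unfolding K_def by blast
          moreover have "k' \<noteq> k" using k'(3) by auto
          ultimately show False using d3[of w k k'] w(1) k k' \<open>k \<noteq> w\<close> sX unfolding K_def by auto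
        qed
        then show False using a w(1) J k(1) \<open>k \<noteq> w\<close> by blast
      qed
      then show ?thesis
      proof (elim disjE bexE conjE)
        assume "K = {}"
        then show ?thesis using XJK(1) rdJ[OF KE(3)] by simp
      next
        fix w u assume a: "w \<in> L" "J = L - {w}" "u \<in> A" "u \<noteq> w" "K = {z u}"
        have "X = insert (z u) (L - {w})" using XJK(1) a by simp
        then have "rd X = rd (L - {w}) + 1" using nsp[OF a(3,1,4)] D.not_span_insert by simp
        then show ?thesis using rdJ[of "L - {w}"] cX a by auto
      qed
    qed
  qed
  show "X \<subseteq> L \<union> z ` A \<Longrightarrow> rd X = int (card X) \<longleftrightarrow> \<not> theta_dependent L A z X"
    using dep indep by blast
qed

end

text \<open>Quantifiers over indices match \<open>theta_dependent\<close> after renaming along an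
  enumeration of \<open>L\<close>.\<close>

lemma theta_circuit_subset_iff:
  "(\<exists>C \<in> theta_circuits n. C \<subseteq> Y) \<longleftrightarrow>
     (\<exists>i \<in> {1..n}. \<exists>j \<in> {1..n}. \<exists>k \<in> {1..n}. i \<noteq> j \<and> i \<noteq> k \<and> j \<noteq> k \<and> Theta_w i \<in> Y \<and> Theta_w j \<in> Y \<and> Theta_w k \<in> Y) \<or>
     (\<exists>i \<in> {1..n}. (\<forall>m \<in> {1..n} - {i}. Theta_z m \<in> Y) \<and> Theta_w i \<in> Y) \<or>
     (\<exists>i \<in> {1..n}. \<exists>j \<in> {1..n}. \<exists>k \<in> {1..n}. i \<noteq> j \<and> i \<noteq> k \<and> j \<noteq> k \<and>
        (\<forall>m \<in> {1..n} - {i}. Theta_z m \<in> Y) \<and> Theta_w j \<in> Y \<and> Theta_w k \<in> Y)"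
  (is "?l \<longleftrightarrow> ?a \<or> ?b \<or> ?c")
proof -
  have z: "theta_Z n - {Theta_z i} \<subseteq> Y \<longleftrightarrow> (\<forall>m \<in> {1..n} - {i}. Theta_z m \<in> Y)" for i
    by (auto simp: theta_Z_def)
  have 1: "(\<exists>C. C \<subseteq> theta_W n \<and> card C = 3 \<and> C \<subseteq> Y) \<longleftrightarrow> ?a"
  proof
    assume "\<exists>C. C \<subseteq> theta_W n \<and> card C = 3 \<and> C \<subseteq> Y"
    then obtain C where C: "C \<subseteq> theta_W n" "card C = 3" "C \<subseteq> Y" by auto
    then obtain x y w where xyw: "C = {x, y, w}" "x \<noteq> y" "x \<noteq> w" "y \<noteq> w" by (auto simp: card_3_iff)
    then have "x \<in> theta_W n" "y \<in> theta_W n" "w \<in> theta_W n" using C by auto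
    then obtain i j k where ijk: "i \<in> {1..n}" "j \<in> {1..n}" "k \<in> {1..n}"
      "x = Theta_w i" "y = Theta_w j" "w = Theta_w k" unfolding theta_W_def by blast
    have "i \<noteq> j" "i \<noteq> k" "j \<noteq> k" "Theta_w i \<in> Y" "Theta_w j \<in> Y" "Theta_w k \<in> Y"
      using ijk(4-6) xyw C(3) by auto
    then show ?a using ijk(1-3) by blast
  next
    assume ?a
    then obtain i j k where ijk: "i \<in> {1..n}" "j \<in> {1..n}" "k \<in> {1..n}" "i \<noteq> j" "i \<noteq> k" "j \<noteq> k"
      "Theta_w i \<in> Y" "Theta_w j \<in> Y" "Theta_w k \<in> Y" by blast
    then show "\<exists>C. C \<subseteq> theta_W n \<and> card C = 3 \<and> C \<subseteq> Y"
      by (intro exI[of _ "{Theta_w i, Theta_w j, Theta_w k}"]) (auto simp: theta_W_def)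
  qed
  have 2: "(\<exists>C \<in> {theta_Z n - {Theta_z i} \<union> {Theta_w i} | i. i \<in> {1..n}}. C \<subseteq> Y) \<longleftrightarrow>
     (\<exists>i \<in> {1..n}. theta_Z n - {Theta_z i} \<subseteq> Y \<and> Theta_w i \<in> Y)"
  proof -
    have "(\<exists>C \<in> {g i | i. i \<in> {1..n}}. C \<subseteq> Y) \<longleftrightarrow> (\<exists>i \<in> {1..n}. g i \<subseteq> Y)" for g :: "nat \<Rightarrow> theta_elem set" by blast
    then show ?thesis by (simp only: Un_subset_iff insert_subset empty_subsetI simp_thms)
  qed
  have 3: "(\<exists>C \<in> {theta_Z n - {Theta_z i} \<union> {Theta_w j, Theta_w k} | i j k.
        i \<in> {1..n} \<and> j \<in> {1..n} \<and> k \<in> {1..n} \<and> i \<noteq> j \<and> i \<noteq> k \<and> j \<noteq> k}. C \<subseteq> Y) \<longleftrightarrow>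
     (\<exists>i \<in> {1..n}. \<exists>j \<in> {1..n}. \<exists>k \<in> {1..n}. i \<noteq> j \<and> i \<noteq> k \<and> j \<noteq> k \<and>
        theta_Z n - {Theta_z i} \<subseteq> Y \<and> Theta_w j \<in> Y \<and> Theta_w k \<in> Y)"
    (is "?l3 \<longleftrightarrow> ?r3")
  proof
    assume ?l3
    then obtain i j k where ijk: "i \<in> {1..n}" "j \<in> {1..n}" "k \<in> {1..n}" "i \<noteq> j" "i \<noteq> k" "j \<noteq> k"
      "theta_Z n - {Theta_z i} \<union> {Theta_w j, Theta_w k} \<subseteq> Y" by auto
    then have "theta_Z n - {Theta_z i} \<subseteq> Y" "Theta_w j \<in> Y" "Theta_w k \<in> Y" by auto
    then show ?r3 using ijk(1-6) by blast
  next
    assume ?r3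
    then obtain i j k where ijk: "i \<in> {1..n}" "j \<in> {1..n}" "k \<in> {1..n}" "i \<noteq> j" "i \<noteq> k" "j \<noteq> k"
      "theta_Z n - {Theta_z i} \<subseteq> Y" "Theta_w j \<in> Y" "Theta_w k \<in> Y" by blast
    have "theta_Z n - {Theta_z i} \<union> {Theta_w j, Theta_w k} \<subseteq> Y" using ijk(7-9) by simp
    then show ?l3 using ijk(1-6) by blast
  qed
  have "?l \<longleftrightarrow> (\<exists>C. C \<subseteq> theta_W n \<and> card C = 3 \<and> C \<subseteq> Y) \<or>
     (\<exists>i \<in> {1..n}. theta_Z n - {Theta_z i} \<subseteq> Y \<and> Theta_w i \<in> Y) \<or>
     (\<exists>i \<in> {1..n}. \<exists>j \<in> {1..n}. \<exists>k \<in> {1..n}. i \<noteq> j \<and> i \<noteq> k \<and> j \<noteq> k \<and>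
        theta_Z n - {Theta_z i} \<subseteq> Y \<and> Theta_w j \<in> Y \<and> Theta_w k \<in> Y)"
    unfolding theta_circuits_def bex_Un 2 3 by (simp add: Bex_def conj_assoc disj_assoc)
  then show ?thesis unfolding 1 z .
qed

context matroid
begin

text \<open>An enumeration \<open>h\<close> of \<open>L\<close> sends its points to the
  \<open>Theta_z\<close> and each \<open>z w\<close> to the \<open>Theta_w\<close> with the index of
  \<open>w\<close>. Whether \<open>A\<close> is all of \<open>L\<close> or misses one point decides
  between the two variants.\<close>

lemma theta_separator_of_config:
  assumes c3: "three_connected M" "4 \<le> card (ground M)" and conf: "theta_config (ground M) (irk M)"
  shows "\<exists>S. theta_separator M S"
proof -
  define E where "E = ground M"
  define r where "r = irk M"
  interpret T: tri_connected E r unfolding E_def r_def by (rule tri_connected_irk[OF c3])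
  interpret D: matroid "dual_matroid M" by (rule matroid_dual)
  obtain L A z where rE: "4 \<le> r E" and L: "L \<subseteq> E" "r L = 2" "4 \<le> card L" and A: "A \<subseteq> L" "card L \<le> card A + 1"
    and z: "\<And>w. w \<in> A \<Longrightarrow> z w \<in> E - L \<and> cocirc E r (insert (z w) (L - {w}))"
    using conf unfolding theta_config_def E_def r_def by blast
  note th = T.theta_structure[OF L rE A z]
  have cork: "irk (dual_matroid M) X = T.rd X" for X unfolding irk_dual_apply E_def r_def ..
  have inj: "inj_on z A" by (rule th(1))
  define n where "n = card L"
  define Z where "Z = z ` A"
  define S where "S = L \<union> Z"
  have fL: "finite L" using L T.fin_sub by auto
  obtain h where h: "bij_betw h {1..n} L" using ex_bij_betw_nat_finite_1[OF fL] n_def by auto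
  define ix where "ix = inv_into {1..n} h"
  have hL: "h i \<in> L" if "i \<in> {1..n}" for i using h that by (auto simp: bij_betw_def)
  have ixh: "ix (h i) = i" if "i \<in> {1..n}" for i
    using h that unfolding ix_def by (simp add: bij_betw_def)
  have hix: "h (ix x) = x" "ix x \<in> {1..n}" if "x \<in> L" for x
    using h that unfolding ix_def bij_betw_def by (auto simp: f_inv_into_f inv_into_into)
  have ZL: "Z \<inter> L = {}" "Z \<subseteq> E" using z unfolding Z_def by auto
  define f where "f x = (if x \<in> L then Theta_z (ix x) else Theta_w (ix (inv_into A z x)))" for x
  have fz: "f x = Theta_z (ix x)" if "x \<in> L" for x using that by (simp add: f_def)
  have fw: "f (z x) = Theta_w (ix x)" if "x \<in> A" for x
    using that z[OF that] inj by (simp add: f_def)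
  define I where "I = {i \<in> {1..n}. h i \<in> A}"
  define G where "G = theta_Z n \<union> Theta_w ` I"
  have ixinj: "x = y" if "x \<in> L" "y \<in> L" "ix x = ix y" for x y using hix(1) that by metis
  have "inj_on f S"
  proof (rule inj_onI)
    fix x y assume a: "x \<in> S" "y \<in> S" "f x = f y"
    consider "x \<in> L" "y \<in> L" | x' y' where "x = z x'" "y = z y'" "x' \<in> A" "y' \<in> A"
      | y' where "x \<in> L" "y = z y'" "y' \<in> A" | x' where "y \<in> L" "x = z x'" "x' \<in> A"
      using a unfolding S_def Z_def by auto
    then show "x = y"
    proof cases
      case 1
      then show ?thesis using a(3) fz ixinj by auto
    next
      case 2
      then show ?thesis using a(3) fw ixinj[of x' y'] A by auto
    qed (use a(3) fz fw in auto)
  qed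
  moreover have "f ` S = G"
  proof -
    have "f ` L = theta_Z n"
    proof -
      have "f ` L = Theta_z ` ix ` L" using fz by (auto simp: image_iff)
      also have "ix ` L = {1..n}"
      proof
        show "ix ` L \<subseteq> {1..n}" using hix(2) by auto
        show "{1..n} \<subseteq> ix ` L" using ixh hL by (metis image_eqI subsetI)
      qed
      finally show ?thesis by (simp add: theta_Z_def)
    qed
    moreover have "f ` Z = Theta_w ` I"
    proof -
      have "f ` Z = Theta_w ` ix ` A" using fw by (auto simp: Z_def image_iff)
      also have "ix ` A = I"
      proof
        show "ix ` A \<subseteq> I" using hix A unfolding I_def by auto
        show "I \<subseteq> ix ` A"
        proof
          fix i assume "i \<in> I"
          then have "ix (h i) = i" "h i \<in> A" using ixh by (auto simp: I_def)
          then show "i \<in> ix ` A" by (metis imageI)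
        qed
      qed
      finally show ?thesis .
    qed
    ultimately show ?thesis unfolding S_def G_def by (simp add: image_Un)
  qed
  ultimately have bij: "bij_betw f S G" by (simp add: bij_betw_def)
  have memz: "Theta_z i \<in> f ` X \<longleftrightarrow> h i \<in> X" if i: "i \<in> {1..n}" and X: "X \<subseteq> S" for i X
  proof
    assume "Theta_z i \<in> f ` X"
    then obtain x where x: "x \<in> X" "Theta_z i = f x" by auto
    then have "x \<in> L" by (cases "x \<in> L") (auto simp: f_def)
    then show "h i \<in> X" using x fz hix(1) by auto
  next
    assume "h i \<in> X"
    moreover have "f (h i) = Theta_z i" using fz[OF hL[OF i]] ixh[OF i] by simp
    ultimately show "Theta_z i \<in> f ` X" by (metis imageI)
  qed
  have memw: "Theta_w i \<in> f ` X \<longleftrightarrow> h i \<in> A \<and> z (h i) \<in> X" if i: "i \<in> {1..n}" and X: "X \<subseteq> S" for i X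
  proof
    assume "Theta_w i \<in> f ` X"
    then obtain x where x: "x \<in> X" "Theta_w i = f x" by auto
    then have "x \<notin> L" by (auto simp: f_def)
    then obtain w where w: "x = z w" "w \<in> A" using x X unfolding S_def Z_def by auto
    then have "h i = w" using x fw hix(1) A by auto
    then show "h i \<in> A \<and> z (h i) \<in> X" using w x by simp
  next
    assume a: "h i \<in> A \<and> z (h i) \<in> X"
    then have "f (z (h i)) = Theta_w i" using fw[of "h i"] ixh[OF i] by simp
    then show "Theta_w i \<in> f ` X" using a by (metis imageI)
  qed
  have exL: "(\<exists>i \<in> {1..n}. P (h i)) \<longleftrightarrow> (\<exists>x \<in> L. P x)" for P using hL hix by metis
  have heq: "h i = h j \<longleftrightarrow> i = j" if "i \<in> {1..n}" "j \<in> {1..n}" for i j using ixh that by metis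
  have allL: "(\<forall>m \<in> {1..n} - {i}. h m \<in> X) \<longleftrightarrow> L - {h i} \<subseteq> X" if i: "i \<in> {1..n}" for i X
  proof
    assume a: "\<forall>m \<in> {1..n} - {i}. h m \<in> X"
    show "L - {h i} \<subseteq> X"
    proof
      fix x assume x: "x \<in> L - {h i}"
      then have "ix x \<noteq> i" using hix(1)[of x] by auto
      then show "x \<in> X" using a hix[of x] x by (metis Diff_iff singletonD)
    qed
  next
    assume "L - {h i} \<subseteq> X"
    then show "\<forall>m \<in> {1..n} - {i}. h m \<in> X" using hL heq[OF _ i] by blast
  qed
  have circ: "(\<exists>C \<in> theta_circuits n. C \<subseteq> f ` X) \<longleftrightarrow> theta_dependent L A z X" if X: "X \<subseteq> S" for X
  proof -
    have a: "(\<exists>i \<in> {1..n}. \<exists>j \<in> {1..n}. \<exists>k \<in> {1..n}. i \<noteq> j \<and> i \<noteq> k \<and> j \<noteq> k \<and> Theta_w i \<in> f ` X \<and> Theta_w j \<in> f ` X \<and> Theta_w k \<in> f ` X) \<longleftrightarrow>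
      (\<exists>u \<in> L. \<exists>v \<in> L. \<exists>w \<in> L. u \<noteq> v \<and> u \<noteq> w \<and> v \<noteq> w \<and> (u \<in> A \<and> z u \<in> X) \<and> (v \<in> A \<and> z v \<in> X) \<and> (w \<in> A \<and> z w \<in> X))"
      unfolding exL[symmetric] using memw[OF _ X] heq by (intro bex_cong refl) simp
    have b: "(\<exists>i \<in> {1..n}. (\<forall>m \<in> {1..n} - {i}. Theta_z m \<in> f ` X) \<and> Theta_w i \<in> f ` X) \<longleftrightarrow>
      (\<exists>w \<in> L. L - {w} \<subseteq> X \<and> w \<in> A \<and> z w \<in> X)"
      unfolding exL[symmetric] using memw[OF _ X] memz[OF _ X] allL by (intro bex_cong refl) simp
    have c: "(\<exists>i \<in> {1..n}. \<exists>j \<in> {1..n}. \<exists>k \<in> {1..n}. i \<noteq> j \<and> i \<noteq> k \<and> j \<noteq> k \<and>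
        (\<forall>m \<in> {1..n} - {i}. Theta_z m \<in> f ` X) \<and> Theta_w j \<in> f ` X \<and> Theta_w k \<in> f ` X) \<longleftrightarrow>
      (\<exists>w \<in> L. \<exists>u \<in> L. \<exists>v \<in> L. w \<noteq> u \<and> w \<noteq> v \<and> u \<noteq> v \<and> L - {w} \<subseteq> X \<and> (u \<in> A \<and> z u \<in> X) \<and> (v \<in> A \<and> z v \<in> X))"
      unfolding exL[symmetric] using memw[OF _ X] memz[OF _ X] allL heq by (intro bex_cong refl) simp
    show ?thesis unfolding theta_circuit_subset_iff a b c theta_dependent_def using A(1) by blast
  qed
  define N where "N = restrict_matroid (dual_matroid M) S"
  have SE: "S \<subseteq> E" using L ZL unfolding S_def by auto
  have gN: "ground N = S" using SE by (auto simp: N_def restrict_matroid_def ground_dual E_def)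
  have iN: "X \<in> indep_sets N \<longleftrightarrow> \<not> (\<exists>C \<in> theta_circuits n. C \<subseteq> f ` X)" if X: "X \<subseteq> S" for X
  proof -
    have "X \<in> indep_sets N \<longleftrightarrow> T.rd X = int (card X)"
      using X SE unfolding N_def restrict_matroid_def by (auto simp: D.indep_iff cork ground_dual E_def)
    then show ?thesis using th(4)[of X] X circ[OF X] unfolding S_def Z_def by blast
  qed
  have fG: "f ` X \<subseteq> G" if "X \<subseteq> S" for X using bij that by (auto simp: bij_betw_def)
  have theta: "theta_or_theta_minus n N"
  proof (cases "A = L")
    case True
    then have "I = {1..n}" using hL by (auto simp: I_def)
    then have "ground (theta n) = G" by (simp add: theta_def matroid_of_circuits_def G_def theta_W_def Un_commute)
    moreover have "X \<in> indep_sets N \<longleftrightarrow> f ` X \<in> indep_sets (theta n)" if "X \<subseteq> S" for X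
      using iN[OF that] fG[OF that] calculation by (simp add: theta_def matroid_of_circuits_def)
    ultimately have "matroid_iso N (theta n)" unfolding matroid_iso_def gN using bij by auto
    then show ?thesis by (simp add: theta_or_theta_minus_def)
  next
    case False
    then obtain w where w: "w \<in> L" "w \<notin> A" using A by auto
    have fA: "finite (L - {w})" "A \<subseteq> L - {w}" using w A fL by auto
    have AL: "A = L - {w}" by (rule card_seteq[OF fA]) (use A w fL in auto)
    define k where "k = ix w"
    have k: "k \<in> {1..n}" "h k = w" using hix[OF w(1)] by (auto simp: k_def)
    have I: "I = {1..n} - {k}" using hL heq[OF _ k(1)] k(2) unfolding I_def AL by auto
    have g: "ground (theta n) = theta_W n \<union> theta_Z n" by (simp add: theta_def matroid_of_circuits_def)
    have G: "theta_W n \<union> theta_Z n - {Theta_w k} = G"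
      unfolding G_def I theta_W_def theta_Z_def by auto
    then have gm: "ground (theta_minus n k) = G"
      unfolding theta_minus_def delete_matroid_def restrict_matroid_def g by auto
    have "X \<in> indep_sets N \<longleftrightarrow> f ` X \<in> indep_sets (theta_minus n k)" if "X \<subseteq> S" for X
    proof -
      have "f ` X \<subseteq> theta_W n \<union> theta_Z n - {Theta_w k}" using fG[OF that] G by simp
      then show ?thesis using iN[OF that]
        unfolding theta_minus_def delete_matroid_def restrict_matroid_def g
        by (auto simp: theta_def matroid_of_circuits_def)
    qed
    then have "matroid_iso N (theta_minus n k)" unfolding matroid_iso_def gN gm using bij by auto
    then show ?thesis using k by (auto simp: theta_or_theta_minus_def)
  qed
  have fA: "finite A" using A fL finite_subset by auto
  have cZ: "card Z = card A" unfolding Z_def by (rule card_image[OF inj])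
  have "card A \<le> card L" by (rule card_mono[OF fL A(1)])
  then have n: "n = max (card L) (card Z)" using cZ n_def by simp
  have ranks: "4 \<le> rk M (ground M)" "4 \<le> cork M (ground M)" "rk M L = 2" "cork M Z = 2"
    using rE L(2) th(2,3) cork[of "ground M"] cork[of Z] unfolding E_def r_def Z_def by simp_all
  \<comment> \<open>The roles are swapped: \<open>L\<close> is the rank-2 set \<open>W\<close> of
    the separator, although the isomorphism, taken in the dual, maps it onto the
    \<open>Theta_z\<close>.\<close>
  have "\<exists>W Z n. W \<subseteq> ground M \<and> Z \<subseteq> ground M \<and> S = W \<union> Z \<and>
        rk M W = 2 \<and> cork M Z = 2 \<and> n = max (card W) (card Z) \<and> 3 \<le> n \<and>
        (theta_or_theta_minus n (restrict_matroid M S) \<or>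
         theta_or_theta_minus n (restrict_matroid (dual_matroid M) S))"
    by (rule exI[of _ L], rule exI[of _ Z], rule exI[of _ n])
       (use L ZL ranks n n_def S_def theta N_def E_def in simp)
  then have "theta_separator M S" using c3(1) ranks(1,2) by (simp add: theta_separator_def)
  then show ?thesis by blast
qed

lemma theta_separator_dual: "theta_separator (dual_matroid M) S \<Longrightarrow> theta_separator M S"
proof -
  assume "theta_separator (dual_matroid M) S"
  then obtain W Z n where a: "three_connected M" "4 \<le> cork M (ground M)" "4 \<le> rk M (ground M)"
    "W \<subseteq> ground M" "Z \<subseteq> ground M" "S = W \<union> Z" "cork M W = 2" "rk M Z = 2" "n = max (card W) (card Z)" "3 \<le> n"
    "theta_or_theta_minus n (restrict_matroid (dual_matroid M) S) \<or> theta_or_theta_minus n (restrict_matroid M S)"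
    unfolding theta_separator_def dual_dual ground_dual n_connected_dual by blast
  show "theta_separator M S"
    unfolding theta_separator_def
    by (intro conjI exI[of _ Z] exI[of _ W] exI[of _ n]) (use a in auto)
qed

end

theorem theorem1p5:
  fixes M :: "'a matroid"
  assumes "matroid M"
    and "three_connected M"
    and "\<not> (\<exists>F. fan M F \<and> card F = 4)"
    and "\<not> (\<exists>S. theta_separator M S)"
    and "card {e. elastic M e} = 4"
  shows "path_width_three M"
proof -
  interpret matroid M by fact
  interpret D: matroid "dual_matroid M" by (rule matroid_dual)
  define E where "E = ground M"
  define r where "r = irk M"
  have el: "{e. elastic M e} \<subseteq> E" by (auto simp: elastic_def E_def)
  have fE: "finite E" unfolding E_def by (rule finite_ground)
  have c4: "4 \<le> card E" using card_mono[OF fE el] assms(5) by simp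
  note c3 = assms(2) c4[unfolded E_def]
  have c3d: "three_connected (dual_matroid M)" "4 \<le> card (ground (dual_matroid M))"
    using c3 by (simp_all add: n_connected_dual ground_dual)
  interpret T: tri_connected E r unfolding E_def r_def by (rule tri_connected_irk[OF c3])
  have nofan: "T.rd {b, c, d} \<noteq> 2"
    if a: "{a, b, c, d} \<subseteq> E" "distinct [a, b, c, d]" "r {a, b, c} = 2" for a b c d
  proof
    assume d: "T.rd {b, c, d} = 2"
    have t1: "triangle M {a, b, c}"
      by (rule triangleI[OF c3]) (use a in \<open>auto simp: E_def r_def\<close>)
    have "triangle (dual_matroid M) {b, c, d}"
      by (rule D.triangleI[OF c3d]) (use a d in \<open>auto simp: E_def r_def ground_dual irk_dual_apply\<close>)
    then have t2: "triad M {b, c, d}" by (simp add: triad_def triangle_def)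
    have "if even i then triangle M {[a, b, c, d] ! i, [a, b, c, d] ! (i + 1), [a, b, c, d] ! (i + 2)}
        else triad M {[a, b, c, d] ! i, [a, b, c, d] ! (i + 1), [a, b, c, d] ! (i + 2)}"
      if "i + 2 < length [a, b, c, d]" for i
    proof -
      have "i = 0 \<or> i = 1" using that by auto
      then show ?thesis using t1 t2 by (auto simp: numeral_2_eq_2)
    qed
    moreover have "3 \<le> length [a, b, c, d]" by simp
    ultimately have "fan_ordering M [a, b, c, d]" using a(2) unfolding fan_ordering_def by blast
    then have "fan M {a, b, c, d}" unfolding fan_def by (intro exI[of _ "[a, b, c, d]"]) simp
    moreover have "card {a, b, c, d} = 4" using a(2) by simp
    ultimately show False using assms(3) by blast
  qed
  have "\<not> theta_config E r" using theta_separator_of_config[OF c3] assms(4) unfolding E_def r_def by blast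
  moreover have "\<not> theta_config E (drk E r)"
    using D.theta_separator_of_config[OF c3d] theta_separator_dual assms(4)
    unfolding E_def r_def ground_dual irk_dual by blast
  ultimately interpret F: fan_theta_free E r using nofan by unfold_locales auto
  have sub: "elast E r \<subseteq> {e. elastic M e}" unfolding E_def r_def by (rule elast_subset_elastic[OF c3])
  have "\<exists>es. distinct es \<and> set es = E \<and> T.narrow es"
  proof (cases "elast E r = E")
    case True
    then have "{e. elastic M e} = E" using sub el by blast
    then have "card E = 4" using assms(5) by simp
    obtain es where es: "distinct es" "set es = E" using finite_distinct_list[OF fE] by blast
    \<comment> \<open>Without triples \<open>E\<close> consists of four elements, so any set or its
      complement has at most two, and every ordering works.\<close>
    have "T.lam X \<le> 2" if X: "X \<subseteq> E" for X
    proof (cases "card X \<le> 2")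
      case True
      then show ?thesis using T.lam_le_card[OF X] by simp
    next
      case False
      then have "card (E - X) \<le> 2" using T.card_compl[OF X] \<open>card E = 4\<close> by simp
      then show ?thesis using T.lam_le_card[of "E - X"] T.lam_compl[OF X] by simp
    qed
    moreover have "set (take i es) \<subseteq> E" for i using es(2) set_take_subset by force
    ultimately have "T.narrow es" unfolding T.narrow_def by blast
    then show ?thesis using es by blast
  next
    case False
    then obtain g where "g \<in> E" "g \<notin> elast E r" by (auto simp: elast_def)
    moreover have "card (elast E r) \<le> 4"
      using card_mono[OF finite_subset[OF el fE] sub] assms(5) by simp
    ultimately show ?thesis using F.narrow_of_nonelastic by blast
  qed
  then obtain es where es: "distinct es" "set es = E" "T.narrow es" by blast
  have "separating 3 M (set (take i es))" for i
  proof -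
    have "set (take i es) \<subseteq> ground M" using es(2) set_take_subset unfolding E_def by force
    moreover have "T.lam (set (take i es)) \<le> 2" using es(3) unfolding T.narrow_def by blast
    then have "connectivity M (set (take i es)) \<le> 2" unfolding connectivity_eq E_def r_def .
    ultimately show ?thesis by (simp add: separating_def)
  qed
  then show ?thesis unfolding path_width_three_def using es(1,2) unfolding E_def by blast
qed

end
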